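(* Let $Q$ be a finite symmetric quiver with set of vertices $I$, and let $(\mathcal{H},\star)$ be its rational Cohomological Hall algebra with the sign-twisted product, regarded as a $(\mathbb{Z}_{\geq 0}^I\times\mathbb{Z})$-graded super-commutative algebra. Suppose that $(\mathcal{H},\star)$ is the free super-commutative algebra generated by a $(\mathbb{Z}_{\geq 0}^I\times\mathbb{Z})$-graded vector space $V$ of the form $V=V^{prim}\otimes\mathbb{Q}[x]$, where $x$ is a variable of bidegree $(0,2)$ and, for every $\gamma\in\mathbb{Z}_{\geq 0}^I$, the space $V^{prim}_{\gamma,k}$ is non-zero (and finite-dimensional) only for finitely many $k\in\mathbb{Z}$. If $V^{prim}_{\gamma,k}\neq 0$, then $\gamma\neq 0$, $$k\equiv\chi_Q(\gamma,\gamma)\ \bmod 2,\qquad\text{and}\qquad \chi_Q(\gamma,\gamma)\leq k<\chi_Q(\gamma,\gamma)+2N_\gamma(Q),$$ where for $\gamma\in\mathbb{Z}_{\geq 0}^I\setminus\{0\}$ $$N_\gamma(Q):=\frac12\Big(\sum_{i,j\in I,\ i\neq j}a_{ij}\gamma^i\gamma^j+\sum_{i\in I}\max(a_{ii}-1,0)\,\gamma^i(\gamma^i-1)\Big)-\sum_{i\in I}\gamma^i+2.$$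
   Context: **Quiver.** $Q$ is a finite quiver with set of vertices $I$ and $a_{ij}\in\mathbb{Z}_{\geq 0}$ arrows from $i$ to $j$ ($i,j\in I$). It is symmetric if $a_{ij}=a_{ji}$ for all $i,j$. The Euler form is $\chi_Q(\gamma_1,\gamma_2)=\sum_{i\in I}\gamma_1^i\gamma_2^i-\sum_{i,j\in I}a_{ij}\gamma_1^i\gamma_2^j$ for $\gamma_1,\gamma_2\in\mathbb{Z}^I$; it is symmetric when $Q$ is. **Cohomological Hall algebra.** For $\gamma=(\gamma^i)_{i\in I}\in\mathbb{Z}_{\geq 0}^I$, let $M_\gamma=\prod_{i,j\in I}\mathbb{C}^{a_{ij}\gamma^i\gamma^j}$ be the affine space of representations of $Q$ in the coordinate spaces $\mathbb{C}^{\gamma^i}$, acted on by conjugation by $G_\gamma=\prod_{i\in I}GL(\gamma^i,\mathbb{C})$. Put $\mathcal{H}=\bigoplus_{\gamma\in\mathbb{Z}_{\geq 0}^I}\mathcal{H}_\gamma$, $\mathcal{H}_\gamma:=H^{\bullet}_{G_\gamma}(M_\gamma,\mathbb{Q})$. For $\gamma=\gamma_1+\gamma_2$, let $M_{\gamma_1,\gamma_2}\subset M_\gamma$ be the subspace of representations for which the standard subspaces $\mathbb{C}^{\gamma_1^i}\subset\mathbb{C}^{\gamma^i}$ form a subrepresentation, and $G_{\gamma_1,\gamma_2}\subset G_\gamma$ the subgroup preserving these subspaces. The product $\mathcal{H}_{\gamma_1}\otimes\mathcal{H}_{\gamma_2}\to\mathcal{H}_{\gamma}$ is the composition of the Künneth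 isomorphism, the isomorphism $H^\bullet_{G_{\gamma_1}\times G_{\gamma_2}}(M_{\gamma_1}\times M_{\gamma_2},\mathbb{Q})\cong H^\bullet_{G_{\gamma_1,\gamma_2}}(M_{\gamma_1,\gamma_2},\mathbb{Q})$ and the natural pushforwards $H^\bullet_{G_{\gamma_1,\gamma_2}}(M_{\gamma_1,\gamma_2},\mathbb{Q})\to H^{\bullet+2c_1}_{G_{\gamma_1,\gamma_2}}(M_{\gamma},\mathbb{Q})\to H^{\bullet+2c_1+2c_2}_{G_{\gamma}}(M_{\gamma},\mathbb{Q})$, where $c_1=\dim_{\mathbb C} M_\gamma-\dim_{\mathbb C} M_{\gamma_1,\gamma_2}$, $c_2=\dim_{\mathbb C} G_{\gamma_1,\gamma_2}-\dim_{\mathbb C} G_\gamma$. This makes $\mathcal{H}$ an associative unital $\mathbb{Z}_{\geq 0}^I$-graded $\mathbb{Q}$-algebra. **Explicit description (Kontsevich–Soibelman).** Equivalently, $\mathcal{H}_\gamma=\mathbb{Q}[\{x_{i,\alpha}\}_{i\in I,\,1\leq\alpha\leq\gamma^i}]^{\prod_{i\in I}S_{\gamma^i}}$ (each $x_{i,\alpha}$ has cohomological degree $2$), and for $f_1\in\mathcal{H}_{\gamma_1}$, $f_2\in\mathcal{H}_{\gamma_2}$ the product $f_1\cdot f_2\in\mathcal{H}_{\gamma_1+\gamma_2}$ is the sum over all shuffles (for each $i\in I$, all ways of distributing the variables $x_{i,1},\dots,x_{i,\gamma_1^i+\gamma_2^i}$ into an increasing list $x'_{i,1},\dots,x'_{i,\gamma_1^i}$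 and a complementary increasing list $x''_{i,1},\dots,x''_{i,\gamma_2^i}$) of $$f_1((x'_{i,\alpha}))\,f_2((x''_{i,\alpha}))\,\frac{\prod_{i,j\in I}\prod_{\alpha_1=1}^{\gamma_1^i}\prod_{\alpha_2=1}^{\gamma_2^j}(x''_{j,\alpha_2}-x'_{i,\alpha_1})^{a_{ij}}}{\prod_{i\in I}\prod_{\alpha_1=1}^{\gamma_1^i}\prod_{\alpha_2=1}^{\gamma_2^i}(x''_{i,\alpha_2}-x'_{i,\alpha_1})}.$$ **Bigrading and twisted product (symmetric $Q$).** A homogeneous polynomial $f\in\mathcal{H}_\gamma$ of polynomial degree $d$ has bidegree $(\gamma,2d+\chi_Q(\gamma,\gamma))\in\mathbb{Z}_{\geq 0}^I\times\mathbb{Z}$; the product respects this bigrading. The super-structure (parity) is induced by the $\mathbb{Z}$-grading, so elements of $\mathcal{H}_{\gamma,k}$ have parity $k\equiv\epsilon(\gamma):=\chi_Q(\gamma,\gamma)\bmod 2$. The form $(\gamma_1,\gamma_2)\mapsto\chi_Q(\gamma_1,\gamma_2)+\epsilon(\gamma_1)\epsilon(\gamma_2)\bmod 2$ induces a symmetric bilinear form $\beta$ on $(\mathbb{Z}/2\mathbb{Z})^I$ with $\beta(\gamma,\gamma)=0$ for all $\gamma$. Fix a bilinear form $\psi$ on $(\mathbb{Z}/2\mathbb{Z})^I$ with $\psi(\gamma_1,\gamma_2)+\psi(\gamma_2,\gamma_1)=\beta(\gamma_1,\gamma_2)$, and set $a\star b=(-1)^{\psi(\gamma,\gamma')}a\cdot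 b$ for $a\in\mathcal{H}_{\gamma,k}$, $b\in\mathcal{H}_{\gamma',k'}$. Then $(\mathcal{H},\star)$ is associative and super-commutative: $a\star b=(-1)^{kk'}b\star a$. **Freeness.** $(\mathcal{H},\star)$ is free super-commutative generated by a bigraded subspace $V\subset\mathcal{H}$ if the canonical map from the free unital super-commutative algebra on $V$ (the symmetric algebra on the even part tensored with the exterior algebra on the odd part) to $(\mathcal{H},\star)$ is an isomorphism. $V^{prim}_{\gamma,k}$ denotes the component of bidegree $(\gamma,k)$ of the $(\mathbb{Z}_{\geq 0}^I\times\mathbb{Z})$-graded $\mathbb{Q}$-vector space $V^{prim}$. *)

theory Defs
  imports
    "HOL-Library.Poly_Mapping"
    "HOL-Library.Z2"
    "HOL-Combinatorics.Permutations"
    "HOL-Computational_Algebra.Polynomial"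
begin

section \<open>Symmetric quivers\<close>

text \<open>A quiver on the finite vertex type \<open>'i\<close> is given by its numbers of arrows:
  \<open>a i j\<close> arrows from \<open>i\<close> to \<open>j\<close>.\<close>

definition symmetric_quiver :: "('i::finite \<Rightarrow> 'i \<Rightarrow> nat) \<Rightarrow> bool" where
  "symmetric_quiver a \<longleftrightarrow> (\<forall>i j. a i j = a j i)"

definition euler_form :: "('i::finite \<Rightarrow> 'i \<Rightarrow> nat) \<Rightarrow> ('i \<Rightarrow> int) \<Rightarrow> ('i \<Rightarrow> int) \<Rightarrow> int" where
  "euler_form a g h = (\<Sum>i\<in>UNIV. g i * h i) - (\<Sum>i\<in>UNIV. \<Sum>j\<in>UNIV. int (a i j) * g i * h j)"

abbreviation chi :: "('i::finite \<Rightarrow> 'i \<Rightarrow> nat) \<Rightarrow> ('i \<Rightarrow> nat) \<Rightarrow> ('i \<Rightarrow> nat) \<Rightarrow> int" where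
  "chi a \<gamma> \<gamma>' \<equiv> euler_form a (\<lambda>i. int (\<gamma> i)) (\<lambda>i. int (\<gamma>' i))"

definition N_bound :: "('i::finite \<Rightarrow> 'i \<Rightarrow> nat) \<Rightarrow> ('i \<Rightarrow> nat) \<Rightarrow> rat" where
  "N_bound a \<gamma> =
     1 / 2 * (of_nat (\<Sum>(i, j)\<in>{(i, j). i \<noteq> j}. a i j * \<gamma> i * \<gamma> j)
       + of_int (\<Sum>i\<in>UNIV. max (int (a i i) - 1) 0 * (int (\<gamma> i) * (int (\<gamma> i) - 1))))
     - of_nat (\<Sum>i\<in>UNIV. \<gamma> i) + 2"


section \<open>Multivariate polynomials over the rationals\<close>

abbreviation "lookup \<equiv> Poly_Mapping.lookup"
abbreviation "keys \<equiv> Poly_Mapping.keys"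

text \<open>A monomial is a finitely supported exponent vector.\<close>

type_synonym 'v mpol = "('v \<Rightarrow>\<^sub>0 nat) \<Rightarrow>\<^sub>0 rat"

definition Var :: "'v \<Rightarrow> 'v mpol" where
  "Var v = Poly_Mapping.single (Poly_Mapping.single v 1) 1"

definition Const :: "rat \<Rightarrow> 'v mpol" where
  "Const c = Poly_Mapping.single 0 c"

definition subst :: "('v \<Rightarrow> 'u mpol) \<Rightarrow> 'v mpol \<Rightarrow> 'u mpol" where
  "subst s f = (\<Sum>m\<in>keys f. Const (lookup f m) * (\<Prod>v\<in>keys m. s v ^ lookup m v))"

definition mon_degree :: "('v \<Rightarrow>\<^sub>0 nat) \<Rightarrow> nat" where
  "mon_degree m = (\<Sum>v\<in>keys m. lookup m v)"


section \<open>The underlying graded space of the Cohomological Hall algebra\<close>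

text \<open>The variable \<open>x\<^sub>i\<^sub>,\<^sub>\<alpha>\<close> is indexed by the pair \<open>(i, \<alpha>)\<close>, with \<open>\<alpha>\<close> counted from \<open>0\<close>.\<close>

definition coha_comp :: "('i \<Rightarrow> nat) \<Rightarrow> ('i \<times> nat) mpol set" where
  "coha_comp \<gamma> = {f.
     (\<forall>m\<in>keys f. keys m \<subseteq> {(i, \<alpha>). \<alpha> < \<gamma> i}) \<and>
     (\<forall>\<pi>. (\<forall>i. \<pi> i permutes {..<\<gamma> i}) \<longrightarrow> subst (\<lambda>(i, \<alpha>). Var (i, \<pi> i \<alpha>)) f = f)}"

text \<open>Elements of the direct sum are finitely supported families, whose member at \<open>\<gamma>\<close> lies in
  \<open>coha_comp \<gamma>\<close>; their product is \<open>coha_star\<close> below.\<close>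

type_synonym 'i coha = "('i \<Rightarrow> nat) \<Rightarrow>\<^sub>0 ('i \<times> nat) mpol"

definition coha_space :: "'i coha set" where
  "coha_space = {h. \<forall>\<gamma>. lookup h \<gamma> \<in> coha_comp \<gamma>}"

definition coha_scale :: "rat \<Rightarrow> 'i coha \<Rightarrow> 'i coha" where
  "coha_scale c h = Poly_Mapping.map (\<lambda>f. Const c * f) h"

lemma lookup_coha_scale: "lookup (coha_scale c h) \<gamma> = Const c * lookup h \<gamma>"
  by (simp add: coha_scale_def Poly_Mapping.map.rep_eq when_def)

interpretation coha: vector_space coha_scale
  by unfold_locales
    (auto intro!: poly_mapping_eqI
      simp: lookup_coha_scale lookup_add Const_def algebra_simps single_add mult_single
        simp flip: mult.assoc)

definition coha_bideg :: "('i::finite \<Rightarrow> 'i \<Rightarrow> nat) \<Rightarrow> ('i \<Rightarrow> nat) \<Rightarrow> int \<Rightarrow> 'i coha set" where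
  "coha_bideg a \<gamma> k = {Poly_Mapping.single \<gamma> f | f.
     f \<in> coha_comp \<gamma> \<and> (\<forall>m\<in>keys f. 2 * int (mon_degree m) + chi a \<gamma> \<gamma> = k)}"


section \<open>The shuffle product and its sign twist\<close>

text \<open>A shuffle is recorded by the sets \<open>S i\<close> of the positions of the variables \<open>x'\<close>.\<close>

definition shuffle_sets :: "('i \<Rightarrow> nat) \<Rightarrow> ('i \<Rightarrow> nat) \<Rightarrow> ('i \<Rightarrow> nat set) set" where
  "shuffle_sets \<gamma>1 \<gamma>2 = {S. \<forall>i. S i \<subseteq> {..<\<gamma>1 i + \<gamma>2 i} \<and> card (S i) = \<gamma>1 i}"

definition var1 :: "('i \<Rightarrow> nat set) \<Rightarrow> 'i \<times> nat \<Rightarrow> ('i \<times> nat) mpol" where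
  "var1 S = (\<lambda>(i, \<alpha>). Var (i, sorted_list_of_set (S i) ! \<alpha>))"

definition var2 :: "('i \<Rightarrow> nat) \<Rightarrow> ('i \<Rightarrow> nat) \<Rightarrow> ('i \<Rightarrow> nat set) \<Rightarrow> 'i \<times> nat \<Rightarrow> ('i \<times> nat) mpol" where
  "var2 \<gamma>1 \<gamma>2 S = (\<lambda>(i, \<alpha>). Var (i, sorted_list_of_set ({..<\<gamma>1 i + \<gamma>2 i} - S i) ! \<alpha>))"

definition shuffle_num ::
  "('i::finite \<Rightarrow> 'i \<Rightarrow> nat) \<Rightarrow> ('i \<Rightarrow> nat) \<Rightarrow> ('i \<Rightarrow> nat) \<Rightarrow> ('i \<Rightarrow> nat set) \<Rightarrow> ('i \<times> nat) mpol" where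
  "shuffle_num a \<gamma>1 \<gamma>2 S =
     (\<Prod>i\<in>UNIV. \<Prod>j\<in>UNIV. \<Prod>\<alpha>1<\<gamma>1 i. \<Prod>\<alpha>2<\<gamma>2 j.
        (var2 \<gamma>1 \<gamma>2 S (j, \<alpha>2) - var1 S (i, \<alpha>1)) ^ a i j)"

definition shuffle_den ::
  "('i::finite \<Rightarrow> nat) \<Rightarrow> ('i \<Rightarrow> nat) \<Rightarrow> ('i \<Rightarrow> nat set) \<Rightarrow> ('i \<times> nat) mpol" where
  "shuffle_den \<gamma>1 \<gamma>2 S =
     (\<Prod>i\<in>UNIV. \<Prod>\<alpha>1<\<gamma>1 i. \<Prod>\<alpha>2<\<gamma>2 i. var2 \<gamma>1 \<gamma>2 S (i, \<alpha>2) - var1 S (i, \<alpha>1))"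

text \<open>The product of \<open>f1\<close> and \<open>f2\<close> is the sum over all shuffles \<open>S\<close> of the rational functions
  \<open>f1(x') * f2(x'') * shuffle_num / shuffle_den\<close>. This sum is a polynomial, and it is
  determined by the equation obtained by multiplying with the product of all the denominators.\<close>

definition coha_mult ::
  "('i::finite \<Rightarrow> 'i \<Rightarrow> nat) \<Rightarrow> ('i \<Rightarrow> nat) \<Rightarrow> ('i \<Rightarrow> nat) \<Rightarrow>
     ('i \<times> nat) mpol \<Rightarrow> ('i \<times> nat) mpol \<Rightarrow> ('i \<times> nat) mpol" where
  "coha_mult a \<gamma>1 \<gamma>2 f1 f2 = (THE h.
     h * (\<Prod>T\<in>shuffle_sets \<gamma>1 \<gamma>2. shuffle_den \<gamma>1 \<gamma>2 T) =
     (\<Sum>S\<in>shuffle_sets \<gamma>1 \<gamma>2.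
        subst (var1 S) f1 * subst (var2 \<gamma>1 \<gamma>2 S) f2 * shuffle_num a \<gamma>1 \<gamma>2 S *
        (\<Prod>T\<in>shuffle_sets \<gamma>1 \<gamma>2 - {S}. shuffle_den \<gamma>1 \<gamma>2 T)))"

definition bilinear_form2 :: "(('i \<Rightarrow> bit) \<Rightarrow> ('i \<Rightarrow> bit) \<Rightarrow> bit) \<Rightarrow> bool" where
  "bilinear_form2 \<psi> \<longleftrightarrow>
     (\<forall>u v w. \<psi> (\<lambda>i. u i + v i) w = \<psi> u w + \<psi> v w) \<and>
     (\<forall>u v w. \<psi> w (\<lambda>i. u i + v i) = \<psi> w u + \<psi> w v) \<and>
     (\<forall>c u w. \<psi> (\<lambda>i. c * u i) w = c * \<psi> u w \<and> \<psi> w (\<lambda>i. c * u i) = c * \<psi> w u)"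

abbreviation mod2 :: "('i \<Rightarrow> nat) \<Rightarrow> 'i \<Rightarrow> bit" where
  "mod2 \<gamma> \<equiv> \<lambda>i. of_nat (\<gamma> i)"

definition sign_form ::
  "('i::finite \<Rightarrow> 'i \<Rightarrow> nat) \<Rightarrow> (('i \<Rightarrow> bit) \<Rightarrow> ('i \<Rightarrow> bit) \<Rightarrow> bit) \<Rightarrow> bool" where
  "sign_form a \<psi> \<longleftrightarrow> bilinear_form2 \<psi> \<and>
     (\<forall>\<gamma>1 \<gamma>2. \<psi> (mod2 \<gamma>1) (mod2 \<gamma>2) + \<psi> (mod2 \<gamma>2) (mod2 \<gamma>1) =
        of_int (chi a \<gamma>1 \<gamma>2 + chi a \<gamma>1 \<gamma>1 * chi a \<gamma>2 \<gamma>2))"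

definition coha_star ::
  "('i::finite \<Rightarrow> 'i \<Rightarrow> nat) \<Rightarrow> (('i \<Rightarrow> bit) \<Rightarrow> ('i \<Rightarrow> bit) \<Rightarrow> bit) \<Rightarrow>
     'i coha \<Rightarrow> 'i coha \<Rightarrow> 'i coha" where
  "coha_star a \<psi> x y =
     (\<Sum>\<gamma>1\<in>keys x. \<Sum>\<gamma>2\<in>keys y. Poly_Mapping.single (\<lambda>i. \<gamma>1 i + \<gamma>2 i)
        ((if \<psi> (mod2 \<gamma>1) (mod2 \<gamma>2) = 0 then 1 else - 1) *
         coha_mult a \<gamma>1 \<gamma>2 (lookup x \<gamma>1) (lookup y \<gamma>2)))"

definition coha_one :: "'i coha" where
  "coha_one = Poly_Mapping.single (\<lambda>_. 0) 1"


section \<open>Graded subspaces and freeness\<close>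

text \<open>The set \<open>U\<close> is the internal direct sum of the \<open>C p\<close>.\<close>

definition is_direct_sum :: "'v::comm_monoid_add set \<Rightarrow> ('p \<Rightarrow> 'v set) \<Rightarrow> bool" where
  "is_direct_sum U C \<longleftrightarrow> (\<forall>p. C p \<subseteq> U) \<and>
     (\<forall>u\<in>U. \<exists>!c. finite {p. c p \<noteq> 0} \<and> (\<forall>p. c p \<in> C p) \<and> u = (\<Sum>p | c p \<noteq> 0. c p))"

definition bigraded_subspace :: "('i::finite \<Rightarrow> 'i \<Rightarrow> nat) \<Rightarrow> 'i coha set \<Rightarrow> bool" where
  "bigraded_subspace a V \<longleftrightarrow> V \<subseteq> coha_space \<and> coha.subspace V \<and>
     is_direct_sum V (\<lambda>(\<gamma>, k). V \<inter> coha_bideg a \<gamma> k)"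

text \<open>Rational linear combinations of words; the words with letters in \<open>V\<close> span the free
  associative algebra on the set \<open>V\<close>.\<close>

definition word_scale :: "rat \<Rightarrow> ('x list \<Rightarrow>\<^sub>0 rat) \<Rightarrow> ('x list \<Rightarrow>\<^sub>0 rat)" where
  "word_scale c u = Poly_Mapping.map ((*) c) u"

lemma lookup_word_scale: "lookup (word_scale c u) w = c * lookup u w"
  by (simp add: word_scale_def Poly_Mapping.map.rep_eq when_def)

interpretation word: vector_space word_scale
  by unfold_locales
    (auto intro!: poly_mapping_eqI simp: lookup_word_scale lookup_add algebra_simps)

abbreviation word :: "'x list \<Rightarrow> ('x list \<Rightarrow>\<^sub>0 rat)" where
  "word w \<equiv> Poly_Mapping.single w 1"

definition word_space :: "'x set \<Rightarrow> ('x list \<Rightarrow>\<^sub>0 rat) set" where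
  "word_space V = {u. keys u \<subseteq> lists V}"

text \<open>The free super-commutative algebra on \<open>V\<close> is the quotient of the words in \<open>V\<close> by the
  two-sided ideal below. Its first two families of generators make the letters linear, which
  gives the tensor algebra of \<open>V\<close>; the third one makes the letters super-commute. For odd
  \<open>v = w\<close> this yields \<open>2 v v = 0\<close> and hence \<open>v v = 0\<close>, so that the quotient is the symmetric
  algebra of the even part tensored with the exterior algebra of the odd part.\<close>

definition supercomm_ideal ::
  "('i::finite \<Rightarrow> 'i \<Rightarrow> nat) \<Rightarrow> 'i coha set \<Rightarrow> ('i coha list \<Rightarrow>\<^sub>0 rat) set" where
  "supercomm_ideal a V = word.span (
     {word (p @ [v + w] @ q) - word (p @ [v] @ q) - word (p @ [w] @ q) | p q v w.
        p \<in> lists V \<and> q \<in> lists V \<and> v \<in> V \<and> w \<in> V} \<union>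
     {word (p @ [coha_scale c v] @ q) - word_scale c (word (p @ [v] @ q)) | p q v c.
        p \<in> lists V \<and> q \<in> lists V \<and> v \<in> V} \<union>
     {word (p @ [v, w] @ q) - word_scale (if odd k \<and> odd l then - 1 else 1) (word (p @ [w, v] @ q))
        | p q v w \<gamma> k \<delta> l. p \<in> lists V \<and> q \<in> lists V \<and>
            v \<in> V \<inter> coha_bideg a \<gamma> k \<and> w \<in> V \<inter> coha_bideg a \<delta> l})"

definition canonical_map ::
  "('i::finite \<Rightarrow> 'i \<Rightarrow> nat) \<Rightarrow> (('i \<Rightarrow> bit) \<Rightarrow> ('i \<Rightarrow> bit) \<Rightarrow> bit) \<Rightarrow>
     ('i coha list \<Rightarrow>\<^sub>0 rat) \<Rightarrow> 'i coha" where
  "canonical_map a \<psi> u =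
     (\<Sum>w\<in>keys u. coha_scale (lookup u w) (foldr (coha_star a \<psi>) w coha_one))"

text \<open>The map induced on the quotient by \<open>supercomm_ideal a V\<close> is an isomorphism.\<close>

definition free_supercomm_generated ::
  "('i::finite \<Rightarrow> 'i \<Rightarrow> nat) \<Rightarrow> (('i \<Rightarrow> bit) \<Rightarrow> ('i \<Rightarrow> bit) \<Rightarrow> bit) \<Rightarrow> 'i coha set \<Rightarrow> bool" where
  "free_supercomm_generated a \<psi> V \<longleftrightarrow>
     canonical_map a \<psi> ` word_space V = coha_space \<and>
     {u \<in> word_space V. canonical_map a \<psi> u = 0} = supercomm_ideal a V"


section \<open>Spaces of the form \<open>W \<otimes> \<rat>[x]\<close>\<close>

definition bigraded_space ::
  "(rat \<Rightarrow> 'w::ab_group_add \<Rightarrow> 'w) \<Rightarrow> (('i \<Rightarrow> nat) \<Rightarrow> int \<Rightarrow> 'w set) \<Rightarrow> bool" where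
  "bigraded_space scale W \<longleftrightarrow> vector_space scale \<and>
     (\<forall>\<gamma> k. module.subspace scale (W \<gamma> k)) \<and> is_direct_sum UNIV (\<lambda>(\<gamma>, k). W \<gamma> k)"

text \<open>The tensor product with \<open>\<rat>[x]\<close> is the type \<open>'w poly\<close> of polynomials with coefficients in
  \<open>'w\<close>; as \<open>x\<close> has bidegree \<open>(0, 2)\<close>, its part of bidegree \<open>(\<gamma>, k)\<close> is as follows.\<close>

definition tensor_x_bideg ::
  "(('i \<Rightarrow> nat) \<Rightarrow> int \<Rightarrow> 'w::zero set) \<Rightarrow> ('i \<Rightarrow> nat) \<Rightarrow> int \<Rightarrow> 'w poly set" where
  "tensor_x_bideg W \<gamma> k = {p. \<forall>n. coeff p n \<in> W \<gamma> (k - 2 * int n)}"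

definition bigraded_iso_tensor_x ::
  "('i::finite \<Rightarrow> 'i \<Rightarrow> nat) \<Rightarrow> (rat \<Rightarrow> 'w::ab_group_add \<Rightarrow> 'w) \<Rightarrow>
     (('i \<Rightarrow> nat) \<Rightarrow> int \<Rightarrow> 'w set) \<Rightarrow> 'i coha set \<Rightarrow> ('w poly \<Rightarrow> 'i coha) \<Rightarrow> bool" where
  "bigraded_iso_tensor_x a scale W V \<phi> \<longleftrightarrow> bij_betw \<phi> UNIV V \<and>
     (\<forall>p q. \<phi> (p + q) = \<phi> p + \<phi> q) \<and>
     (\<forall>c p. \<phi> (map_poly (scale c) p) = coha_scale c (\<phi> p)) \<and>
     (\<forall>\<gamma> k. \<phi> ` tensor_x_bideg W \<gamma> k = V \<inter> coha_bideg a \<gamma> k)"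

definition fin_dim :: "(rat \<Rightarrow> 'w::ab_group_add \<Rightarrow> 'w) \<Rightarrow> 'w set \<Rightarrow> bool" where
  "fin_dim scale U \<longleftrightarrow> (\<exists>B. finite B \<and> B \<subseteq> U \<and> module.span scale B = U)"

end

theory Submission
  imports Defs "HOL-Library.Countable"
begin

text \<open>Let \<open>D\<close> be the span of the products of two elements without component in dimension zero. As the
  algebra is free on \<open>V\<close>, its elements without component in dimension zero form the direct sum of
  \<open>V\<close> and \<open>D\<close> (\<open>plus_eq_V_plus_decomposables\<close>, \<open>V_Int_decomposables\<close>). A non-zero element of
  \<open>Vprim \<gamma> k\<close> yields a non-zero generator of bidegree \<open>(\<gamma>, k)\<close>, that is, a symmetric polynomial of
  degree \<open>(k - \<chi>(\<gamma>, \<gamma>)) / 2\<close>. This gives the parity and the lower bound, and \<open>\<gamma> \<noteq> 0\<close> because a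
  constant among the generators would be related to the unit.

  For the upper bound, let \<open>\<sigma>\<close> be the sum of all variables. Multiplication by \<open>\<sigma>\<close> is a derivation of
  the algebra, so it preserves \<open>D\<close>. The main point (\<open>high_degree_reducible\<close>) is that a symmetric
  polynomial of degree at least \<open>N\<^sub>\<gamma>(Q)\<close> is a multiple of \<open>\<sigma>\<close> plus an element of \<open>D\<close>. Symmetrizing a
  polynomial multiple of a shuffle kernel produces an element of \<open>D\<close>
  (\<open>symmetrized_kernel_decomposable\<close>). Hence it suffices that the monomials of such a degree lie in
  the ideal, in the ring of all polynomials, generated by \<open>\<sigma>\<close> and polynomial multiples of the
  kernels. Such multiples are the products of \<open>x\<^sub>v - x\<^sub>u\<close> over the edges between the two sides of a
  cut, in the graph on the variables with \<open>a i j\<close> edges between \<open>x\<^sub>i\<^sub>,\<^sub>\<alpha>\<close> and \<open>x\<^sub>j\<^sub>,\<^sub>\<beta>\<close> for \<open>i \<noteq> j\<close> and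
  \<open>max (a i i - 1) 0\<close> edges for \<open>i = j\<close>. If this graph has \<open>n\<close> vertices and \<open>E\<close> edges, then
  \<open>N\<^sub>\<gamma>(Q) = E - n + 2\<close>, and from this degree on \<open>\<sigma>\<close> and the cuts generate all monomials: this holds for
  every graph, by induction on the edges (\<open>monomials_in_cut_ideal\<close>).

  Since \<open>D\<close> is bigraded, for \<open>k \<ge> \<chi>(\<gamma>, \<gamma>) + 2 N\<^sub>\<gamma>(Q)\<close> every element of \<open>V\<^sub>\<gamma>\<^sub>,\<^sub>k\<close> is congruent modulo \<open>D\<close> to
  \<open>\<sigma>\<close> times an element of \<open>V\<^sub>\<gamma>\<^sub>,\<^sub>k\<^sub>-\<^sub>2\<close>, so \<open>V\<^sub>\<gamma>\<^sub>,\<^sub>k\<close> has at most the dimension of \<open>V\<^sub>\<gamma>\<^sub>,\<^sub>k\<^sub>-\<^sub>2\<close>. But its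
  dimension is that of \<open>V\<^sub>\<gamma>\<^sub>,\<^sub>k\<^sub>-\<^sub>2\<close> plus that of \<open>Vprim \<gamma> k\<close>, which therefore vanishes
  (\<open>no_new_generators\<close>).

  The product is a sum of rational functions, and it is handled through values at points with
  distinct coordinates. A symmetric polynomial becomes a function of a family of finite sets of
  rationals, one for each vertex, and the product becomes a sum over the ways to split the family
  in two, weighted by a kernel that is multiplicative in both halves (\<open>hat_star\<close>). Associativity and
  the derivation property can be read off from this. That the product is a polynomial at all is
  the content of \<open>vanish_on_diagonal\<close> and \<open>coha_mult_eval\<close>.\<close>

section \<open>Evaluation of polynomials\<close>

abbreviation "single \<equiv> Poly_Mapping.single"

definition monom_at :: "('v \<Rightarrow> rat) \<Rightarrow> ('v \<Rightarrow>\<^sub>0 nat) \<Rightarrow> rat" where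
  "monom_at x m = (\<Prod>v\<in>keys m. x v ^ lookup m v)"

definition eval_at :: "('v \<Rightarrow> rat) \<Rightarrow> 'v mpol \<Rightarrow> rat" where
  "eval_at x f = (\<Sum>m\<in>keys f. lookup f m * monom_at x m)"

lemma monom_at_superset:
  assumes "finite S" "keys m \<subseteq> S"
  shows "monom_at x m = (\<Prod>v\<in>S. x v ^ lookup m v)"
  unfolding monom_at_def
  by (rule prod.mono_neutral_left) (use assms in \<open>auto simp: in_keys_iff\<close>)

lemma monom_at_add: "monom_at x (m + n) = monom_at x m * monom_at x n"
proof -
  let ?S = "keys m \<union> keys n"
  have "keys (m + n) \<subseteq> ?S"
    by (rule Poly_Mapping.keys_add)
  then show ?thesis
    by (subst (1 2 3) monom_at_superset[of ?S])
      (auto simp: lookup_add power_add prod.distrib)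
qed

lemma monom_at_0 [simp]: "monom_at x 0 = 1"
  by (simp add: monom_at_def)

lemma eval_at_superset:
  assumes "finite S" "keys f \<subseteq> S"
  shows "eval_at x f = (\<Sum>m\<in>S. lookup f m * monom_at x m)"
  unfolding eval_at_def
  by (rule sum.mono_neutral_left) (use assms in \<open>auto simp: in_keys_iff\<close>)

lemma eval_at_0 [simp]: "eval_at x 0 = 0"
  by (simp add: eval_at_def)

lemma eval_at_add [simp]: "eval_at x (f + g) = eval_at x f + eval_at x g"
proof -
  let ?S = "keys f \<union> keys g"
  have "keys (f + g) \<subseteq> ?S"
    by (rule Poly_Mapping.keys_add)
  then show ?thesis
    by (subst (1 2 3) eval_at_superset[of ?S])
      (auto simp: lookup_add sum.distrib distrib_right)
qed

lemma eval_at_sum [simp]: "eval_at x (\<Sum>i\<in>I. f i) = (\<Sum>i\<in>I. eval_at x (f i))"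
  by (induction I rule: infinite_finite_induct) auto

lemma eval_at_uminus [simp]: "eval_at x (- f) = - eval_at x f"
  using eval_at_add[of x f "- f"] by (simp del: eval_at_add)

lemma eval_at_diff [simp]: "eval_at x (f - g) = eval_at x f - eval_at x g"
  using eval_at_add[of x f "- g"] by (simp del: eval_at_add)

lemma eval_at_single [simp]: "eval_at x (single m c) = c * monom_at x m"
  by (subst eval_at_superset[of "{m}"]) auto

lemma poly_mapping_as_sum: "f = (\<Sum>m\<in>keys f. single m (lookup f m))"
  by (rule poly_mapping_eqI)
    (auto simp: lookup_sum lookup_single when_def in_keys_iff sum.delta)

lemma eval_at_mult [simp]: "eval_at x (f * g) = eval_at x f * eval_at x g"
proof -
  have "f * g = (\<Sum>m\<in>keys f. \<Sum>n\<in>keys g.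
      single (m + n) (lookup f m * lookup g n))"
    by (subst poly_mapping_as_sum[of f], subst poly_mapping_as_sum[of g])
      (simp add: sum_product mult_single)
  then have "eval_at x (f * g) = (\<Sum>m\<in>keys f. \<Sum>n\<in>keys g.
      (lookup f m * monom_at x m) * (lookup g n * monom_at x n))"
    by (simp add: monom_at_add mult_ac)
  then show ?thesis
    by (simp add: eval_at_def sum_product)
qed

lemma eval_at_Const [simp]: "eval_at x (Const c) = c"
  by (simp add: Const_def)

lemma eval_at_1 [simp]: "eval_at x 1 = 1"
  using eval_at_Const[of x 1] by (simp add: Const_def)

lemma eval_at_power [simp]: "eval_at x (f ^ n) = eval_at x f ^ n"
  by (induction n) auto

lemma eval_at_prod [simp]: "eval_at x (\<Prod>i\<in>I. f i) = (\<Prod>i\<in>I. eval_at x (f i))"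
  by (induction I rule: infinite_finite_induct) auto

lemma eval_at_Var [simp]: "eval_at x (Var v) = x v"
  by (simp add: Var_def monom_at_def)

lemma eval_at_subst [simp]: "eval_at x (subst s f) = eval_at (\<lambda>v. eval_at x (s v)) f"
  by (simp add: subst_def eval_at_def[of _ f] monom_at_def)

lemma eval_at_cong:
  assumes "\<And>m v. m \<in> keys f \<Longrightarrow> v \<in> keys m \<Longrightarrow> x v = y v"
  shows "eval_at x f = eval_at y f"
  unfolding eval_at_def monom_at_def
  by (intro sum.cong prod.cong refl arg_cong2[of _ _ _ _ "(*)"]) (simp add: assms)

lemma digits_unique:
  fixes f g :: "nat \<Rightarrow> nat"
  assumes "\<And>j. j < n \<Longrightarrow> f j < M" "\<And>j. j < n \<Longrightarrow> g j < M"
    and "(\<Sum>j<n. f j * M ^ j) = (\<Sum>j<n. g j * M ^ j)" and "j < n"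
  shows "f j = g j"
  using assms
proof (induction n arbitrary: f g j)
  case (Suc n)
  have shift: "(\<Sum>j<Suc n. h j * M ^ j) = h 0 + M * (\<Sum>j<n. h (Suc j) * M ^ j)" for h :: "nat \<Rightarrow> nat"
    by (simp add: sum.lessThan_Suc_shift sum_distrib_left mult_ac del: sum.lessThan_Suc)
  let ?F = "\<Sum>j<n. f (Suc j) * M ^ j" and ?G = "\<Sum>j<n. g (Suc j) * M ^ j"
  have eq: "f 0 + M * ?F = g 0 + M * ?G"
    using Suc.prems(3) unfolding shift .
  have f0: "f 0 < M" and g0: "g 0 < M"
    using Suc.prems(1,2)[of 0] by auto
  have "(f 0 + M * ?F) mod M = (g 0 + M * ?G) mod M" "(f 0 + M * ?F) div M = (g 0 + M * ?G) div M"
    by (simp_all only: eq)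
  then have "f 0 = g 0" "?F = ?G"
    using f0 g0 by simp_all
  moreover have "f (Suc i) = g (Suc i)" if "i < n" for i
    by (rule Suc.IH[of "\<lambda>j. f (Suc j)" "\<lambda>j. g (Suc j)"]) (use Suc.prems \<open>?F = ?G\<close> that in auto)
  ultimately show ?case
    using Suc.prems(4) by (cases j) auto
qed simp

text \<open>Kronecker substitution: sending the variable number \<open>j\<close> to \<open>t ^ M ^ j\<close> keeps apart the
  monomials with exponents below \<open>M\<close>, and the resulting polynomial in \<open>t\<close> has only finitely many
  roots. For \<open>M, t \<ge> 2\<close> the point obtained in this way has pairwise distinct coordinates, so
  it stays clear of the denominators of the shuffle product.\<close>

lemma eval_at_inj_nonzero:
  fixes f :: "'v::countable mpol"
  assumes "f \<noteq> 0"
  obtains x where "inj x" "eval_at x f \<noteq> 0"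
proof -
  define Vs where "Vs = (\<Union>m\<in>keys f. keys m)"
  have Vs: "finite Vs" "\<And>m. m \<in> keys f \<Longrightarrow> keys m \<subseteq> Vs"
    by (auto simp: Vs_def)
  \<comment> \<open>The base exceeds all exponents, and it is at least \<open>2\<close>.\<close>
  define M where "M = Suc (Suc (\<Sum>m\<in>keys f. \<Sum>v\<in>Vs. lookup m v))"
  have M: "lookup m v < M" if "m \<in> keys f" for m v
  proof (cases "v \<in> Vs")
    case True
    have "lookup m v \<le> (\<Sum>v\<in>Vs. lookup m v)"
      by (rule member_le_sum) (use True Vs in auto)
    also have "\<dots> \<le> (\<Sum>m\<in>keys f. \<Sum>v\<in>Vs. lookup m v)"
      by (rule member_le_sum) (use that in auto)
    finally show ?thesis by (simp add: M_def)
  next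
    case False
    then have "v \<notin> keys m" using Vs(2) that by blast
    then show ?thesis by (simp add: in_keys_iff M_def)
  qed
  define e where "e m = (\<Sum>v\<in>Vs. lookup m v * M ^ to_nat v)" for m :: "'v \<Rightarrow>\<^sub>0 nat"
  obtain n where n: "to_nat ` Vs \<subseteq> {..<n}"
    using finite_nat_bounded[of "to_nat ` Vs"] Vs(1) by auto
  have e_digits: "e m = (\<Sum>j<n. (if j \<in> to_nat ` Vs then lookup m (from_nat j) else 0) * M ^ j)" for m
  proof -
    have "e m = (\<Sum>j\<in>to_nat ` Vs. lookup m (from_nat j) * M ^ j)"
      unfolding e_def by (subst sum.reindex) (auto simp: inj_on_def)
    also have "\<dots> = (\<Sum>j\<in>to_nat ` Vs. (if j \<in> to_nat ` Vs then lookup m (from_nat j) else 0) * M ^ j)"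
      by (rule sum.cong) auto
    also have "\<dots> = (\<Sum>j<n. (if j \<in> to_nat ` Vs then lookup m (from_nat j) else 0) * M ^ j)"
      by (rule sum.mono_neutral_left) (use n in auto)
    finally show ?thesis .
  qed
  have e_inj: "inj_on e (keys f)"
  proof (rule inj_onI)
    fix m m' assume mm: "m \<in> keys f" "m' \<in> keys f" "e m = e m'"
    show "m = m'"
    proof (rule poly_mapping_eqI)
      fix v
      show "lookup m v = lookup m' v"
      proof (cases "v \<in> Vs")
        case True
        then have "to_nat v < n" using n by auto
        have "(if to_nat v \<in> to_nat ` Vs then lookup m (from_nat (to_nat v)) else 0)
            = (if to_nat v \<in> to_nat ` Vs then lookup m' (from_nat (to_nat v)) else 0)"
          by (rule digits_unique[of n _ M]) (use mm M \<open>to_nat v < n\<close> in \<open>auto simp: e_digits M_def\<close>)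
        then show ?thesis using True by auto
      next
        case False
        then have "v \<notin> keys m" "v \<notin> keys m'" using Vs(2) mm by blast+
        then show ?thesis by (simp add: in_keys_iff)
      qed
    qed
  qed
  define q where "q = (\<Sum>m\<in>keys f. monom (lookup f m) (e m))"
  obtain m where m: "m \<in> keys f"
    using assms by (metis all_not_in_conv keys_eq_empty)
  have "coeff q (e m) = (\<Sum>m'\<in>keys f. if m' = m then lookup f m' else 0)"
    unfolding q_def coeff_sum
    by (rule sum.cong) (use e_inj m in \<open>auto simp: inj_on_def\<close>)
  also have "\<dots> = lookup f m"
    using m by simp
  finally have "q \<noteq> 0"
    using m by (auto simp: in_keys_iff)
  then have "finite {t. poly q t = 0}"
    by (rule poly_roots_finite)
  moreover have "infinite (of_nat ` {2::nat..} :: rat set)"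
    using infinite_Ici[of "2::nat"] by (subst finite_image_iff) (auto simp: inj_on_def)
  ultimately obtain t :: rat where "t \<in> of_nat ` {2::nat..}" "t \<notin> {t. poly q t = 0}"
    by (metis finite_subset subsetI)
  then obtain t :: nat where t: "t \<ge> 2" "poly q (of_nat t) \<noteq> 0"
    by auto
  define x :: "'v \<Rightarrow> rat" where "x v = of_nat (t ^ M ^ to_nat v)" for v
  have mono: "monom_at x m = of_nat t ^ e m" if "m \<in> keys f" for m
    using Vs that
    by (simp add: monom_at_superset[of Vs] x_def e_def power_mult[symmetric] power_sum mult_ac)
  have "inj x"
  proof (rule injI)
    fix u v assume "x u = x v"
    then have "t ^ M ^ to_nat u = t ^ M ^ to_nat v"
      unfolding x_def of_nat_eq_iff .
    then have "M ^ to_nat u = M ^ to_nat v"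
      using t(1) by (subst (asm) power_inject_exp) auto
    then have "to_nat u = to_nat v"
      by (subst (asm) power_inject_exp) (auto simp: M_def)
    then show "u = v" by simp
  qed
  moreover have "eval_at x f = poly q (of_nat t)"
    by (simp add: eval_at_def q_def poly_sum poly_monom mono)
  ultimately show ?thesis
    using that t(2) by auto
qed

lemma mpol_eqI:
  fixes f g :: "'v::countable mpol"
  assumes "\<And>x. inj x \<Longrightarrow> eval_at x f = eval_at x g"
  shows "f = g"
  using eval_at_inj_nonzero[of "f - g"] assms by (metis eq_iff_diff_eq_0 eval_at_diff)

lemma dvd_diff_prod:
  fixes f g :: "'b \<Rightarrow> 'a::comm_ring_1"
  assumes "\<And>i. i \<in> I \<Longrightarrow> d dvd f i - g i"
  shows "d dvd (\<Prod>i\<in>I. f i) - (\<Prod>i\<in>I. g i)"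
  using assms
proof (induction I rule: infinite_finite_induct)
  case (insert i I)
  have "f i * P - g i * Q = (f i - g i) * P + g i * (P - Q)" for P Q
    by (simp add: algebra_simps)
  then show ?case
    using insert by (simp add: dvd_add)
qed auto

lemma subst_Var: "subst Var f = f" for f :: "'v::countable mpol"
  by (rule mpol_eqI) simp

text \<open>The factor theorem for the linear form \<open>Var v - Var u\<close>: a polynomial agrees with its
  substitution \<open>u \<mapsto> v\<close> up to a multiple of this form.\<close>

lemma diagonal_dvd:
  fixes f :: "'v::countable mpol"
  assumes "u \<noteq> v"
    and "\<And>x. inj_on x (- {u}) \<Longrightarrow> x u = x v \<Longrightarrow> eval_at x f = 0"
  shows "(Var v - Var u) dvd f"
proof -
  define s where "s = (\<lambda>w. if w = u then Var v else Var w)"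
  have "subst s f = 0"
  proof (rule mpol_eqI)
    fix x :: "'v \<Rightarrow> rat" assume "inj x"
    then have "inj_on (\<lambda>w. eval_at x (s w)) (- {u})"
      by (auto simp: s_def inj_on_def)
    then show "eval_at x (subst s f) = eval_at x 0"
      using assms by (simp add: s_def)
  qed
  moreover have "(Var v - Var u) dvd subst Var f - subst s f"
    unfolding subst_def sum_subtractf[symmetric] right_diff_distrib[symmetric]
  proof (intro dvd_sum dvd_mult dvd_diff_prod)
    fix m w
    have "(Var v - Var u) dvd Var w - s w"
      by (metis cancel_comm_monoid_add_class.diff_cancel dvd_0_right dvd_minus_iff dvd_refl
          minus_diff_eq s_def)
    then show "(Var v - Var u) dvd Var w ^ lookup m w - s w ^ lookup m w"
      using dvd_trans power_diff_sumr2 by (metis dvd_triv_left)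
  qed
  ultimately show ?thesis
    by (simp add: subst_Var)
qed

section \<open>Symmetric polynomials as functions of families of finite sets\<close>

definition cards :: "('i \<Rightarrow> 'b set) \<Rightarrow> 'i \<Rightarrow> nat" where
  "cards A = (\<lambda>i. card (A i))"

text \<open>Coordinates beyond the end of a row are set to \<open>0\<close>, so that every polynomial has a value at a
  family of lists.\<close>

definition pt :: "('i \<Rightarrow> rat list) \<Rightarrow> 'i \<times> nat \<Rightarrow> rat" where
  "pt e = (\<lambda>(i, \<alpha>). if \<alpha> < length (e i) then e i ! \<alpha> else 0)"

definition enums :: "('i \<Rightarrow> rat set) \<Rightarrow> ('i \<Rightarrow> rat list) set" where
  "enums A = {e. \<forall>i. distinct (e i) \<and> set (e i) = A i}"

text \<open>A symmetric polynomial takes the same value at all orderings of a family of sets; the increasing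
  one is chosen.\<close>

definition eval_set :: "('i \<times> nat) mpol \<Rightarrow> ('i \<Rightarrow> rat set) \<Rightarrow> rat" where
  "eval_set f A = eval_at (pt (\<lambda>i. sorted_list_of_set (A i))) f"

definition row_inj :: "('i \<Rightarrow> nat) \<Rightarrow> ('i \<times> nat \<Rightarrow> rat) \<Rightarrow> bool" where
  "row_inj \<gamma> x \<longleftrightarrow> (\<forall>i. inj_on (\<lambda>\<alpha>. x (i, \<alpha>)) {..<\<gamma> i})"

definition rows :: "('i \<Rightarrow> nat) \<Rightarrow> ('i \<times> nat \<Rightarrow> rat) \<Rightarrow> 'i \<Rightarrow> rat set" where
  "rows \<gamma> x = (\<lambda>i. (\<lambda>\<alpha>. x (i, \<alpha>)) ` {..<\<gamma> i})"

lemma row_inj_if_inj: "inj x \<Longrightarrow> row_inj \<gamma> x"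
  by (auto simp: row_inj_def inj_on_def)

lemma finite_rows [simp]: "finite (rows \<gamma> x i)"
  by (simp add: rows_def)

lemma cards_rows: "row_inj \<gamma> x \<Longrightarrow> cards (rows \<gamma> x) = \<gamma>"
  by (auto simp: cards_def rows_def row_inj_def card_image)

lemma prod_rows:
  assumes "row_inj \<gamma> x"
  shows "(\<Prod>b\<in>rows \<gamma> x i. g b) = (\<Prod>\<alpha><\<gamma> i. g (x (i, \<alpha>)))"
  unfolding rows_def using assms by (subst prod.reindex) (auto simp: row_inj_def)

lemma row_inj_pt:
  assumes "e \<in> enums A" "\<And>i. finite (A i)"
  shows "row_inj (cards A) (pt e)" "rows (cards A) (pt e) = A"
proof -
  have len: "length (e i) = card (A i)" for i
    using assms distinct_card[of "e i"] by (simp add: enums_def)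
  show "row_inj (cards A) (pt e)"
    using assms by (auto simp: row_inj_def pt_def cards_def len inj_on_def enums_def nth_eq_iff_index_eq)
  have "A i = set (e i)" for i
    using assms by (auto simp: enums_def)
  then show "rows (cards A) (pt e) = A"
    by (auto simp: rows_def pt_def cards_def len set_conv_nth image_iff fun_eq_iff)
qed

lemma sorted_list_in_enums: "(\<And>i. finite (A i)) \<Longrightarrow> (\<lambda>i. sorted_list_of_set (A i)) \<in> enums A"
  by (auto simp: enums_def)

lemma coha_comp_eval_cong:
  assumes "f \<in> coha_comp \<gamma>" "\<And>i \<alpha>. \<alpha> < \<gamma> i \<Longrightarrow> x (i, \<alpha>) = y (i, \<alpha>)"
  shows "eval_at x f = eval_at y f"
  by (rule eval_at_cong) (use assms in \<open>force simp: coha_comp_def\<close>)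

lemma eval_at_subst_rows:
  "eval_at x (subst (\<lambda>(i, \<alpha>). Var (i, \<pi> i \<alpha>)) f) = eval_at (\<lambda>(i, \<alpha>). x (i, \<pi> i \<alpha>)) f"
  unfolding eval_at_subst by (rule arg_cong[of _ _ "\<lambda>y. eval_at y f"]) auto

lemma coha_comp_eval_permute:
  assumes "f \<in> coha_comp \<gamma>" "\<And>i. \<pi> i permutes {..<\<gamma> i}"
  shows "eval_at (\<lambda>(i, \<alpha>). x (i, \<pi> i \<alpha>)) f = eval_at x f"
proof -
  have "subst (\<lambda>(i, \<alpha>). Var (i, \<pi> i \<alpha>)) f = f"
    using assms by (auto simp: coha_comp_def)
  then show ?thesis
    using eval_at_subst_rows[of x \<pi> f] by simp
qed

text \<open>The coordinates in each row are a permutation of the increasing list of their values.\<close>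

lemma eval_at_row_inj:
  assumes f: "f \<in> coha_comp \<gamma>" and x: "row_inj \<gamma> x"
  shows "eval_at x f = eval_set f (rows \<gamma> x)"
proof -
  define s where "s i = sorted_list_of_set (rows \<gamma> x i)" for i
  have len: "length (s i) = \<gamma> i" for i
    using cards_rows[OF x] by (auto simp: s_def cards_def fun_eq_iff)
  have "\<exists>p. p permutes {..<\<gamma> i} \<and> permute_list p (map (\<lambda>\<alpha>. x (i, \<alpha>)) [0..<\<gamma> i]) = s i" for i
  proof -
    have "mset (s i) = mset (map (\<lambda>\<alpha>. x (i, \<alpha>)) [0..<\<gamma> i])"
      using x by (subst set_eq_iff_mset_eq_distinct[symmetric])
        (auto simp: s_def rows_def distinct_map row_inj_def atLeast0LessThan)
    then show ?thesis
      using mset_eq_permutation[of "s i" "map (\<lambda>\<alpha>. x (i, \<alpha>)) [0..<\<gamma> i]"] by auto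
  qed
  then obtain p where p: "\<And>i. p i permutes {..<\<gamma> i}"
    "\<And>i. permute_list (p i) (map (\<lambda>\<alpha>. x (i, \<alpha>)) [0..<\<gamma> i]) = s i"
    by metis
  have nth: "s i ! \<alpha> = x (i, p i \<alpha>)" if "\<alpha> < \<gamma> i" for i \<alpha>
  proof -
    have "p i \<alpha> < \<gamma> i"
      using permutes_in_image[OF p(1)[of i], of \<alpha>] that by simp
    then show ?thesis
      using that p(1)[of i] by (subst p(2)[symmetric], subst permute_list_nth) auto
  qed
  have "eval_set f (rows \<gamma> x) = eval_at (\<lambda>(i, \<alpha>). x (i, p i \<alpha>)) f"
    unfolding eval_set_def s_def[symmetric]
    by (rule coha_comp_eval_cong[OF f]) (simp add: pt_def len nth)
  then show ?thesis
    using coha_comp_eval_permute[OF f p(1)] by simp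
qed

lemma eval_at_enum:
  assumes "f \<in> coha_comp (cards A)" "e \<in> enums A" "\<And>i. finite (A i)"
  shows "eval_at (pt e) f = eval_set f A"
  using eval_at_row_inj[OF assms(1) row_inj_pt(1)[OF assms(2,3)]] row_inj_pt(2)[OF assms(2,3)] by simp

text \<open>Membership in \<open>coha_comp \<gamma>\<close> is visible on points: neither the order of the coordinates in a
  row nor the coordinates beyond the first \<open>\<gamma> i\<close> ones may matter.\<close>

lemma coha_compI:
  fixes h :: "('i::finite \<times> nat) mpol"
  assumes R: "\<And>x. row_inj \<gamma> x \<Longrightarrow> eval_at x h = R (rows \<gamma> x)"
  shows "h \<in> coha_comp \<gamma>"
proof -
  let ?X = "{(i, \<alpha>). \<alpha> < \<gamma> i}"
  define h' where "h' = (\<Sum>m | m \<in> keys h \<and> keys m \<subseteq> ?X. single m (lookup h m))"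
  have "h = h'"
  proof (rule mpol_eqI)
    fix x :: "'i \<times> nat \<Rightarrow> rat" assume "inj x"
    define y where "y v = (if v \<in> ?X then x v else 0)" for v
    have mono: "monom_at y m = (if keys m \<subseteq> ?X then monom_at x m else 0)" for m
    proof (cases "keys m \<subseteq> ?X")
      case True
      then show ?thesis
        by (auto simp: monom_at_def y_def intro!: prod.cong)
    next
      case False
      then obtain v where "v \<in> keys m" "v \<notin> ?X" by blast
      then show ?thesis
        using False by (auto simp: monom_at_def y_def in_keys_iff intro!: prod_zero bexI[of _ v])
    qed
    have "row_inj \<gamma> x" using \<open>inj x\<close> by (rule row_inj_if_inj)
    moreover have "row_inj \<gamma> y"
      using calculation by (auto simp: row_inj_def y_def inj_on_def)
    moreover have "rows \<gamma> x = rows \<gamma> y"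
      by (auto simp: rows_def y_def)
    ultimately have "eval_at x h = eval_at y h"
      using R by metis
    also have "\<dots> = (\<Sum>m\<in>keys h. if keys m \<subseteq> ?X then lookup h m * monom_at x m else 0)"
      unfolding eval_at_def mono by (rule sum.cong) auto
    also have "\<dots> = eval_at x h'"
      by (simp add: h'_def sum.If_cases Int_def)
    finally show "eval_at x h = eval_at x h'" .
  qed
  have "keys m \<subseteq> ?X" if "m \<in> keys h" for m
  proof (rule ccontr)
    assume "\<not> keys m \<subseteq> ?X"
    then have "lookup h' m = 0"
      unfolding h'_def lookup_sum by (intro sum.neutral) (auto simp: lookup_single when_def)
    then show False
      using that \<open>h = h'\<close> by (simp add: in_keys_iff)
  qed
  moreover have "subst (\<lambda>(i, \<alpha>). Var (i, \<pi> i \<alpha>)) h = h" if \<pi>: "\<And>i. \<pi> i permutes {..<\<gamma> i}" for \<pi>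
  proof (rule mpol_eqI)
    fix x :: "'i \<times> nat \<Rightarrow> rat" assume "inj x"
    define y where "y = (\<lambda>(i, \<alpha>). x (i, \<pi> i \<alpha>))"
    have "row_inj \<gamma> y"
      unfolding row_inj_def
      by (auto simp: y_def intro!: inj_onI dest!: injD[OF \<open>inj x\<close>] injD[OF permutes_inj[OF \<pi>]])
    moreover have "rows \<gamma> y i = rows \<gamma> x i" for i
    proof -
      have "rows \<gamma> y i = (\<lambda>\<alpha>. x (i, \<alpha>)) ` (\<pi> i ` {..<\<gamma> i})"
        by (simp add: rows_def y_def image_image)
      then show ?thesis
        by (simp add: permutes_image[OF \<pi>] rows_def)
    qed
    then have "rows \<gamma> y = rows \<gamma> x" by (rule ext)
    ultimately have "eval_at y h = eval_at x h"
      using R row_inj_if_inj[OF \<open>inj x\<close>] by metis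
    then show "eval_at x (subst (\<lambda>(i, \<alpha>). Var (i, \<pi> i \<alpha>)) h) = eval_at x h"
      by (simp only: y_def eval_at_subst_rows)
  qed
  ultimately show ?thesis
    by (auto simp: coha_comp_def)
qed


section \<open>The shuffle product on families of sets\<close>

definition shuffle_kernel ::
  "('i::finite \<Rightarrow> 'i \<Rightarrow> nat) \<Rightarrow> ('i \<Rightarrow> rat set) \<Rightarrow> ('i \<Rightarrow> rat set) \<Rightarrow> rat" where
  "shuffle_kernel a B C =
     (\<Prod>i\<in>UNIV. \<Prod>j\<in>UNIV. \<Prod>b\<in>B i. \<Prod>c\<in>C j. (c - b) ^ a i j) /
     (\<Prod>i\<in>UNIV. \<Prod>b\<in>B i. \<Prod>c\<in>C i. c - b)"

definition subfams :: "('i \<Rightarrow> rat set) \<Rightarrow> ('i \<Rightarrow> rat set) set" where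
  "subfams A = {B. \<forall>i. B i \<subseteq> A i}"

abbreviation diff_fam :: "('i \<Rightarrow> rat set) \<Rightarrow> ('i \<Rightarrow> rat set) \<Rightarrow> 'i \<Rightarrow> rat set" where
  "diff_fam A B \<equiv> \<lambda>i. A i - B i"

lemma finite_subfam: "B \<in> subfams A \<Longrightarrow> (\<And>i. finite (A i)) \<Longrightarrow> finite (B i)"
  using finite_subset[of "B i" "A i"] by (auto simp: subfams_def)

lemma finite_subfams:
  assumes "\<And>i. finite (A i)"
  shows "finite (subfams A :: ('i::finite \<Rightarrow> rat set) set)"
proof -
  have "subfams A = PiE UNIV (\<lambda>i. Pow (A i))"
    by (auto simp: subfams_def PiE_UNIV_domain)
  then show ?thesis
    using assms by (simp add: finite_PiE)
qed

definition row_pairs :: "('i::finite \<Rightarrow> nat) \<Rightarrow> ('i \<times> nat \<times> nat) set" where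
  "row_pairs \<gamma> = (SIGMA i:UNIV. SIGMA \<beta>:{..<\<gamma> i}. {..<\<beta>})"

definition row_diff :: "'i \<times> nat \<times> nat \<Rightarrow> ('i \<times> nat) mpol" where
  "row_diff = (\<lambda>(i, \<beta>, \<alpha>). Var (i, \<beta>) - Var (i, \<alpha>))"

definition vandermonde :: "('i::finite \<Rightarrow> nat) \<Rightarrow> ('i \<times> nat) mpol" where
  "vandermonde \<gamma> = (\<Prod>p\<in>row_pairs \<gamma>. row_diff p)"

lemma finite_row_pairs [simp]: "finite (row_pairs \<gamma>)"
  by (auto simp: row_pairs_def)

lemma eval_vandermonde_nonzero:
  assumes "row_inj \<gamma> x"
  shows "eval_at x (vandermonde \<gamma>) \<noteq> 0"
  using assms unfolding vandermonde_def row_inj_def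
  by (auto simp: row_diff_def row_pairs_def dest!: inj_onD)

text \<open>The fourth power of the Vandermonde product is the product of the squared differences over all
  ordered pairs of distinct positions in a row, which makes its symmetry plain. This much symmetry
  suffices below, and it spares the computation of the sign by which a transposition acts.\<close>

lemma vandermonde_fourth_power_permute:
  assumes \<pi>: "\<And>i. \<pi> i permutes {..<\<gamma> i}"
  shows "eval_at (\<lambda>(i, \<alpha>). x (i, \<pi> i \<alpha>)) (vandermonde \<gamma>) ^ 4 = eval_at x (vandermonde \<gamma>) ^ 4"
proof -
  define Off where "Off = {(i, \<beta>, \<alpha>). \<beta> < \<gamma> i \<and> \<alpha> < \<gamma> i \<and> \<beta> \<noteq> \<alpha>}"
  define sw :: "'a \<times> nat \<times> nat \<Rightarrow> 'a \<times> nat \<times> nat" where "sw = (\<lambda>(i, \<beta>, \<alpha>). (i, \<alpha>, \<beta>))"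
  define q where "q y = (\<lambda>(i, \<beta>, \<alpha>). (y (i, \<beta>) - y (i, \<alpha>))\<^sup>2)" for y :: "'a \<times> nat \<Rightarrow> rat"
  have Off: "Off = row_pairs \<gamma> \<union> sw ` row_pairs \<gamma>" "row_pairs \<gamma> \<inter> sw ` row_pairs \<gamma> = {}"
    by (auto simp: Off_def row_pairs_def sw_def image_iff)
  have fourth: "eval_at y (vandermonde \<gamma>) ^ 4 = (\<Prod>p\<in>Off. q y p)" for y
  proof -
    have "(\<Prod>p\<in>sw ` row_pairs \<gamma>. q y p) = (\<Prod>p\<in>row_pairs \<gamma>. q y p)"
      by (subst prod.reindex)
        (auto simp: inj_on_def sw_def q_def power2_commute intro!: prod.cong)
    moreover have "(\<Prod>p\<in>row_pairs \<gamma>. q y p) = (eval_at y (vandermonde \<gamma>))\<^sup>2"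
      unfolding vandermonde_def eval_at_prod prod_power_distrib
      by (rule prod.cong) (auto simp: q_def row_diff_def)
    ultimately have "(\<Prod>p\<in>Off. q y p) = (eval_at y (vandermonde \<gamma>))\<^sup>2 * (eval_at y (vandermonde \<gamma>))\<^sup>2"
      unfolding Off(1) by (subst prod.union_disjoint) (use Off(2) in auto)
    then show ?thesis
      by (simp flip: power_add)
  qed
  have lt: "\<pi> i \<alpha> < \<gamma> i \<longleftrightarrow> \<alpha> < \<gamma> i" for i \<alpha>
    using permutes_in_image[OF \<pi>[of i], of \<alpha>] by simp
  have bij: "bij_betw (\<lambda>(i, \<beta>, \<alpha>). (i, \<pi> i \<beta>, \<pi> i \<alpha>)) Off Off"
  proof (rule bij_betw_byWitness[where f' = "\<lambda>(i, \<beta>, \<alpha>). (i, inv (\<pi> i) \<beta>, inv (\<pi> i) \<alpha>)"])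
    have lt': "inv (\<pi> i) \<alpha> < \<gamma> i \<longleftrightarrow> \<alpha> < \<gamma> i" for i \<alpha>
      using permutes_in_image[OF permutes_inv[OF \<pi>[of i]], of \<alpha>] by simp
    show "(\<lambda>(i, \<beta>, \<alpha>). (i, \<pi> i \<beta>, \<pi> i \<alpha>)) ` Off \<subseteq> Off"
      using permutes_inj[OF \<pi>] by (auto simp: Off_def lt inj_eq)
    show "(\<lambda>(i, \<beta>, \<alpha>). (i, inv (\<pi> i) \<beta>, inv (\<pi> i) \<alpha>)) ` Off \<subseteq> Off"
      using permutes_inj[OF permutes_inv[OF \<pi>]] by (auto simp: Off_def lt' inj_eq)
  qed (use permutes_inverses[OF \<pi>] in auto)
  have "(\<Prod>p\<in>Off. q (\<lambda>(i, \<alpha>). x (i, \<pi> i \<alpha>)) p) = (\<Prod>p\<in>Off. q x ((\<lambda>(i, \<beta>, \<alpha>). (i, \<pi> i \<beta>, \<pi> i \<alpha>)) p))"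
    by (rule prod.cong) (auto simp: q_def)
  also have "\<dots> = (\<Prod>p\<in>Off. q x p)"
    by (rule prod.reindex_bij_betw[OF bij])
  finally show ?thesis
    by (simp add: fourth)
qed

text \<open>This is why the shuffle product has no poles. Off the diagonals \<open>Q\<close> is the product of the
  Vandermonde product with a symmetric function; hence, up to a factor that does not vanish there,
  \<open>Q\<close> changes sign when \<open>(i, \<alpha>)\<close> and \<open>(i, \<beta>)\<close> are exchanged, and so it vanishes on their diagonal.\<close>

lemma vanish_on_diagonal:
  fixes Q :: "('i::finite \<times> nat) mpol"
  assumes Q: "\<And>x. row_inj \<gamma> x \<Longrightarrow> eval_at x Q = eval_at x (vandermonde \<gamma>) * R (rows \<gamma> x)"
    and p: "(i, \<beta>, \<alpha>) \<in> row_pairs \<gamma>"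
    and x: "x (i, \<alpha>) = x (i, \<beta>)"
    and nz: "\<And>p. p \<in> row_pairs \<gamma> \<Longrightarrow> p \<noteq> (i, \<beta>, \<alpha>) \<Longrightarrow> eval_at x (row_diff p) \<noteq> 0"
  shows "eval_at x Q = 0"
proof -
  define d where "d = (row_diff (i, \<beta>, \<alpha>) :: ('i \<times> nat) mpol)"
  define E where "E = (\<Prod>p\<in>row_pairs \<gamma> - {(i, \<beta>, \<alpha>)}. row_diff p :: ('i \<times> nat) mpol)"
  define \<pi> where "\<pi> j = (if j = i then transpose \<alpha> \<beta> else id)" for j
  define sw where "sw y = (\<lambda>(j, \<delta>). y (j, \<pi> j \<delta>))" for y :: "'i \<times> nat \<Rightarrow> rat"
  have lt: "\<alpha> < \<beta>" "\<beta> < \<gamma> i"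
    using p by (auto simp: row_pairs_def)
  have \<pi>: "\<pi> j permutes {..<\<gamma> j}" for j
    using lt by (auto simp: \<pi>_def permutes_swap_id permutes_id)
  have dE: "vandermonde \<gamma> = d * E"
    unfolding vandermonde_def d_def E_def using p by (subst prod.remove[of _ "(i, \<beta>, \<alpha>)"]) auto
  \<comment> \<open>The cube of the Vandermonde product times \<open>Q\<close> is its fourth power times a symmetric function. Cancelling
    the cube of the difference \<open>d\<close>, which changes sign, leaves \<open>E ^ 3 * Q\<close>.\<close>
  have anti: "eval_at (sw y) (E ^ 3 * Q) = - eval_at y (E ^ 3 * Q)" if "inj y" for y
  proof -
    have y: "row_inj \<gamma> y"
      using that by (rule row_inj_if_inj)
    have sy: "row_inj \<gamma> (sw y)"
      unfolding row_inj_def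
      by (auto simp: sw_def intro!: inj_onI dest!: injD[OF that] injD[OF permutes_inj[OF \<pi>]])
    have "rows \<gamma> (sw y) j = (\<lambda>\<alpha>. y (j, \<alpha>)) ` (\<pi> j ` {..<\<gamma> j})" for j
      by (simp add: rows_def sw_def image_image)
    then have rows: "rows \<gamma> (sw y) = rows \<gamma> y"
      by (auto simp: permutes_image[OF \<pi>] rows_def)
    have "eval_at z (vandermonde \<gamma>) ^ 3 * eval_at z Q = eval_at z (vandermonde \<gamma>) ^ 4 * R (rows \<gamma> z)"
      if "row_inj \<gamma> z" for z
      by (simp add: Q[OF that] power_numeral_reduce mult_ac)
    then have "eval_at (sw y) (vandermonde \<gamma>) ^ 3 * eval_at (sw y) Q
        = eval_at y (vandermonde \<gamma>) ^ 3 * eval_at y Q"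
      using y sy rows vandermonde_fourth_power_permute[of \<pi> \<gamma> y, OF \<pi>, folded sw_def] by simp
    then have "eval_at (sw y) d ^ 3 * eval_at (sw y) (E ^ 3 * Q) = eval_at y d ^ 3 * eval_at y (E ^ 3 * Q)"
      by (simp add: dE power_mult_distrib mult_ac)
    moreover have "eval_at (sw y) d = - eval_at y d"
      by (simp add: d_def row_diff_def sw_def \<pi>_def)
    moreover have "eval_at y d \<noteq> 0"
      using that lt by (auto simp: d_def row_diff_def inj_eq)
    ultimately have "eval_at y d ^ 3 * eval_at (sw y) (E ^ 3 * Q) = eval_at y d ^ 3 * (- eval_at y (E ^ 3 * Q))"
      by simp
    then show ?thesis
      using \<open>eval_at y d \<noteq> 0\<close> by (subst (asm) mult_left_cancel) auto
  qed
  have "subst (\<lambda>(j, \<delta>). Var (j, \<pi> j \<delta>)) (E ^ 3 * Q) = - (E ^ 3 * Q)"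
  proof (rule mpol_eqI)
    fix y :: "'i \<times> nat \<Rightarrow> rat" assume "inj y"
    have "eval_at y (subst (\<lambda>(j, \<delta>). Var (j, \<pi> j \<delta>)) (E ^ 3 * Q)) = eval_at (sw y) (E ^ 3 * Q)"
      unfolding sw_def by (rule eval_at_subst_rows)
    then show "eval_at y (subst (\<lambda>(j, \<delta>). Var (j, \<pi> j \<delta>)) (E ^ 3 * Q)) = eval_at y (- (E ^ 3 * Q))"
      using anti[OF \<open>inj y\<close>] by simp
  qed
  then have "eval_at x (subst (\<lambda>(j, \<delta>). Var (j, \<pi> j \<delta>)) (E ^ 3 * Q)) = - eval_at x (E ^ 3 * Q)"
    by simp
  moreover have "eval_at x (subst (\<lambda>(j, \<delta>). Var (j, \<pi> j \<delta>)) (E ^ 3 * Q)) = eval_at (sw x) (E ^ 3 * Q)"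
    unfolding sw_def by (rule eval_at_subst_rows)
  moreover have "sw x = x"
    using x by (auto simp: sw_def \<pi>_def transpose_def)
  ultimately have "eval_at x (E ^ 3 * Q) = 0"
    by simp
  moreover have "eval_at x E \<noteq> 0"
    using nz by (auto simp: E_def)
  ultimately show ?thesis by simp
qed

text \<open>Distinct row differences are coprime: at a point where only two coordinates agree, all other
  differences are non-zero. So the divisors found on the diagonals multiply up.\<close>

lemma vandermonde_dvd:
  fixes Q :: "('i::finite \<times> nat) mpol"
  assumes Q: "\<And>x. row_inj \<gamma> x \<Longrightarrow> eval_at x Q = eval_at x (vandermonde \<gamma>) * R (rows \<gamma> x)"
  shows "vandermonde \<gamma> dvd Q"
proof -
  have "(\<Prod>p\<in>P. row_diff p) dvd Q" if "finite P" "P \<subseteq> row_pairs \<gamma>" for P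
    using that
  proof (induction P rule: finite_induct)
    case (insert p P)
    obtain i \<beta> \<alpha> where p: "p = (i, \<beta>, \<alpha>)"
      by (cases p) auto
    then have lt: "\<alpha> < \<beta>" and pP: "(i, \<beta>, \<alpha>) \<in> row_pairs \<gamma>"
      using insert.prems by (auto simp: row_pairs_def)
    obtain g where g: "Q = (\<Prod>p\<in>P. row_diff p) * g"
      using insert by auto
    have "(Var (i, \<beta>) - Var (i, \<alpha>)) dvd g"
    proof (rule diagonal_dvd)
      fix x :: "'i \<times> nat \<Rightarrow> rat"
      assume x: "inj_on x (- {(i, \<alpha>)})" "x (i, \<alpha>) = x (i, \<beta>)"
      have nz: "eval_at x (row_diff q) \<noteq> 0" if "q \<in> row_pairs \<gamma>" "q \<noteq> (i, \<beta>, \<alpha>)" for q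
      proof
        assume 0: "eval_at x (row_diff q) = 0"
        obtain j \<beta>' \<alpha>' where q: "q = (j, \<beta>', \<alpha>')"
          by (cases q) auto
        have lt': "\<alpha>' < \<beta>'" and eq: "x (j, \<beta>') = x (j, \<alpha>')"
          using that 0 by (auto simp: q row_pairs_def row_diff_def)
        have same: "u = v" if "x u = x v" "u \<noteq> (i, \<alpha>)" "v \<noteq> (i, \<alpha>)" for u v
          using x(1) that by (auto simp: inj_on_def)
        consider "(j, \<beta>') \<noteq> (i, \<alpha>)" "(j, \<alpha>') \<noteq> (i, \<alpha>)" | "(j, \<alpha>') = (i, \<alpha>)" | "(j, \<beta>') = (i, \<alpha>)"
          by blast
        then show False
        proof cases
          case 1
          then show False using same[OF eq] lt' by simp
        next
          case 2
          then have "(j, \<beta>') = (i, \<beta>)"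
            using same[of "(j, \<beta>')" "(i, \<beta>)"] eq x(2) lt lt' by auto
          then show False using 2 that(2) q by simp
        next
          case 3
          then have "(j, \<alpha>') = (i, \<beta>)"
            using same[of "(j, \<alpha>')" "(i, \<beta>)"] eq x(2) lt lt' by auto
          then show False using 3 lt lt' by simp
        qed
      qed
      have "eval_at x Q = 0"
        by (rule vanish_on_diagonal[OF Q pP x(2) nz])
      moreover have "eval_at x (\<Prod>p\<in>P. row_diff p) \<noteq> 0"
        using nz insert.hyps insert.prems by (auto simp: p)
      ultimately show "eval_at x g = 0"
        by (simp add: g)
    qed (use lt in auto)
    then have "row_diff p dvd g"
      by (simp add: p row_diff_def)
    then show ?case
      using insert.hyps by (simp add: g mult.commute mult_dvd_mono)
  qed simp
  from this[of "row_pairs \<gamma>"] show ?thesis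
    by (simp add: vandermonde_def)
qed

definition shuffle_sum ::
  "('i::finite \<Rightarrow> 'i \<Rightarrow> nat) \<Rightarrow> ('i \<Rightarrow> nat) \<Rightarrow> ('i \<times> nat) mpol \<Rightarrow> ('i \<times> nat) mpol \<Rightarrow>
     ('i \<Rightarrow> rat set) \<Rightarrow> rat" where
  "shuffle_sum a \<gamma>1 f1 f2 A = (\<Sum>B | B \<in> subfams A \<and> cards B = \<gamma>1.
     eval_set f1 B * eval_set f2 (diff_fam A B) * shuffle_kernel a B (diff_fam A B))"

lemma select_rows:
  assumes x: "row_inj \<gamma> x" and T: "\<And>i. T i \<subseteq> {..<\<gamma> i}" "\<And>i. card (T i) = \<delta> i"
  defines "y \<equiv> (\<lambda>(i, \<alpha>). x (i, sorted_list_of_set (T i) ! \<alpha>))"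
  shows "row_inj \<delta> y" "rows \<delta> y = (\<lambda>i. (\<lambda>\<alpha>. x (i, \<alpha>)) ` T i)"
proof -
  have bij: "bij_betw (\<lambda>\<alpha>. sorted_list_of_set (T i) ! \<alpha>) {..<\<delta> i} (T i)" for i
    by (rule bij_betw_nth) (use T finite_subset[OF T(1)] in auto)
  have "inj_on (\<lambda>\<alpha>. x (i, \<alpha>)) (T i)" for i
    using x T(1) by (auto simp: row_inj_def intro: inj_on_subset)
  then have "bij_betw (\<lambda>\<alpha>. y (i, \<alpha>)) {..<\<delta> i} ((\<lambda>\<alpha>. x (i, \<alpha>)) ` T i)" for i
    unfolding y_def using bij_betw_trans[OF bij[of i] inj_on_imp_bij_betw] by (fastforce simp: comp_def)
  then show "row_inj \<delta> y" "rows \<delta> y = (\<lambda>i. (\<lambda>\<alpha>. x (i, \<alpha>)) ` T i)"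
    by (auto simp: row_inj_def rows_def bij_betw_def)
qed

lemma finite_shuffle_sets [simp]: "finite (shuffle_sets \<gamma>1 (\<gamma>2 :: 'i::finite \<Rightarrow> nat))"
proof (rule finite_subset)
  show "shuffle_sets \<gamma>1 \<gamma>2 \<subseteq> PiE UNIV (\<lambda>i. Pow {..<\<gamma>1 i + \<gamma>2 i})"
    by (auto simp: shuffle_sets_def PiE_UNIV_domain)
qed (simp add: finite_PiE)

context
  fixes a :: "'i::finite \<Rightarrow> 'i \<Rightarrow> nat" and \<gamma>1 \<gamma>2 \<gamma> :: "'i \<Rightarrow> nat" and f1 f2 :: "('i \<times> nat) mpol"
  assumes f1: "f1 \<in> coha_comp \<gamma>1" and f2: "f2 \<in> coha_comp \<gamma>2"
  defines \<gamma>: "\<gamma> \<equiv> (\<lambda>i. \<gamma>1 i + \<gamma>2 i)"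
begin

lemma eval_shuffle:
  assumes S: "S \<in> shuffle_sets \<gamma>1 \<gamma>2" and x: "row_inj \<gamma> x"
  defines "B \<equiv> \<lambda>i. (\<lambda>\<alpha>. x (i, \<alpha>)) ` S i"
  shows "eval_at x (shuffle_den \<gamma>1 \<gamma>2 S) \<noteq> 0"
    and "eval_at x (subst (var1 S) f1 * subst (var2 \<gamma>1 \<gamma>2 S) f2 * shuffle_num a \<gamma>1 \<gamma>2 S) /
      eval_at x (shuffle_den \<gamma>1 \<gamma>2 S) =
      eval_set f1 B * eval_set f2 (diff_fam (rows \<gamma> x) B) * shuffle_kernel a B (diff_fam (rows \<gamma> x) B)"
proof -
  define y1 where "y1 = (\<lambda>(i, \<alpha>). x (i, sorted_list_of_set (S i) ! \<alpha>))"
  define y2 where "y2 = (\<lambda>(i, \<alpha>). x (i, sorted_list_of_set ({..<\<gamma> i} - S i) ! \<alpha>))"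
  have S': "S i \<subseteq> {..<\<gamma> i}" "card (S i) = \<gamma>1 i" for i
    using S by (auto simp: shuffle_sets_def \<gamma>)
  have C: "{..<\<gamma> i} - S i \<subseteq> {..<\<gamma> i}" "card ({..<\<gamma> i} - S i) = \<gamma>2 i" for i
    using S'[of i] by (auto simp: card_Diff_subset finite_subset[OF S'(1)] \<gamma>)
  note y1 = select_rows[OF x S', folded y1_def] and y2 = select_rows[OF x C, folded y2_def]
  have r1: "rows \<gamma>1 y1 = B"
    by (simp add: y1 B_def)
  have "inj_on (\<lambda>\<alpha>. x (i, \<alpha>)) {..<\<gamma> i}" for i
    using x by (simp add: row_inj_def)
  then have "(\<lambda>\<alpha>. x (i, \<alpha>)) ` ({..<\<gamma> i} - S i) = (\<lambda>\<alpha>. x (i, \<alpha>)) ` {..<\<gamma> i} - (\<lambda>\<alpha>. x (i, \<alpha>)) ` S i" for i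
    by (rule inj_on_image_set_diff) (use S'(1) in auto)
  then have r2: "rows \<gamma>2 y2 = diff_fam (rows \<gamma> x) B"
    unfolding y2(2) unfolding B_def rows_def by (rule ext)
  have v1: "eval_at x (var1 S v) = y1 v" for v
    by (cases v) (simp add: var1_def y1_def)
  have v2: "eval_at x (var2 \<gamma>1 \<gamma>2 S v) = y2 v" for v
    by (cases v) (simp add: var2_def y2_def \<gamma>)
  have num: "eval_at x (shuffle_num a \<gamma>1 \<gamma>2 S) = (\<Prod>i\<in>UNIV. \<Prod>j\<in>UNIV.
      \<Prod>b\<in>rows \<gamma>1 y1 i. \<Prod>c\<in>rows \<gamma>2 y2 j. (c - b) ^ a i j)"
    by (simp add: shuffle_num_def v1 v2 prod_rows[OF y1(1)] prod_rows[OF y2(1)])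
  have den: "eval_at x (shuffle_den \<gamma>1 \<gamma>2 S) = (\<Prod>i\<in>UNIV.
      \<Prod>b\<in>rows \<gamma>1 y1 i. \<Prod>c\<in>rows \<gamma>2 y2 i. c - b)"
    by (simp add: shuffle_den_def v1 v2 prod_rows[OF y1(1)] prod_rows[OF y2(1)])
  show "eval_at x (shuffle_den \<gamma>1 \<gamma>2 S) \<noteq> 0"
    unfolding den r1 r2 using finite_subset[OF S'(1)] by (auto simp: B_def)
  have "eval_at x (subst (var1 S) f1) = eval_set f1 B" "eval_at x (subst (var2 \<gamma>1 \<gamma>2 S) f2) = eval_set f2 (diff_fam (rows \<gamma> x) B)"
    using eval_at_row_inj[OF f1 y1(1)] eval_at_row_inj[OF f2 y2(1)] by (simp_all add: v1 v2 r1 r2)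
  then show "eval_at x (subst (var1 S) f1 * subst (var2 \<gamma>1 \<gamma>2 S) f2 * shuffle_num a \<gamma>1 \<gamma>2 S) /
      eval_at x (shuffle_den \<gamma>1 \<gamma>2 S) =
      eval_set f1 B * eval_set f2 (diff_fam (rows \<gamma> x) B) * shuffle_kernel a B (diff_fam (rows \<gamma> x) B)"
    by (simp add: num den shuffle_kernel_def r1 r2)
qed

text \<open>A shuffle selects positions, and at a point with distinct coordinates in each row this is the
  same as selecting values.\<close>

lemma sum_shuffles:
  assumes x: "row_inj \<gamma> x"
  shows "(\<Sum>S\<in>shuffle_sets \<gamma>1 \<gamma>2.
      eval_at x (subst (var1 S) f1 * subst (var2 \<gamma>1 \<gamma>2 S) f2 * shuffle_num a \<gamma>1 \<gamma>2 S) /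
      eval_at x (shuffle_den \<gamma>1 \<gamma>2 S)) = shuffle_sum a \<gamma>1 f1 f2 (rows \<gamma> x)"
proof -
  have inj: "inj_on (\<lambda>\<alpha>. x (i, \<alpha>)) {..<\<gamma> i}" for i
    using x by (simp add: row_inj_def)
  have bij: "bij_betw (\<lambda>S i. (\<lambda>\<alpha>. x (i, \<alpha>)) ` S i) (shuffle_sets \<gamma>1 \<gamma>2)
      {B. B \<in> subfams (rows \<gamma> x) \<and> cards B = \<gamma>1}"
  proof (rule bij_betw_byWitness[where f' = "\<lambda>B i. {\<alpha>. \<alpha> < \<gamma> i \<and> x (i, \<alpha>) \<in> B i}"])
    show "\<forall>S\<in>shuffle_sets \<gamma>1 \<gamma>2. (\<lambda>i. {\<alpha>. \<alpha> < \<gamma> i \<and> x (i, \<alpha>) \<in> (\<lambda>\<alpha>. x (i, \<alpha>)) ` S i}) = S"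
    proof (intro ballI ext)
      fix S i assume "S \<in> shuffle_sets \<gamma>1 \<gamma>2"
      then have "S i \<subseteq> {..<\<gamma> i}" by (auto simp: shuffle_sets_def \<gamma>)
      then show "{\<alpha>. \<alpha> < \<gamma> i \<and> x (i, \<alpha>) \<in> (\<lambda>\<alpha>. x (i, \<alpha>)) ` S i} = S i"
        using inj_onD[OF inj, of i] by (auto simp: subset_iff)
    qed
    show image: "\<forall>B\<in>{B. B \<in> subfams (rows \<gamma> x) \<and> cards B = \<gamma>1}.
        (\<lambda>i. (\<lambda>\<alpha>. x (i, \<alpha>)) ` {\<alpha>. \<alpha> < \<gamma> i \<and> x (i, \<alpha>) \<in> B i}) = B"
      by (auto simp: subfams_def rows_def fun_eq_iff)
    show "(\<lambda>S i. (\<lambda>\<alpha>. x (i, \<alpha>)) ` S i) ` shuffle_sets \<gamma>1 \<gamma>2 \<subseteq> {B. B \<in> subfams (rows \<gamma> x) \<and> cards B = \<gamma>1}"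
    proof safe
      fix S assume "S \<in> shuffle_sets \<gamma>1 \<gamma>2"
      then have S: "S i \<subseteq> {..<\<gamma> i}" "card (S i) = \<gamma>1 i" for i
        by (auto simp: shuffle_sets_def \<gamma>)
      show "(\<lambda>i. (\<lambda>\<alpha>. x (i, \<alpha>)) ` S i) \<in> subfams (rows \<gamma> x)"
        using S by (auto simp: subfams_def rows_def)
      show "cards (\<lambda>i. (\<lambda>\<alpha>. x (i, \<alpha>)) ` S i) = \<gamma>1"
        using S inj_on_subset[OF inj S(1)] by (auto simp: cards_def card_image)
    qed
    show "(\<lambda>B i. {\<alpha>. \<alpha> < \<gamma> i \<and> x (i, \<alpha>) \<in> B i}) ` {B. B \<in> subfams (rows \<gamma> x) \<and> cards B = \<gamma>1} \<subseteq> shuffle_sets \<gamma>1 \<gamma>2"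
    proof safe
      fix B assume B: "B \<in> subfams (rows \<gamma> x)" "\<gamma>1 = cards B"
      have "card {\<alpha>. \<alpha> < \<gamma> i \<and> x (i, \<alpha>) \<in> B i} = card ((\<lambda>\<alpha>. x (i, \<alpha>)) ` {\<alpha>. \<alpha> < \<gamma> i \<and> x (i, \<alpha>) \<in> B i})" for i
        by (rule card_image[symmetric]) (rule inj_on_subset[OF inj], auto)
      also have "\<dots> i = card (B i)" for i
        using fun_cong[OF bspec[OF image, of B], of i] B by simp
      finally show "(\<lambda>i. {\<alpha>. \<alpha> < \<gamma> i \<and> x (i, \<alpha>) \<in> B i}) \<in> shuffle_sets (cards B) \<gamma>2"
        using B by (auto simp: shuffle_sets_def cards_def \<gamma>)
    qed
  qed
  show ?thesis
    unfolding shuffle_sum_def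
    unfolding sum.reindex_bij_betw[OF bij, symmetric]
    by (rule sum.cong[OF refl]) (rule eval_shuffle(2)[OF _ x])
qed

text \<open>A single denominator is, up to signs, the product of the row differences between the two parts
  of the shuffle.\<close>

lemma shuffle_den_dvd_vandermonde:
  assumes S: "S \<in> shuffle_sets \<gamma>1 \<gamma>2"
  shows "shuffle_den \<gamma>1 \<gamma>2 S dvd vandermonde \<gamma>"
proof -
  have S': "S i \<subseteq> {..<\<gamma> i}" "card (S i) = \<gamma>1 i" for i
    using S by (auto simp: shuffle_sets_def \<gamma>)
  have C: "card ({..<\<gamma> i} - S i) = \<gamma>2 i" for i
    using S'[of i] by (auto simp: card_Diff_subset finite_subset[OF S'(1)] \<gamma>)
  have fin: "finite (S i)" for i
    using S'(1) finite_subset by blast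
  have b1: "bij_betw (\<lambda>\<alpha>. sorted_list_of_set (S i) ! \<alpha>) {..<\<gamma>1 i} (S i)" for i
    by (rule bij_betw_nth) (use S' fin in auto)
  have b2: "bij_betw (\<lambda>\<alpha>. sorted_list_of_set ({..<\<gamma> i} - S i) ! \<alpha>) {..<\<gamma>2 i} ({..<\<gamma> i} - S i)" for i
    by (rule bij_betw_nth) (use C in auto)
  define T where "T = (SIGMA i:UNIV. S i \<times> ({..<\<gamma> i} - S i))"
  \<comment> \<open>A pair of positions on different sides of the shuffle, put in order.\<close>
  define h where "h = (\<lambda>(i :: 'i, \<alpha> :: nat, \<beta>). (i, max \<alpha> \<beta>, min \<alpha> \<beta>))"
  define d where "d = (\<lambda>(i, \<alpha>, \<beta>). Var (i, \<beta>) - Var (i, \<alpha>) :: ('i \<times> nat) mpol)"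
  have "shuffle_den \<gamma>1 \<gamma>2 S = (\<Prod>i\<in>UNIV. \<Prod>\<alpha>\<in>S i. \<Prod>\<beta>\<in>{..<\<gamma> i} - S i. Var (i, \<beta>) - Var (i, \<alpha>))"
    unfolding shuffle_den_def
  proof (rule prod.cong[OF refl])
    fix i
    have "(\<Prod>\<alpha>1<\<gamma>1 i. \<Prod>\<alpha>2<\<gamma>2 i. var2 \<gamma>1 \<gamma>2 S (i, \<alpha>2) - var1 S (i, \<alpha>1))
        = (\<Prod>\<alpha>1<\<gamma>1 i. (\<lambda>\<alpha>. \<Prod>\<alpha>2<\<gamma>2 i. var2 \<gamma>1 \<gamma>2 S (i, \<alpha>2) - Var (i, \<alpha>)) (sorted_list_of_set (S i) ! \<alpha>1))"
      by (simp add: var1_def)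
    also have "\<dots> = (\<Prod>\<alpha>\<in>S i. \<Prod>\<alpha>2<\<gamma>2 i. var2 \<gamma>1 \<gamma>2 S (i, \<alpha>2) - Var (i, \<alpha>))"
      by (rule prod.reindex_bij_betw[OF b1])
    also have "\<dots> = (\<Prod>\<alpha>\<in>S i. \<Prod>\<alpha>2<\<gamma>2 i.
        (\<lambda>\<beta>. Var (i, \<beta>) - Var (i, \<alpha>)) (sorted_list_of_set ({..<\<gamma> i} - S i) ! \<alpha>2))"
      by (simp add: var2_def \<gamma>)
    also have "\<dots> = (\<Prod>\<alpha>\<in>S i. \<Prod>\<beta>\<in>{..<\<gamma> i} - S i. Var (i, \<beta>) - Var (i, \<alpha>))"
      by (intro prod.cong[OF refl] prod.reindex_bij_betw[OF b2])
    finally show "(\<Prod>\<alpha>1<\<gamma>1 i. \<Prod>\<alpha>2<\<gamma>2 i. var2 \<gamma>1 \<gamma>2 S (i, \<alpha>2) - var1 S (i, \<alpha>1))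
        = (\<Prod>\<alpha>\<in>S i. \<Prod>\<beta>\<in>{..<\<gamma> i} - S i. Var (i, \<beta>) - Var (i, \<alpha>))" .
  qed
  also have "\<dots> = (\<Prod>t\<in>T. d t)"
    unfolding T_def d_def using fin by (simp add: prod.Sigma prod.cartesian_product case_prod_beta)
  finally have den: "shuffle_den \<gamma>1 \<gamma>2 S = (\<Prod>t\<in>T. d t)" .
  have "d t dvd row_diff (h t)" for t
  proof (cases t)
    case (fields i \<alpha> \<beta>)
    have "d t = row_diff (h t) \<or> d t = - row_diff (h t)"
      by (cases "\<alpha> \<le> \<beta>") (auto simp: fields d_def h_def row_diff_def max_def min_def)
    then show ?thesis by auto
  qed
  then have "(\<Prod>t\<in>T. d t) dvd (\<Prod>t\<in>T. row_diff (h t))"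
    by (rule prod_dvd_prod)
  also have "(\<Prod>t\<in>T. row_diff (h t)) = (\<Prod>p\<in>h ` T. row_diff p)"
    by (subst prod.reindex) (auto simp: T_def h_def inj_on_def max_def min_def split: if_splits)
  also have "\<dots> dvd (\<Prod>p\<in>row_pairs \<gamma>. row_diff p)"
  proof (rule prod_dvd_prod_subset)
    show "h ` T \<subseteq> row_pairs \<gamma>"
    proof
      fix p assume "p \<in> h ` T"
      then obtain i \<alpha> \<beta> where p: "p = (i, max \<alpha> \<beta>, min \<alpha> \<beta>)" "\<alpha> \<in> S i" "\<beta> < \<gamma> i" "\<beta> \<notin> S i"
        by (auto simp: T_def h_def)
      then have "\<alpha> < \<gamma> i" "\<alpha> \<noteq> \<beta>" using S'(1)[of i] by auto
      then show "p \<in> row_pairs \<gamma>"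
        using p by (auto simp: row_pairs_def max_def min_def)
    qed
  qed simp
  finally show ?thesis
    by (simp add: den vandermonde_def)
qed

text \<open>Multiplying the shuffle sum by the Vandermonde product clears all denominators, and the result is
  divisible by that product because the sum depends only on the rows as sets. The quotient solves the
  equation that defines the product; it is the only solution, as points with distinct coordinates
  separate polynomials.\<close>

lemma coha_mult_eval:
  assumes x: "row_inj \<gamma> x"
  shows "eval_at x (coha_mult a \<gamma>1 \<gamma>2 f1 f2) = shuffle_sum a \<gamma>1 f1 f2 (rows \<gamma> x)"
proof -
  define N where "N S = subst (var1 S) f1 * subst (var2 \<gamma>1 \<gamma>2 S) f2 * shuffle_num a \<gamma>1 \<gamma>2 S" for S
  define D where "D S = shuffle_den \<gamma>1 \<gamma>2 S" for S
  let ?Sh = "shuffle_sets \<gamma>1 \<gamma>2"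
  define P where "P h \<longleftrightarrow> h * (\<Prod>T\<in>?Sh. D T) = (\<Sum>S\<in>?Sh. N S * (\<Prod>T\<in>?Sh - {S}. D T))" for h
  have D_nz: "eval_at y (D S) \<noteq> 0" if "row_inj \<gamma> y" "S \<in> ?Sh" for y S
    unfolding D_def using eval_shuffle(1) that by blast
  have sum_ND: "(\<Sum>S\<in>?Sh. eval_at y (N S) / eval_at y (D S)) = shuffle_sum a \<gamma>1 f1 f2 (rows \<gamma> y)"
    if "row_inj \<gamma> y" for y
    using sum_shuffles[OF that] by (simp add: N_def D_def)
  have rhs: "eval_at y (\<Sum>S\<in>?Sh. N S * (\<Prod>T\<in>?Sh - {S}. D T))
      = shuffle_sum a \<gamma>1 f1 f2 (rows \<gamma> y) * eval_at y (\<Prod>T\<in>?Sh. D T)" if y: "row_inj \<gamma> y" for y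
  proof -
    have "eval_at y (\<Sum>S\<in>?Sh. N S * (\<Prod>T\<in>?Sh - {S}. D T))
        = (\<Sum>S\<in>?Sh. eval_at y (N S) / eval_at y (D S) * (\<Prod>T\<in>?Sh. eval_at y (D T)))"
      unfolding eval_at_sum
    proof (rule sum.cong[OF refl])
      fix S assume S: "S \<in> ?Sh"
      show "eval_at y (N S * (\<Prod>T\<in>?Sh - {S}. D T))
          = eval_at y (N S) / eval_at y (D S) * (\<Prod>T\<in>?Sh. eval_at y (D T))"
        using D_nz[OF y S] by (simp add: prod.remove[OF finite_shuffle_sets S])
    qed
    also have "\<dots> = shuffle_sum a \<gamma>1 f1 f2 (rows \<gamma> y) * (\<Prod>T\<in>?Sh. eval_at y (D T))"
      by (simp only: sum_ND[OF y] flip: sum_distrib_right)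
    finally show ?thesis
      by simp
  qed
  have "\<exists>e. \<forall>S\<in>?Sh. vandermonde \<gamma> = D S * e S"
    using shuffle_den_dvd_vandermonde unfolding dvd_def D_def by (intro bchoice) auto
  then obtain e where e: "\<And>S. S \<in> ?Sh \<Longrightarrow> vandermonde \<gamma> = D S * e S"
    by blast
  define Q where "Q = (\<Sum>S\<in>?Sh. N S * e S)"
  have Q: "eval_at y Q = eval_at y (vandermonde \<gamma>) * shuffle_sum a \<gamma>1 f1 f2 (rows \<gamma> y)"
    if y: "row_inj \<gamma> y" for y
    unfolding sum_ND[OF y, symmetric] sum_distrib_left Q_def eval_at_sum
  proof (rule sum.cong[OF refl])
    fix S assume S: "S \<in> ?Sh"
    show "eval_at y (N S * e S) = eval_at y (vandermonde \<gamma>) * (eval_at y (N S) / eval_at y (D S))"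
      using D_nz[OF y S] by (simp add: e[OF S])
  qed
  then obtain h where h: "Q = vandermonde \<gamma> * h"
    using vandermonde_dvd[of \<gamma> Q "shuffle_sum a \<gamma>1 f1 f2"] by auto
  have "P h"
    unfolding P_def
  proof (rule mpol_eqI)
    fix y :: "'i \<times> nat \<Rightarrow> rat" assume "inj y"
    then have y: "row_inj \<gamma> y" by (rule row_inj_if_inj)
    have "eval_at y h = shuffle_sum a \<gamma>1 f1 f2 (rows \<gamma> y)"
      using Q[OF y] eval_vandermonde_nonzero[OF y] by (simp add: h)
    then show "eval_at y (h * (\<Prod>T\<in>?Sh. D T)) = eval_at y (\<Sum>S\<in>?Sh. N S * (\<Prod>T\<in>?Sh - {S}. D T))"
      by (subst rhs[OF y]) simp
  qed
  have P_eval: "eval_at y h' = shuffle_sum a \<gamma>1 f1 f2 (rows \<gamma> y)" if "P h'" "row_inj \<gamma> y" for h' y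
  proof -
    have "eval_at y (h' * (\<Prod>T\<in>?Sh. D T)) = shuffle_sum a \<gamma>1 f1 f2 (rows \<gamma> y) * eval_at y (\<Prod>T\<in>?Sh. D T)"
      using that(1) rhs[OF that(2)] by (simp only: P_def)
    moreover have "eval_at y (\<Prod>T\<in>?Sh. D T) \<noteq> 0"
      using D_nz[OF that(2)] by simp
    ultimately show ?thesis
      by (simp del: eval_at_prod)
  qed
  have "h' = h" if "P h'" for h'
    by (rule mpol_eqI) (simp add: P_eval[OF that] P_eval[OF \<open>P h\<close>] row_inj_if_inj)
  then have "P (THE h. P h)"
    using \<open>P h\<close> by (metis theI)
  then have "P (coha_mult a \<gamma>1 \<gamma>2 f1 f2)"
    unfolding coha_mult_def P_def N_def D_def .
  then show ?thesis
    using P_eval x by blast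
qed

lemma coha_mult_in_comp: "coha_mult a \<gamma>1 \<gamma>2 f1 f2 \<in> coha_comp \<gamma>"
  using coha_mult_eval by (rule coha_compI)

lemma coha_mult_eval_set:
  assumes "cards A = \<gamma>" "\<And>i. finite (A i)"
  shows "eval_set (coha_mult a \<gamma>1 \<gamma>2 f1 f2) A = shuffle_sum a \<gamma>1 f1 f2 A"
proof -
  let ?e = "\<lambda>i. sorted_list_of_set (A i)"
  have e: "?e \<in> enums A"
    by (rule sorted_list_in_enums) (rule assms)
  show ?thesis
    using coha_mult_eval[of "pt ?e"] row_inj_pt[OF e] assms by (simp add: eval_set_def)
qed

end

section \<open>The algebra as functions on families of sets\<close>

text \<open>The family determines, through the cardinalities of its members, the dimension vector of the
  component to be evaluated.\<close>

definition hat :: "'i coha \<Rightarrow> ('i \<Rightarrow> rat set) \<Rightarrow> rat" where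
  "hat h A = eval_set (lookup h (cards A)) A"

lemma hat_0 [simp]: "hat 0 A = 0"
  by (simp add: hat_def eval_set_def)

lemma hat_add [simp]: "hat (x + y) A = hat x A + hat y A"
  by (simp add: hat_def eval_set_def lookup_add)

lemma hat_sum [simp]: "hat (\<Sum>i\<in>I. x i) A = (\<Sum>i\<in>I. hat (x i) A)"
  by (induction I rule: infinite_finite_induct) auto

lemma hat_scale [simp]: "hat (coha_scale c x) A = c * hat x A"
  by (simp add: hat_def eval_set_def lookup_coha_scale)

lemma hat_single: "hat (single \<gamma> f) A = (if cards A = \<gamma> then eval_set f A else 0)"
  by (simp add: hat_def eval_set_def lookup_single when_def)

lemma coha_comp_0 [simp]: "0 \<in> coha_comp (\<gamma> :: 'i::finite \<Rightarrow> nat)"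
  by (rule coha_compI[where R = "\<lambda>_. 0"]) simp

lemma coha_comp_add: "f \<in> coha_comp \<gamma> \<Longrightarrow> g \<in> coha_comp \<gamma> \<Longrightarrow> f + g \<in> coha_comp (\<gamma> :: 'i::finite \<Rightarrow> nat)"
  by (rule coha_compI[where R = "\<lambda>A. eval_set f A + eval_set g A"]) (simp add: eval_at_row_inj)

lemma coha_comp_Const_mult: "f \<in> coha_comp \<gamma> \<Longrightarrow> Const c * f \<in> coha_comp (\<gamma> :: 'i::finite \<Rightarrow> nat)"
  by (rule coha_compI[where R = "\<lambda>A. c * eval_set f A"]) (simp add: eval_at_row_inj)

lemma coha_comp_1 [simp]: "1 \<in> coha_comp (\<gamma> :: 'i::finite \<Rightarrow> nat)"
  by (rule coha_compI[where R = "\<lambda>_. 1"]) simp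

lemma subspace_coha_space: "coha.subspace (coha_space :: 'i::finite coha set)"
  by (rule coha.subspaceI)
    (auto simp: coha_space_def lookup_add lookup_coha_scale coha_comp_add coha_comp_Const_mult)

lemma single_in_space [simp]:
  "single \<gamma> f \<in> coha_space \<longleftrightarrow> f \<in> coha_comp (\<gamma> :: 'i::finite \<Rightarrow> nat)"
  by (auto simp: coha_space_def lookup_single when_def)

lemmas space_add = coha.subspace_add[OF subspace_coha_space]
  and space_scale = coha.subspace_scale[OF subspace_coha_space]
  and space_sum = coha.subspace_sum[OF subspace_coha_space]
  and space_0 = coha.subspace_0[OF subspace_coha_space]

lemma coha_eqI:
  assumes "x \<in> coha_space" "y \<in> coha_space"
    and eq: "\<And>A. (\<And>i. finite (A i)) \<Longrightarrow> hat x A = hat y A"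
  shows "x = (y :: 'i::finite coha)"
proof (rule poly_mapping_eqI, rule mpol_eqI)
  fix \<gamma> and z :: "'i \<times> nat \<Rightarrow> rat" assume "inj z"
  then have z: "row_inj \<gamma> z" by (rule row_inj_if_inj)
  have "lookup x \<gamma> \<in> coha_comp \<gamma>" "lookup y \<gamma> \<in> coha_comp \<gamma>"
    using assms by (auto simp: coha_space_def)
  then show "eval_at z (lookup x \<gamma>) = eval_at z (lookup y \<gamma>)"
    using eq[of "rows \<gamma> z"] by (simp add: eval_at_row_inj[OF _ z] hat_def cards_rows[OF z])
qed

lemma hat_one:
  assumes "\<And>i. finite (A i)"
  shows "hat coha_one A = (if A = (\<lambda>_. {}) then 1 else 0)"
proof -
  have "cards A = (\<lambda>_. 0) \<longleftrightarrow> A = (\<lambda>_. {})"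
    using assms by (auto simp: cards_def fun_eq_iff)
  then show ?thesis
    by (simp add: coha_one_def hat_single eval_set_def)
qed

lemma shuffle_kernel_union_left:
  assumes "\<And>i. finite (B i)" "\<And>i. finite (B' i)" "\<And>i. B i \<inter> B' i = {}"
  shows "shuffle_kernel a (\<lambda>i. B i \<union> B' i) C = shuffle_kernel a B C * shuffle_kernel a B' C"
  by (simp add: shuffle_kernel_def prod.union_disjoint assms prod.distrib)

lemma shuffle_kernel_union_right:
  assumes "\<And>i. finite (C i)" "\<And>i. finite (C' i)" "\<And>i. C i \<inter> C' i = {}"
  shows "shuffle_kernel a B (\<lambda>i. C i \<union> C' i) = shuffle_kernel a B C * shuffle_kernel a B C'"
  by (simp add: shuffle_kernel_def prod.union_disjoint assms prod.distrib)

definition twist :: "(('i \<Rightarrow> bit) \<Rightarrow> ('i \<Rightarrow> bit) \<Rightarrow> bit) \<Rightarrow> ('i \<Rightarrow> nat) \<Rightarrow> ('i \<Rightarrow> nat) \<Rightarrow> rat" where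
  "twist \<psi> \<gamma>1 \<gamma>2 = (if \<psi> (mod2 \<gamma>1) (mod2 \<gamma>2) = 0 then 1 else - 1)"

lemma cards_split:
  assumes "B \<in> subfams A" "\<And>i. finite (A i)"
  shows "cards A = (\<lambda>i. cards B i + cards (diff_fam A B) i)"
proof
  fix i
  have "B i \<subseteq> A i" "finite (B i)"
    using assms finite_subset[of "B i" "A i"] by (auto simp: subfams_def)
  then show "cards A i = cards B i + cards (diff_fam A B) i"
    using assms by (simp add: cards_def card_Diff_subset card_mono)
qed

lemma coha_star_in_space:
  assumes "x \<in> coha_space" "y \<in> coha_space"
  shows "coha_star a \<psi> x y \<in> (coha_space :: 'i::finite coha set)"
  unfolding coha_star_def
proof (intro space_sum)
  fix \<gamma>1 \<gamma>2
  have "coha_mult a \<gamma>1 \<gamma>2 (lookup x \<gamma>1) (lookup y \<gamma>2) \<in> coha_comp (\<lambda>i. \<gamma>1 i + \<gamma>2 i)" (is "?h \<in> _")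
    using assms by (intro coha_mult_in_comp) (auto simp: coha_space_def)
  moreover have "- ?h = Const (- 1) * ?h"
    by (rule mpol_eqI) simp
  ultimately show "single (\<lambda>i. \<gamma>1 i + \<gamma>2 i)
      ((if \<psi> (mod2 \<gamma>1) (mod2 \<gamma>2) = 0 then 1 else - 1) * ?h) \<in> coha_space"
    using coha_comp_Const_mult by auto
qed

text \<open>On families of sets the product is a sum over all ways to split the family in two, without any
  reference to dimension vectors or orderings of the variables.\<close>

lemma hat_star:
  assumes x: "x \<in> coha_space" and y: "y \<in> coha_space" and A: "\<And>i. finite (A i)"
  shows "hat (coha_star a \<psi> x y) A = (\<Sum>B\<in>subfams A. twist \<psi> (cards B) (cards (diff_fam A B)) *
    hat x B * hat y (diff_fam A B) * shuffle_kernel a B (diff_fam A B))"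
proof -
  let ?T = "\<lambda>\<gamma>1 \<gamma>2 B. twist \<psi> \<gamma>1 \<gamma>2 * eval_set (lookup x \<gamma>1) B * eval_set (lookup y \<gamma>2) (diff_fam A B) *
    shuffle_kernel a B (diff_fam A B)"
  have fin: "finite (subfams A)"
    using A by (rule finite_subfams)
  have term_eq: "hat (single (\<lambda>i. \<gamma>1 i + \<gamma>2 i)
        ((if \<psi> (mod2 \<gamma>1) (mod2 \<gamma>2) = 0 then 1 else - 1) *
         coha_mult a \<gamma>1 \<gamma>2 (lookup x \<gamma>1) (lookup y \<gamma>2))) A =
      (\<Sum>B\<in>subfams A. if cards B = \<gamma>1 \<and> cards (diff_fam A B) = \<gamma>2 then ?T \<gamma>1 \<gamma>2 B else 0)" for \<gamma>1 \<gamma>2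
  proof (cases "cards A = (\<lambda>i. \<gamma>1 i + \<gamma>2 i)")
    case True
    have diff: "cards (diff_fam A B) = \<gamma>2" if "B \<in> subfams A" "cards B = \<gamma>1" for B
      using cards_split[OF that(1) A] that(2) True by (simp add: fun_eq_iff)
    have "eval_set (coha_mult a \<gamma>1 \<gamma>2 (lookup x \<gamma>1) (lookup y \<gamma>2)) A
        = shuffle_sum a \<gamma>1 (lookup x \<gamma>1) (lookup y \<gamma>2) A"
      by (rule coha_mult_eval_set) (use x y A True in \<open>auto simp: coha_space_def\<close>)
    then have "hat (single (\<lambda>i. \<gamma>1 i + \<gamma>2 i)
        ((if \<psi> (mod2 \<gamma>1) (mod2 \<gamma>2) = 0 then 1 else - 1) *
         coha_mult a \<gamma>1 \<gamma>2 (lookup x \<gamma>1) (lookup y \<gamma>2))) A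
      = twist \<psi> \<gamma>1 \<gamma>2 * shuffle_sum a \<gamma>1 (lookup x \<gamma>1) (lookup y \<gamma>2) A"
      using True by (simp add: hat_single twist_def eval_set_def)
    also have "\<dots> = (\<Sum>B | B \<in> subfams A \<and> cards B = \<gamma>1. ?T \<gamma>1 \<gamma>2 B)"
      by (simp add: shuffle_sum_def sum_distrib_left mult_ac)
    also have "\<dots> = (\<Sum>B\<in>subfams A. if cards B = \<gamma>1 then ?T \<gamma>1 \<gamma>2 B else 0)"
      using fin by (simp add: sum.inter_filter)
    also have "\<dots> = (\<Sum>B\<in>subfams A. if cards B = \<gamma>1 \<and> cards (diff_fam A B) = \<gamma>2 then ?T \<gamma>1 \<gamma>2 B else 0)"
      by (rule sum.cong) (use diff in auto)
    finally show ?thesis .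
  next
    case False
    then have "\<not> (cards B = \<gamma>1 \<and> cards (diff_fam A B) = \<gamma>2)" if "B \<in> subfams A" for B
      using cards_split[OF that A] by auto
    then show ?thesis
      using False by (subst sum.neutral) (auto simp: hat_single)
  qed
  have pick: "(\<Sum>\<gamma>1\<in>keys x. \<Sum>\<gamma>2\<in>keys y.
      if cards B = \<gamma>1 \<and> cards (diff_fam A B) = \<gamma>2 then ?T \<gamma>1 \<gamma>2 B else 0) =
      ?T (cards B) (cards (diff_fam A B)) B" for B
  proof -
    have "(\<Sum>\<gamma>2\<in>keys y. if cards B = \<gamma>1 \<and> cards (diff_fam A B) = \<gamma>2 then ?T \<gamma>1 \<gamma>2 B else 0)
        = (if cards B = \<gamma>1 then ?T \<gamma>1 (cards (diff_fam A B)) B else 0)" for \<gamma>1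
      by (auto simp: in_keys_iff eval_set_def)
    then show ?thesis
      by (auto simp: in_keys_iff eval_set_def)
  qed
  have "hat (coha_star a \<psi> x y) A = (\<Sum>\<gamma>1\<in>keys x. \<Sum>\<gamma>2\<in>keys y. \<Sum>B\<in>subfams A.
      if cards B = \<gamma>1 \<and> cards (diff_fam A B) = \<gamma>2 then ?T \<gamma>1 \<gamma>2 B else 0)"
    by (simp only: coha_star_def hat_sum term_eq)
  also have "\<dots> = (\<Sum>B\<in>subfams A. \<Sum>\<gamma>1\<in>keys x. \<Sum>\<gamma>2\<in>keys y.
      if cards B = \<gamma>1 \<and> cards (diff_fam A B) = \<gamma>2 then ?T \<gamma>1 \<gamma>2 B else 0)"
    by (subst (2) sum.swap, subst sum.swap) (rule refl)
  finally show ?thesis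
    by (simp only: pick hat_def)
qed

lemma coha_star_add_left:
  assumes "x \<in> coha_space" "x' \<in> coha_space" "y \<in> coha_space"
  shows "coha_star a \<psi> (x + x') y = coha_star a \<psi> x y + coha_star a \<psi> x' y"
  by (rule coha_eqI) (use assms in \<open>auto simp: hat_star coha_star_in_space space_add
    sum.distrib algebra_simps\<close>)

lemma coha_star_add_right:
  assumes "x \<in> coha_space" "y \<in> coha_space" "y' \<in> coha_space"
  shows "coha_star a \<psi> x (y + y') = coha_star a \<psi> x y + coha_star a \<psi> x y'"
  by (rule coha_eqI) (use assms in \<open>auto simp: hat_star coha_star_in_space space_add
    sum.distrib algebra_simps\<close>)

lemma coha_star_scale_left:
  assumes "x \<in> coha_space" "y \<in> coha_space"
  shows "coha_star a \<psi> (coha_scale c x) y = coha_scale c (coha_star a \<psi> x y)"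
  by (rule coha_eqI) (use assms in \<open>auto simp: hat_star coha_star_in_space space_scale
    sum_distrib_left algebra_simps\<close>)

lemma coha_star_scale_right:
  assumes "x \<in> coha_space" "y \<in> coha_space"
  shows "coha_star a \<psi> x (coha_scale c y) = coha_scale c (coha_star a \<psi> x y)"
  by (rule coha_eqI) (use assms in \<open>auto simp: hat_star coha_star_in_space space_scale
    sum_distrib_left algebra_simps\<close>)

lemma coha_star_0_left [simp]: "coha_star a \<psi> 0 y = 0"
  and coha_star_0_right [simp]: "coha_star a \<psi> x 0 = 0"
  by (simp_all add: coha_star_def)

lemma coha_star_sum_left:
  assumes "\<And>i. i \<in> I \<Longrightarrow> x i \<in> coha_space" "y \<in> coha_space"
  shows "coha_star a \<psi> (\<Sum>i\<in>I. x i) y = (\<Sum>i\<in>I. coha_star a \<psi> (x i) y)"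
  using assms by (induction I rule: infinite_finite_induct) (auto simp: coha_star_add_left space_sum)

lemma coha_star_sum_right:
  assumes "x \<in> coha_space" "\<And>i. i \<in> I \<Longrightarrow> y i \<in> coha_space"
  shows "coha_star a \<psi> x (\<Sum>i\<in>I. y i) = (\<Sum>i\<in>I. coha_star a \<psi> x (y i))"
  using assms by (induction I rule: infinite_finite_induct) (auto simp: coha_star_add_right space_sum)

lemma coha_one_in_space [simp]: "coha_one \<in> (coha_space :: 'i::finite coha set)"
  by (simp add: coha_one_def)

context
  fixes a :: "'i::finite \<Rightarrow> 'i \<Rightarrow> nat" and \<psi> :: "('i \<Rightarrow> bit) \<Rightarrow> ('i \<Rightarrow> bit) \<Rightarrow> bit"
  assumes bilinear: "bilinear_form2 \<psi>"
begin

text \<open>Bilinearity makes the signs a multiplicative 2-cocycle, which is why the twisted product is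
  associative.\<close>

lemma twist_cocycle:
  "twist \<psi> (\<lambda>i. \<gamma>1 i + \<gamma>2 i) \<gamma>3 * twist \<psi> \<gamma>1 \<gamma>2 = twist \<psi> \<gamma>1 (\<lambda>i. \<gamma>2 i + \<gamma>3 i) * twist \<psi> \<gamma>2 \<gamma>3"
proof -
  have "\<psi> (mod2 (\<lambda>i. \<gamma>1 i + \<gamma>2 i)) (mod2 \<gamma>3) = \<psi> (mod2 \<gamma>1) (mod2 \<gamma>3) + \<psi> (mod2 \<gamma>2) (mod2 \<gamma>3)"
    "\<psi> (mod2 \<gamma>1) (mod2 (\<lambda>i. \<gamma>2 i + \<gamma>3 i)) = \<psi> (mod2 \<gamma>1) (mod2 \<gamma>2) + \<psi> (mod2 \<gamma>1) (mod2 \<gamma>3)"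
    using bilinear by (simp_all add: bilinear_form2_def)
  then show ?thesis
    by (auto simp: twist_def)
qed

lemma twist_0_right: "twist \<psi> \<gamma> (\<lambda>_. 0) = 1"
proof -
  have "\<psi> w (\<lambda>i. 0 * w i) = 0 * \<psi> w w" for w
    using bilinear unfolding bilinear_form2_def by blast
  then have "\<psi> w (\<lambda>_. 0) = 0" for w
    by simp
  then show ?thesis by (simp add: twist_def)
qed

lemma coha_star_one_right:
  assumes x: "x \<in> coha_space"
  shows "coha_star a \<psi> x coha_one = x"
proof (rule coha_eqI)
  fix A :: "'i \<Rightarrow> rat set" assume A: "\<And>i. finite (A i)"
  have iff: "diff_fam A B = (\<lambda>_. {}) \<longleftrightarrow> B = A" if "B \<in> subfams A" for B
    using that by (fastforce simp: subfams_def fun_eq_iff)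
  have "hat (coha_star a \<psi> x coha_one) A = (\<Sum>B\<in>subfams A. if B = A then hat x A else 0)"
    unfolding hat_star[OF x coha_one_in_space A]
  proof (rule sum.cong[OF refl])
    fix B assume B: "B \<in> subfams A"
    have "hat coha_one (diff_fam A B) = (if B = A then 1 else 0)"
      using hat_one[of "diff_fam A B"] A by (simp add: iff[OF B])
    then show "twist \<psi> (cards B) (cards (diff_fam A B)) * hat x B * hat coha_one (diff_fam A B) *
        shuffle_kernel a B (diff_fam A B) = (if B = A then hat x A else 0)"
      by (simp add: twist_0_right cards_def shuffle_kernel_def)
  qed
  also have "\<dots> = hat x A"
  proof -
    have "finite (subfams A)" "A \<in> subfams A"
      using finite_subfams[of A] A by (auto simp: subfams_def)
    then show ?thesis by simp
  qed
  finally show "hat (coha_star a \<psi> x coha_one) A = hat x A" .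
qed (use x in \<open>auto intro: coha_star_in_space\<close>)

text \<open>Both ways to bracket a triple product sum over all ways to split a family into three parts,
  and the kernel is multiplicative in both arguments.\<close>

lemma coha_star_assoc:
  assumes x: "x \<in> coha_space" and y: "y \<in> coha_space" and z: "z \<in> coha_space"
  shows "coha_star a \<psi> (coha_star a \<psi> x y) z = coha_star a \<psi> x (coha_star a \<psi> y z)"
proof (rule coha_eqI)
  fix A :: "'i \<Rightarrow> rat set" assume A: "\<And>i. finite (A i)"
  let ?s = "\<lambda>B C. twist \<psi> (cards B) (cards C)" and ?K = "shuffle_kernel a"
  have xy: "coha_star a \<psi> x y \<in> coha_space" and yz: "coha_star a \<psi> y z \<in> coha_space"
    using x y z by (auto intro: coha_star_in_space)
  have fin: "finite (B i)" if "B \<in> subfams A" for B i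
    using that A by (rule finite_subfam)
  let ?L = "\<lambda>(C, B). ?s C (diff_fam A C) * (?s B (diff_fam C B) * hat x B * hat y (diff_fam C B) *
    ?K B (diff_fam C B)) * hat z (diff_fam A C) * ?K C (diff_fam A C)"
  let ?R = "\<lambda>(B, D). ?s B (diff_fam A B) * hat x B * (?s D (diff_fam (diff_fam A B) D) * hat y D *
    hat z (diff_fam (diff_fam A B) D) * ?K D (diff_fam (diff_fam A B) D)) * ?K B (diff_fam A B)"
  let ?SL = "SIGMA C:subfams A. subfams C" and ?SR = "SIGMA B:subfams A. subfams (diff_fam A B)"
  have "hat (coha_star a \<psi> (coha_star a \<psi> x y) z) A = (\<Sum>C\<in>subfams A. \<Sum>B\<in>subfams C. ?L (C, B))"
    unfolding hat_star[OF xy z A]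
  proof (rule sum.cong[OF refl])
    fix C assume C: "C \<in> subfams A"
    show "?s C (diff_fam A C) * hat (coha_star a \<psi> x y) C * hat z (diff_fam A C) * ?K C (diff_fam A C) =
        (\<Sum>B\<in>subfams C. ?L (C, B))"
      by (simp add: hat_star[OF x y fin[OF C]] sum_distrib_left sum_distrib_right)
  qed
  also have "\<dots> = (\<Sum>p\<in>?SL. ?L p)"
    by (subst sum.Sigma) (auto simp: finite_subfams A fin)
  also have "\<dots> = (\<Sum>p\<in>?SR. ?R p)"
  proof (rule sum.reindex_bij_witness[where i = "\<lambda>(B, D). (\<lambda>i. B i \<union> D i, B)"
        and j = "\<lambda>(C, B). (B, diff_fam C B)"])
    fix p assume p: "p \<in> ?SL"
    then obtain C B where CB: "p = (C, B)" "C \<in> subfams A" "B \<in> subfams C"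
      by auto
    have sub: "\<And>i. B i \<subseteq> C i" "\<And>i. C i \<subseteq> A i"
      using CB by (auto simp: subfams_def)
    have fC: "finite (C i)" for i
      using fin CB by auto
    have fB: "finite (B i)" for i
      using fC sub finite_subset by blast
    let ?D = "diff_fam C B" and ?E = "diff_fam A C"
    have E: "diff_fam (diff_fam A B) ?D = ?E"
      using sub by (fastforce simp: fun_eq_iff)
    have "?K C ?E = ?K (\<lambda>i. B i \<union> ?D i) ?E"
      using sub by (intro arg_cong2[of _ _ _ _ ?K] refl ext) blast
    also have "\<dots> = ?K B ?E * ?K ?D ?E"
      using fB fC by (intro shuffle_kernel_union_left) auto
    finally have K1: "?K C ?E = ?K B ?E * ?K ?D ?E" .
    have "?K B (diff_fam A B) = ?K B (\<lambda>i. ?D i \<union> ?E i)"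
      using sub by (intro arg_cong2[of _ _ _ _ ?K] refl ext) blast
    also have "\<dots> = ?K B ?D * ?K B ?E"
      using A fC by (intro shuffle_kernel_union_right) auto
    finally have K2: "?K B (diff_fam A B) = ?K B ?D * ?K B ?E" .
    have cC: "cards C = (\<lambda>i. cards B i + cards ?D i)"
      using CB(3) fC by (rule cards_split)
    have "?D \<in> subfams (diff_fam A B)" "\<And>i. finite (diff_fam A B i)"
      using sub A by (auto simp: subfams_def)
    from cards_split[OF this] have cAB: "cards (diff_fam A B) = (\<lambda>i. cards ?D i + cards ?E i)"
      unfolding E .
    have tw: "?s C ?E * ?s B ?D = ?s B (diff_fam A B) * ?s ?D ?E"
      unfolding cC cAB by (rule twist_cocycle)
    have "?L p = (?s C ?E * ?s B ?D) * hat x B * hat y ?D * hat z ?E * (?K B ?D * ?K C ?E)"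
      by (simp add: CB mult_ac)
    also have "\<dots> = (?s B (diff_fam A B) * ?s ?D ?E) * hat x B * hat y ?D * hat z ?E *
        (?K ?D ?E * ?K B (diff_fam A B))"
      unfolding tw by (simp only: K1 K2 mult_ac)
    also have "\<dots> = ?R (B, ?D)"
      by (simp only: case_prod_conv E mult_ac)
    finally show "?R ((\<lambda>(C, B). (B, diff_fam C B)) p) = ?L p"
      by (simp only: CB(1) case_prod_conv)
    show "(\<lambda>(B, D). (\<lambda>i. B i \<union> D i, B)) ((\<lambda>(C, B). (B, diff_fam C B)) p) = p"
      using sub by (auto simp: CB fun_eq_iff)
    show "(\<lambda>(C, B). (B, diff_fam C B)) p \<in> ?SR"
      using sub by (auto simp: CB subfams_def)
  next
    fix p assume "p \<in> ?SR"
    then show "(\<lambda>(C, B). (B, diff_fam C B)) ((\<lambda>(B, D). (\<lambda>i. B i \<union> D i, B)) p) = p"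
      "(\<lambda>(B, D). (\<lambda>i. B i \<union> D i, B)) p \<in> ?SL"
      by (fastforce simp: subfams_def fun_eq_iff)+
  qed
  also have "\<dots> = (\<Sum>B\<in>subfams A. \<Sum>D\<in>subfams (diff_fam A B). ?R (B, D))"
    by (subst sum.Sigma) (auto simp: finite_subfams A)
  also have "\<dots> = hat (coha_star a \<psi> x (coha_star a \<psi> y z)) A"
    unfolding hat_star[OF x yz A]
    by (rule sum.cong[OF refl])
      (simp add: hat_star[OF y z] A sum_distrib_left sum_distrib_right)
  finally show "hat (coha_star a \<psi> (coha_star a \<psi> x y) z) A =
    hat (coha_star a \<psi> x (coha_star a \<psi> y z)) A" .
qed (use x y z in \<open>auto intro: coha_star_in_space\<close>)

end

section \<open>Decomposable elements and the free generators\<close>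

definition coha_plus :: "'i coha set" where
  "coha_plus = {h \<in> coha_space. lookup h (\<lambda>_. 0) = 0}"

definition decomposables ::
  "('i::finite \<Rightarrow> 'i \<Rightarrow> nat) \<Rightarrow> (('i \<Rightarrow> bit) \<Rightarrow> ('i \<Rightarrow> bit) \<Rightarrow> bit) \<Rightarrow> 'i coha set" where
  "decomposables a \<psi> = coha.span {coha_star a \<psi> x y | x y. x \<in> coha_plus \<and> y \<in> coha_plus}"

abbreviation word_product ::
  "('i::finite \<Rightarrow> 'i \<Rightarrow> nat) \<Rightarrow> (('i \<Rightarrow> bit) \<Rightarrow> ('i \<Rightarrow> bit) \<Rightarrow> bit) \<Rightarrow> 'i coha list \<Rightarrow> 'i coha" where
  "word_product a \<psi> w \<equiv> foldr (coha_star a \<psi>) w coha_one"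

lemma plus_in_space: "h \<in> coha_plus \<Longrightarrow> h \<in> coha_space"
  by (simp add: coha_plus_def)

lemma subspace_coha_plus: "coha.subspace (coha_plus :: 'i::finite coha set)"
  by (rule coha.subspaceI)
    (auto simp: coha_plus_def space_0 space_add space_scale lookup_add lookup_coha_scale)

lemma subspace_decomposables: "coha.subspace (decomposables a \<psi>)"
  unfolding decomposables_def by (rule coha.subspace_span)

lemma coha_star_in_decomposables:
  "x \<in> coha_plus \<Longrightarrow> y \<in> coha_plus \<Longrightarrow> coha_star a \<psi> x y \<in> decomposables a \<psi>"
  unfolding decomposables_def by (rule coha.span_base) blast

lemma coha_star_in_plus:
  assumes "x \<in> coha_plus" "y \<in> coha_space"
  shows "coha_star a \<psi> x y \<in> (coha_plus :: 'i::finite coha set)"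
proof -
  have "(\<lambda>i. \<gamma>1 i + \<gamma>2 i) \<noteq> (\<lambda>_. 0)" if "\<gamma>1 \<in> keys x" for \<gamma>1 \<gamma>2
  proof
    assume "(\<lambda>i. \<gamma>1 i + \<gamma>2 i) = (\<lambda>_. 0)"
    then have "\<gamma>1 = (\<lambda>_. 0)" by (simp add: fun_eq_iff)
    then show False
      using that assms by (simp add: coha_plus_def in_keys_iff)
  qed
  then have "lookup (coha_star a \<psi> x y) (\<lambda>_. 0) = 0"
    unfolding coha_star_def lookup_sum by (intro sum.neutral ballI) (simp add: lookup_single when_def)
  then show ?thesis
    using assms coha_star_in_space by (auto simp: coha_plus_def)
qed

lemma decomposables_subset_plus: "decomposables a \<psi> \<subseteq> (coha_plus :: 'i::finite coha set)"
  unfolding decomposables_def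
  by (rule coha.span_minimal[OF _ subspace_coha_plus])
    (auto intro: coha_star_in_plus dest: plus_in_space)

definition word_extend :: "('x list \<Rightarrow> 'i coha) \<Rightarrow> ('x list \<Rightarrow>\<^sub>0 rat) \<Rightarrow> 'i coha" where
  "word_extend F u = (\<Sum>w\<in>keys u. coha_scale (lookup u w) (F w))"

lemma word_extend_superset:
  assumes "finite S" "keys u \<subseteq> S"
  shows "word_extend F u = (\<Sum>w\<in>S. coha_scale (lookup u w) (F w))"
  unfolding word_extend_def
  by (rule sum.mono_neutral_left) (use assms in \<open>auto simp: in_keys_iff\<close>)

lemma module_hom_word_extend: "module_hom word_scale coha_scale (word_extend F)"
proof (unfold_locales)
  fix u v and c :: rat
  have "word_extend F (u + v) = (\<Sum>w\<in>keys u \<union> keys v. coha_scale (lookup (u + v) w) (F w))"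
    by (rule word_extend_superset) (simp_all add: Poly_Mapping.keys_add)
  also have "\<dots> = word_extend F u + word_extend F v"
    by (simp add: word_extend_superset[of "keys u \<union> keys v"] lookup_add coha.scale_left_distrib sum.distrib)
  finally show "word_extend F (u + v) = word_extend F u + word_extend F v" .
  have "word_extend F (word_scale c u) = (\<Sum>w\<in>keys u. coha_scale (lookup (word_scale c u) w) (F w))"
    by (rule word_extend_superset) (auto simp: in_keys_iff lookup_word_scale)
  then show "word_extend F (word_scale c u) = coha_scale c (word_extend F u)"
    by (simp add: word_extend_def lookup_word_scale coha.scale_sum_right)
qed

lemmas word_extend_add = module_hom.add[OF module_hom_word_extend]
  and word_extend_scale = module_hom.scale[OF module_hom_word_extend]
  and word_extend_diff = module_hom.diff[OF module_hom_word_extend]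
  and word_extend_0 = module_hom.zero[OF module_hom_word_extend]

lemma word_extend_word [simp]: "word_extend F (word w) = F w"
  by (simp add: word_extend_superset[of "{w}"])

lemma canonical_map_word_extend: "canonical_map a \<psi> = word_extend (word_product a \<psi>)"
  by (rule ext) (simp add: canonical_map_def word_extend_def)

lemma subspace_word_space: "word.subspace (word_space V)"
  by (rule word.subspaceI)
    (auto simp: word_space_def lookup_word_scale in_keys_iff dest!: Poly_Mapping.keys_add[THEN subsetD])

lemma word_in_word_space [simp]: "word w \<in> word_space V \<longleftrightarrow> w \<in> lists V"
  by (simp add: word_space_def)

text \<open>All the relations of the free super-commutative algebra are linear in the words of length one and
  do not involve the empty word.\<close>

lemma supercomm_ideal_no_unit:
  assumes "u \<in> supercomm_ideal a V"
  shows "lookup u [] = 0"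
  using assms unfolding supercomm_ideal_def
proof (induction rule: word.span_induct)
  case base
  show ?case
    by (rule word.subspaceI) (auto simp: lookup_add lookup_word_scale)
qed (auto simp: lookup_minus lookup_single lookup_word_scale when_def)

lemma supercomm_ideal_letters:
  assumes "u \<in> supercomm_ideal a V"
  shows "word_extend (\<lambda>w. if length w = 1 then hd w else 0) u = 0"
  using assms unfolding supercomm_ideal_def
proof (induction rule: word.span_induct)
  case base
  show ?case
    by (rule word.subspaceI)
      (auto simp: word_extend_0 word_extend_add word_extend_scale)
next
  case (step u)
  then show ?case
    by (auto simp: word_extend_diff word_extend_scale Cons_eq_append_conv)
qed

context
  fixes a :: "'i::finite \<Rightarrow> 'i \<Rightarrow> nat" and \<psi> :: "('i \<Rightarrow> bit) \<Rightarrow> ('i \<Rightarrow> bit) \<Rightarrow> bit" and V :: "'i coha set"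
  assumes bilinear: "bilinear_form2 \<psi>"
    and V: "bigraded_subspace a V"
    and free: "free_supercomm_generated a \<psi> V"
begin

lemma V_space: "V \<subseteq> coha_space" and V_subspace: "coha.subspace V"
  using V by (auto simp: bigraded_subspace_def)

lemma kernel_in_ideal:
  "u \<in> word_space V \<Longrightarrow> canonical_map a \<psi> u = 0 \<Longrightarrow> u \<in> supercomm_ideal a V"
  using free by (auto simp: free_supercomm_generated_def)

lemma word_product_in_space: "w \<in> lists V \<Longrightarrow> word_product a \<psi> w \<in> coha_space"
  using V_space by (induction w) (auto intro: coha_star_in_space)

lemma word_product_singleton: "v \<in> V \<Longrightarrow> word_product a \<psi> [v] = v"
  using V_space coha_star_one_right[OF bilinear] by auto

lemma word_product_append:
  assumes "w \<in> lists V" "w' \<in> lists V" "w \<noteq> []"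
  shows "word_product a \<psi> (w @ w') = coha_star a \<psi> (word_product a \<psi> w) (word_product a \<psi> w')"
  using assms
proof (induction w)
  case (Cons v w)
  then have v: "v \<in> V" by simp
  show ?case
  proof (cases "w = []")
    case True
    then show ?thesis
      using v word_product_singleton[OF v] by simp
  next
    case False
    have "word_product a \<psi> w \<in> coha_space" "word_product a \<psi> w' \<in> coha_space" "v \<in> coha_space"
      using Cons.hyps Cons.prems V_space by (auto intro: word_product_in_space)
    then show ?thesis
      using Cons False coha_star_assoc[OF bilinear] by simp
  qed
qed simp

text \<open>A generator in dimension zero would be a multiple of the unit. Then its one-letter word and the
  empty word satisfy a linear relation, but no element of the ideal involves the empty word.\<close>

lemma V_no_constants: "V \<inter> coha_bideg a (\<lambda>_. 0) k = {0}"
proof (intro equalityI subsetI)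
  fix v assume v: "v \<in> V \<inter> coha_bideg a (\<lambda>_. 0) k"
  then obtain f where f: "v = single (\<lambda>_. 0) f" "f \<in> coha_comp (\<lambda>_. 0)"
    by (auto simp: coha_bideg_def)
  have "f = Const (lookup f 0)"
  proof (rule poly_mapping_eqI)
    fix m
    have "m = 0" if "m \<in> keys f"
      using f(2) that by (auto simp: coha_comp_def)
    then show "lookup f m = lookup (Const (lookup f 0)) m"
      by (cases "m = 0") (auto simp: Const_def lookup_single when_def in_keys_iff)
  qed
  then have v_one: "v = coha_scale (lookup f 0) coha_one"
    by (intro poly_mapping_eqI) (simp add: f coha_one_def lookup_coha_scale lookup_single when_def)
  let ?u = "word [v] - word_scale (lookup f 0) (word [])"
  have "?u \<in> word_space V"
    using v by (intro word.subspace_diff[OF subspace_word_space] word.subspace_scale[OF subspace_word_space]) auto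
  moreover have "canonical_map a \<psi> ?u = 0"
    using v v_one word_product_singleton[of v]
    by (simp add: canonical_map_word_extend word_extend_diff word_extend_scale)
  ultimately have "lookup ?u [] = 0"
    using kernel_in_ideal supercomm_ideal_no_unit by blast
  then have "lookup f 0 = 0"
    by (simp add: lookup_minus lookup_word_scale lookup_single)
  then show "v \<in> {0}"
    using v_one by simp
next
  fix v :: "'i coha" assume "v \<in> {0}"
  moreover have "0 = single (\<lambda>_ :: 'i. 0 :: nat) (0 :: ('i \<times> nat) mpol)"
    by simp
  then have "0 \<in> coha_bideg a (\<lambda>_. 0) k"
    unfolding coha_bideg_def by (intro CollectI exI[of _ 0]) auto
  ultimately show "v \<in> V \<inter> coha_bideg a (\<lambda>_. 0) k"
    using coha.subspace_0[OF V_subspace] by auto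
qed

lemma V_subset_plus: "V \<subseteq> coha_plus"
proof
  fix v assume v: "v \<in> V"
  have "is_direct_sum V (\<lambda>(\<gamma>, k). V \<inter> coha_bideg a \<gamma> k)"
    using V by (simp add: bigraded_subspace_def)
  then obtain c where c: "\<And>p. c p \<in> (\<lambda>(\<gamma>, k). V \<inter> coha_bideg a \<gamma> k) p" "v = (\<Sum>p | c p \<noteq> 0. c p)"
    using v unfolding is_direct_sum_def by blast
  have "lookup (c p) (\<lambda>_. 0) = 0" for p
  proof (cases p)
    case (Pair \<gamma> k)
    then have cp: "c p \<in> V \<inter> coha_bideg a \<gamma> k"
      using c(1)[of p] by simp
    show ?thesis
    proof (cases "\<gamma> = (\<lambda>_. 0)")
      case True
      then show ?thesis
        using cp V_no_constants by auto
    next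
      case False
      then show ?thesis
        using cp by (auto simp: coha_bideg_def lookup_single when_def)
    qed
  qed
  then have "lookup v (\<lambda>_. 0) = 0"
    by (simp add: c(2) lookup_sum)
  then show "v \<in> coha_plus"
    using v V_space by (auto simp: coha_plus_def)
qed

lemma word_product_in_plus: "w \<in> lists V \<Longrightarrow> w \<noteq> [] \<Longrightarrow> word_product a \<psi> w \<in> coha_plus"
  using V_subset_plus word_product_in_space by (cases w) (auto intro: coha_star_in_plus)

lemma plus_spanned_by_words:
  "coha_plus \<subseteq> coha.span (word_product a \<psi> ` {w \<in> lists V. w \<noteq> []})"
proof
  fix h :: "'i coha" assume h: "h \<in> coha_plus"
  let ?F = "word_product a \<psi>"
  have "canonical_map a \<psi> ` word_space V = coha_space"
    using free by (simp add: free_supercomm_generated_def)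
  then obtain u where u: "u \<in> word_space V" "h = canonical_map a \<psi> u"
    using h by (metis (no_types, lifting) coha_plus_def imageE mem_Collect_eq)
  define r where "r = (\<Sum>w\<in>keys u - {[]}. coha_scale (lookup u w) (?F w))"
  have keys: "w \<in> lists V" if "w \<in> keys u" for w
    using u(1) that by (auto simp: word_space_def)
  have r_plus: "r \<in> coha_plus"
    unfolding r_def
    by (intro coha.subspace_sum[OF subspace_coha_plus] coha.subspace_scale[OF subspace_coha_plus]
        word_product_in_plus keys) auto
  have r_span: "r \<in> coha.span (?F ` {w \<in> lists V. w \<noteq> []})"
    unfolding r_def by (intro coha.span_sum coha.span_scale coha.span_base imageI) (use keys in blast)
  have "h = coha_scale (lookup u []) coha_one + r"
  proof -
    have "h = (\<Sum>w\<in>insert [] (keys u). coha_scale (lookup u w) (?F w))"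
      unfolding u(2) canonical_map_word_extend by (rule word_extend_superset) auto
    then show ?thesis
      by (subst (asm) sum.insert_remove) (auto simp: r_def)
  qed
  moreover from this have "lookup h (\<lambda>_. 0) = Const (lookup u []) + lookup r (\<lambda>_. 0)"
    by (simp add: lookup_add lookup_coha_scale coha_one_def)
  then have "Const (lookup u []) = (0 :: ('i \<times> nat) mpol)"
    using h r_plus by (simp add: coha_plus_def)
  then have "lookup u [] = 0"
    by (metis eval_at_0 eval_at_Const)
  ultimately show "h \<in> coha.span (?F ` {w \<in> lists V. w \<noteq> []})"
    using r_span by simp
qed

text \<open>Words of length one give the generators, longer words give decomposable elements, and the empty
  word cannot contribute in the absence of a component in dimension zero.\<close>

lemma plus_eq_V_plus_decomposables:
  assumes "h \<in> coha_plus"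
  obtains v where "v \<in> V" "h - v \<in> decomposables a \<psi>"
proof -
  let ?S = "{h. \<exists>v\<in>V. h - v \<in> decomposables a \<psi>}"
  have "coha.span (word_product a \<psi> ` {w \<in> lists V. w \<noteq> []}) \<subseteq> ?S"
  proof (rule coha.span_minimal)
    show "coha.subspace ?S"
    proof (rule coha.subspaceI)
      show "0 \<in> ?S"
        using coha.subspace_0[OF V_subspace] coha.subspace_0[OF subspace_decomposables] by (auto intro!: bexI[of _ 0])
    next
      fix x y assume "x \<in> ?S" "y \<in> ?S"
      then obtain v w where "v \<in> V" "x - v \<in> decomposables a \<psi>" "w \<in> V" "y - w \<in> decomposables a \<psi>"
        by auto
      moreover have "x + y - (v + w) = (x - v) + (y - w)" by simp
      ultimately show "x + y \<in> ?S"
        using coha.subspace_add[OF V_subspace] coha.subspace_add[OF subspace_decomposables]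
        by (metis (mono_tags, lifting) mem_Collect_eq)
    next
      fix c x assume "x \<in> ?S"
      then obtain v where "v \<in> V" "x - v \<in> decomposables a \<psi>"
        by auto
      then show "coha_scale c x \<in> ?S"
        using coha.subspace_scale[OF V_subspace] coha.subspace_scale[OF subspace_decomposables]
        by (metis (mono_tags, lifting) coha.scale_right_diff_distrib mem_Collect_eq)
    qed
    show "word_product a \<psi> ` {w \<in> lists V. w \<noteq> []} \<subseteq> ?S"
    proof (rule image_subsetI, unfold mem_Collect_eq)
      fix w assume w: "w \<in> lists V \<and> w \<noteq> []"
      then obtain v w' where vw: "w = v # w'" "v \<in> V" "w' \<in> lists V"
        by (cases w) auto
      show "\<exists>x\<in>V. word_product a \<psi> w - x \<in> decomposables a \<psi>"
      proof (cases "w' = []")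
        case True
        then have "word_product a \<psi> w - v = 0"
          using vw word_product_singleton[of v] by simp
        then show ?thesis
          using vw coha.subspace_0[OF subspace_decomposables] by metis
      next
        case False
        then have "word_product a \<psi> w \<in> decomposables a \<psi>"
          using vw V_subset_plus word_product_in_plus[of w'] by (auto intro: coha_star_in_decomposables)
        then show ?thesis
          using coha.subspace_0[OF V_subspace] by (intro bexI[of _ 0]) auto
      qed
    qed
  qed
  then show ?thesis
    using assms plus_spanned_by_words that by blast
qed

text \<open>By associativity, the product of two non-empty words is their concatenation.\<close>

lemma decomposables_spanned_by_long_words:
  "decomposables a \<psi> \<subseteq> coha.span (word_product a \<psi> ` {w \<in> lists V. 2 \<le> length w})"
  unfolding decomposables_def
proof (rule coha.span_minimal)
  let ?W = "{w \<in> lists V. w \<noteq> []}" and ?S = "coha.span (word_product a \<psi> ` {w \<in> lists V. 2 \<le> length w})"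
  have star: "coha_star a \<psi> x y \<in> ?S"
    if x: "x \<in> coha_plus" and y: "y \<in> coha_plus" for x y
  proof -
    have W_space: "coha.span (word_product a \<psi> ` ?W) \<subseteq> coha_space"
      by (rule coha.span_minimal[OF _ subspace_coha_space]) (auto intro: word_product_in_space)
    have 1: "coha_star a \<psi> (word_product a \<psi> w) (word_product a \<psi> w') \<in> ?S" if "w \<in> ?W" "w' \<in> ?W" for w w'
    proof -
      have "2 \<le> length (w @ w')"
        using that by (cases w; cases w') auto
      then show ?thesis
        using that word_product_append[of w w']
        by (intro coha.span_base image_eqI[of _ _ "w @ w'"]) auto
    qed
    have "y \<in> coha_space \<and> coha_star a \<psi> (word_product a \<psi> w) y \<in> ?S" if "w \<in> ?W" for w
    proof -
      have "y \<in> coha.span (word_product a \<psi> ` ?W)"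
        using y plus_spanned_by_words by blast
      then have "y \<in> coha_space \<and> coha_star a \<psi> (word_product a \<psi> w) y \<in> ?S"
      proof (induction rule: coha.span_induct)
        case base
        show ?case
          by (rule coha.subspaceI) (use that in \<open>auto simp: space_add space_scale space_0 word_product_in_space
              coha_star_add_right coha_star_scale_right coha.span_add coha.span_scale coha.span_zero\<close>)
      qed (use 1[OF that] word_product_in_space in auto)
      then show ?thesis .
    qed
    then have 2: "coha_star a \<psi> (word_product a \<psi> w) y \<in> ?S" if "w \<in> ?W" for w
      using that by blast
    have "x \<in> coha.span (word_product a \<psi> ` ?W)"
      using x plus_spanned_by_words by blast
    then have "x \<in> coha_space \<and> coha_star a \<psi> x y \<in> ?S"
    proof (induction rule: coha.span_induct)
      case base
      show ?case
        by (rule coha.subspaceI) (use y in \<open>auto simp: coha_plus_def space_add space_scale space_0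
            coha_star_add_left coha_star_scale_left coha.span_add coha.span_scale coha.span_zero\<close>)
    qed (use 2 word_product_in_space in auto)
    then show ?thesis by blast
  qed
  then show "{coha_star a \<psi> x y | x y. x \<in> coha_plus \<and> y \<in> coha_plus} \<subseteq> ?S"
    by auto
qed (rule coha.subspace_span)

text \<open>A linear combination of words of length at least two which represents a generator \<open>v\<close> gives a relation
  whose part of word length one is \<open>v\<close>; hence \<open>v = 0\<close>.\<close>

lemma V_Int_decomposables:
  assumes "v \<in> V" "v \<in> decomposables a \<psi>"
  shows "v = 0"
proof -
  let ?S = "{v. \<exists>u\<in>word_space V. canonical_map a \<psi> u = v \<and> (\<forall>w\<in>keys u. 2 \<le> length w)}"
  have "v \<in> coha.span (word_product a \<psi> ` {w \<in> lists V. 2 \<le> length w})"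
    using assms decomposables_spanned_by_long_words by blast
  then have "\<exists>u\<in>word_space V. canonical_map a \<psi> u = v \<and> (\<forall>w\<in>keys u. 2 \<le> length w)"
  proof (induction rule: coha.span_induct)
    case base
    show ?case
    proof (rule coha.subspaceI)
      show "0 \<in> ?S"
        using word.subspace_0[OF subspace_word_space]
        by (auto intro!: bexI[of _ 0] simp: canonical_map_word_extend word_extend_0)
    next
      fix x y assume "x \<in> ?S"
        "y \<in> ?S"
      then obtain u u' where "u \<in> word_space V" "canonical_map a \<psi> u = x" "\<forall>w\<in>keys u. 2 \<le> length w"
        "u' \<in> word_space V" "canonical_map a \<psi> u' = y" "\<forall>w\<in>keys u'. 2 \<le> length w"
        by auto
      then show "x + y \<in> ?S"
        using word.subspace_add[OF subspace_word_space]
        by (auto intro!: bexI[of _ "u + u'"] simp: canonical_map_word_extend word_extend_add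
            dest!: Poly_Mapping.keys_add[THEN subsetD])
    next
      fix c x assume "x \<in> ?S"
      then obtain u where "u \<in> word_space V" "canonical_map a \<psi> u = x" "\<forall>w\<in>keys u. 2 \<le> length w"
        by auto
      then show "coha_scale c x \<in> ?S"
        using word.subspace_scale[OF subspace_word_space]
        by (auto intro!: bexI[of _ "word_scale c u"] simp: canonical_map_word_extend word_extend_scale
            in_keys_iff lookup_word_scale)
    qed
  next
    case (step h)
    then obtain w where "w \<in> lists V" "2 \<le> length w" "h = word_product a \<psi> w"
      by auto
    then show ?case
      by (intro bexI[of _ "word w"]) (auto simp: canonical_map_word_extend)
  qed
  then obtain u where u: "u \<in> word_space V" "canonical_map a \<psi> u = v" "\<And>w. w \<in> keys u \<Longrightarrow> 2 \<le> length w"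
    by auto
  let ?L = "word_extend (\<lambda>w. if length w = 1 then hd w else 0)"
  have "word [v] - u \<in> word_space V"
    using assms u by (intro word.subspace_diff[OF subspace_word_space]) auto
  moreover have "canonical_map a \<psi> (word [v] - u) = 0"
    using u(2) word_product_singleton[OF assms(1)] by (simp add: canonical_map_word_extend word_extend_diff)
  ultimately have "?L (word [v] - u) = 0"
    using kernel_in_ideal supercomm_ideal_letters by blast
  moreover have "?L u = 0"
    unfolding word_extend_def by (rule sum.neutral) (use u(3) in force)
  ultimately show ?thesis
    by (simp add: word_extend_diff)
qed

end

section \<open>Cut ideals of graphs\<close>

definition is_ideal :: "'v mpol set \<Rightarrow> bool" where
  "is_ideal J \<longleftrightarrow> 0 \<in> J \<and> (\<forall>p\<in>J. \<forall>q\<in>J. p + q \<in> J) \<and> (\<forall>p\<in>J. \<forall>r. r * p \<in> J)"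

lemma is_idealD:
  assumes "is_ideal J"
  shows "0 \<in> J" "p \<in> J \<Longrightarrow> q \<in> J \<Longrightarrow> p + q \<in> J" "p \<in> J \<Longrightarrow> r * p \<in> J" "p \<in> J \<Longrightarrow> p * r \<in> J"
    "p \<in> J \<Longrightarrow> p dvd q \<Longrightarrow> q \<in> J"
proof -
  show "0 \<in> J" "p \<in> J \<Longrightarrow> q \<in> J \<Longrightarrow> p + q \<in> J" and mult: "p \<in> J \<Longrightarrow> r * p \<in> J" for p q r
    using assms by (auto simp: is_ideal_def)
  then show "p \<in> J \<Longrightarrow> p * r \<in> J" for p r
    by (metis mult.commute)
  then show "p \<in> J \<Longrightarrow> p dvd q \<Longrightarrow> q \<in> J"
    by auto
qed

lemma ideal_diff: "is_ideal J \<Longrightarrow> p \<in> J \<Longrightarrow> q \<in> J \<Longrightarrow> p - q \<in> J"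
  using is_idealD(2)[of J p "- 1 * q"] is_idealD(3)[of J q "- 1"] by simp

lemma ideal_sum: "is_ideal J \<Longrightarrow> (\<And>i. i \<in> I \<Longrightarrow> p i \<in> J) \<Longrightarrow> (\<Sum>i\<in>I. p i) \<in> J"
  by (induction I rule: infinite_finite_induct) (simp_all add: is_idealD(1,2))

lemma ideal_quotient: "is_ideal J \<Longrightarrow> is_ideal {p. d * p \<in> J}"
  unfolding is_ideal_def by (auto simp: distrib_left mult.left_commute)

definition cut_product :: "('v \<times> 'v) multiset \<Rightarrow> 'v set \<Rightarrow> 'v mpol" where
  "cut_product E S = (\<Prod>(u, v)\<in>#E. if (u \<in> S) \<noteq> (v \<in> S) then Var u - Var v else 1)"

lemma mon_degree_superset:
  "finite S \<Longrightarrow> keys m \<subseteq> S \<Longrightarrow> mon_degree m = (\<Sum>v\<in>S. lookup m v)"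
  unfolding mon_degree_def by (rule sum.mono_neutral_left) (auto simp: in_keys_iff)

lemma mon_degree_add: "mon_degree (m + n) = mon_degree m + mon_degree n"
  by (simp add: mon_degree_superset[of "keys m \<union> keys n"] Poly_Mapping.keys_add lookup_add sum.distrib)

lemma mon_degree_single [simp]: "mon_degree (single v k) = k"
  by (simp add: mon_degree_def)

lemma mon_degree_0 [simp]: "mon_degree 0 = 0"
  by (simp add: mon_degree_def)

text \<open>The function \<open>f\<close> sends a vertex to a representative of its connected component, and each edge
  lowers the number of components by at most one.\<close>

lemma components_bound:
  assumes "finite X"
  shows "\<exists>f :: 'v \<Rightarrow> 'v. (\<forall>(u, v)\<in>#E. f u = f v) \<and> card X \<le> card (f ` X) + size E"
proof (induction E)
  case empty
  show ?case by (rule exI[of _ "\<lambda>x. x"]) auto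
next
  case (add e E)
  obtain u v where e: "e = (u, v)" by (cases e)
  obtain f :: "'v \<Rightarrow> 'v" where f: "\<forall>(u, v)\<in>#E. f u = f v" "card X \<le> card (f ` X) + size E"
    using add by blast
  define g where "g x = (if x = f v then f u else x)" for x
  have "f ` X \<subseteq> insert (f v) ((g \<circ> f) ` X)"
    by (auto simp: g_def image_iff)
  then have "card (f ` X) \<le> card (insert (f v) ((g \<circ> f) ` X))"
    using assms by (intro card_mono) auto
  also have "\<dots> \<le> Suc (card ((g \<circ> f) ` X))"
    using assms by (simp add: card_insert_if)
  finally have "card (f ` X) \<le> Suc (card ((g \<circ> f) ` X))" .
  then show ?case
    using f e by (intro exI[of _ "g \<circ> f"]) (auto simp: g_def)
qed

text \<open>The bound is the first Betti number of a connected graph plus one. Removing an edge \<open>e\<close> lowers it by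
  one and turns the ideal into its quotient by the linear form of \<open>e\<close>, whence by induction the
  multiples of that form by monomials of one degree less lie in the ideal. If no cut is empty, these
  forms together with the sum of all variables generate every variable. If some cut is empty, its
  product is \<open>1\<close>.\<close>

lemma monomials_in_cut_ideal:
  fixes J :: "'v mpol set"
  assumes "finite X" "is_ideal J" "(\<Sum>v\<in>X. Var v) \<in> J"
    and "set_mset E \<subseteq> X \<times> X"
    and "\<And>S. S \<subseteq> X \<Longrightarrow> S \<noteq> {} \<Longrightarrow> S \<noteq> X \<Longrightarrow> cut_product E S \<in> J"
    and "keys m \<subseteq> X" "X \<noteq> {}"
    and "int (mon_degree m) \<ge> int (size E) - int (card X) + 2"
  shows "single m 1 \<in> J"
  using assms(2-8)
proof (induction "size E" arbitrary: E J m rule: less_induct)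
  case (less E)
  let ?crossing = "\<lambda>S. \<exists>(u, v)\<in>#E. (u \<in> S) \<noteq> (v \<in> S)"
  note J = less.prems(1,2) and E = less.prems(3) and m = less.prems(5-7)
  have cut: "cut_product E S \<in> J" if "S \<subseteq> X" "S \<noteq> {}" "S \<noteq> X" for S
    using that by (rule less.prems(4))
  show ?case
  proof (cases "\<exists>S. S \<subseteq> X \<and> S \<noteq> {} \<and> S \<noteq> X \<and> \<not> ?crossing S")
    case True
    then obtain S where S: "S \<subseteq> X" "S \<noteq> {}" "S \<noteq> X" "\<not> ?crossing S"
      by blast
    have "cut_product E S = (\<Prod>e\<in>#E. 1)"
      unfolding cut_product_def
    proof (rule arg_cong[of _ _ prod_mset], rule image_mset_cong)
      fix e assume "e \<in># E"
      then show "(case e of (u, v) \<Rightarrow> if (u \<in> S) \<noteq> (v \<in> S) then Var u - Var v else 1) = (1 :: 'v mpol)"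
        using S(4) by (cases e) auto
    qed
    then have "cut_product E S = 1"
      by simp
    then have "1 \<in> J"
      using cut[OF S(1-3)] by metis
    then have "single m 1 * 1 \<in> J"
      by (rule is_idealD(3)[OF J(1)])
    then show ?thesis
      by (simp only: mult_1_right)
  next
    case False
    then have connected: "S = X" if "S \<subseteq> X" "S \<noteq> {}" "\<not> ?crossing S" for S
      using that by metis
    \<comment> \<open>In degree zero the bound leaves too few edges to connect \<open>X\<close>.\<close>
    have "mon_degree m \<noteq> 0"
    proof
      assume "mon_degree m = 0"
      obtain f :: "'v \<Rightarrow> 'v" where f: "\<forall>(u, v)\<in>#E. f u = f v" "card X \<le> card (f ` X) + size E"
        using components_bound[OF assms(1)] by blast
      then have "2 \<le> card (f ` X)"
        using m(3) \<open>mon_degree m = 0\<close> by linarith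
      obtain u where u: "u \<in> X"
        using m(2) by blast
      have "f ` X \<noteq> {f u}"
        using \<open>2 \<le> card (f ` X)\<close> by auto
      then obtain v where v: "v \<in> X" "f v \<noteq> f u"
        using u by blast
      let ?S = "{w \<in> X. f w = f u}"
      have "w \<in> ?S \<longleftrightarrow> w' \<in> ?S" if "(w, w') \<in># E" for w w'
      proof -
        have "f w = f w'" "w \<in> X" "w' \<in> X"
          using that f(1) E by auto
        then show ?thesis by simp
      qed
      then have "\<not> ?crossing ?S"
        by auto
      then have "?S = X"
        using u by (intro connected) auto
      then show False
        using v by blast
    qed
    then obtain u where u: "u \<in> keys m"
      by (auto simp: mon_degree_def)
    define m' where "m' = m - single u 1"
    have mm': "m = single u 1 + m'"
      by (rule poly_mapping_eqI)
        (use u in \<open>auto simp: m'_def lookup_add lookup_minus lookup_single when_def in_keys_iff\<close>)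
    have m'X: "keys m' \<subseteq> X"
      using m(1) by (auto simp: m'_def in_keys_iff lookup_minus)
    have deg: "mon_degree m = Suc (mon_degree m')"
      by (simp add: mm' mon_degree_add)
    let ?m' = "single m' (1 :: rat)"
    have edge: "(Var x - Var y) * ?m' \<in> J" if "(x, y) \<in># E" for x y
    proof -
      let ?J = "{p. (Var x - Var y) * p \<in> J}"
      have "?m' \<in> ?J"
      proof (rule less.hyps)
        show "is_ideal ?J" "(\<Sum>v\<in>X. Var v) \<in> ?J"
          using ideal_quotient[OF J(1)] is_idealD(3)[OF J] by simp_all
        show "size (E - {#(x, y)#}) < size E"
          using that by (rule size_Diff1_less)
        show "set_mset (E - {#(x, y)#}) \<subseteq> X \<times> X"
          using E by (meson in_diffD subset_iff)
        have "size E = Suc (size (E - {#(x, y)#}))"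
          using that by (simp add: size_Suc_Diff1)
        then show "int (size (E - {#(x, y)#})) - int (card X) + 2 \<le> int (mon_degree m')"
          using m(3) by (simp add: deg)
        fix S assume S: "S \<subseteq> X" "S \<noteq> {}" "S \<noteq> X"
        have "cut_product E S = (if (x \<in> S) \<noteq> (y \<in> S) then Var x - Var y else 1) * cut_product (E - {#(x, y)#}) S"
          unfolding cut_product_def using that
          by (subst insert_DiffM[OF that, symmetric]) (simp del: insert_DiffM insert_DiffM2)
        then have "cut_product E S dvd (Var x - Var y) * cut_product (E - {#(x, y)#}) S"
          by auto
        then show "cut_product (E - {#(x, y)#}) S \<in> ?J"
          using is_idealD(5)[OF J(1) cut[OF S]] by simp
      qed (use m'X m in auto)
      then show ?thesis by simp
    qed
    \<comment> \<open>The vertices \<open>v\<close> whose difference to \<open>u\<close> multiplies \<open>m'\<close> into \<open>J\<close> form a union of connected components.\<close>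
    define R where "R = {v \<in> X. (Var u - Var v) * ?m' \<in> J}"
    have "u \<in> R"
      using u m(1) is_idealD(1)[OF J(1)] by (auto simp: R_def)
    moreover have "\<not> ?crossing R"
    proof -
      have "y \<in> R" if "(x, y) \<in># E" "x \<in> R" for x y
      proof -
        have "(Var u - Var x) * ?m' + (Var x - Var y) * ?m' \<in> J"
          using that edge is_idealD(2)[OF J(1)] by (auto simp: R_def)
        then show ?thesis
          using that E by (auto simp: R_def algebra_simps)
      qed
      moreover have "x \<in> R" if "(x, y) \<in># E" "y \<in> R" for x y
      proof -
        have "(Var u - Var y) * ?m' - (Var x - Var y) * ?m' \<in> J"
          using that edge ideal_diff[OF J(1)] by (auto simp: R_def)
        then show ?thesis
          using that E by (auto simp: R_def algebra_simps)
      qed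
      ultimately show ?thesis by auto
    qed
    ultimately have "R = X"
      by (intro connected) (auto simp only: R_def)
    then have "(\<Sum>v\<in>X. (Var u - Var v) * ?m') \<in> J"
      by (intro ideal_sum[OF J(1)]) (auto simp: R_def)
    moreover have "(\<Sum>v\<in>X. Var v) * ?m' \<in> J"
      by (rule is_idealD(4)[OF J])
    ultimately have in_J: "(\<Sum>v\<in>X. (Var u - Var v) * ?m') + (\<Sum>v\<in>X. Var v) * ?m' \<in> J"
      by (rule is_idealD(2)[OF J(1)])
    have "(\<Sum>v\<in>X. (Var u - Var v) * ?m') + (\<Sum>v\<in>X. Var v) * ?m' = of_nat (card X) * (Var u * ?m')"
      by (simp add: sum_distrib_right left_diff_distrib sum_subtractf)
    with in_J have "of_nat (card X) * (Var u * ?m') \<in> J"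
      by (simp only:)
    then have scaled: "Const (1 / of_nat (card X)) * (of_nat (card X) * (Var u * ?m')) \<in> J"
      by (rule is_idealD(3)[OF J(1)])
    have "card X \<noteq> 0"
      using m(2) assms(1) by simp
    then have "Const (1 / of_nat (card X)) * of_nat (card X) = (1 :: 'v mpol)"
      unfolding single_of_nat[symmetric] Const_def mult_single by simp
    then have "Var u * ?m' \<in> J"
      using scaled by (simp only: mult.assoc[symmetric] mult_1)
    moreover have "Var u * ?m' = single m 1"
      by (simp add: Var_def mult_single mm')
    ultimately show ?thesis
      by simp
  qed
qed

section \<open>Multiplication by the sum of the variables\<close>

definition sigma_poly :: "('i::finite \<Rightarrow> nat) \<Rightarrow> ('i \<times> nat) mpol" where
  "sigma_poly \<gamma> = (\<Sum>i\<in>UNIV. \<Sum>\<alpha><\<gamma> i. Var (i, \<alpha>))"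

definition mult_sigma :: "'i::finite coha \<Rightarrow> 'i coha" where
  "mult_sigma h = (\<Sum>\<gamma>\<in>keys h. single \<gamma> (sigma_poly \<gamma> * lookup h \<gamma>))"

definition total :: "('i::finite \<Rightarrow> rat set) \<Rightarrow> rat" where
  "total A = (\<Sum>i\<in>UNIV. \<Sum>b\<in>A i. b)"

lemma eval_sigma_poly:
  assumes "row_inj \<gamma> x"
  shows "eval_at x (sigma_poly \<gamma>) = total (rows \<gamma> x)"
  using assms by (simp add: sigma_poly_def total_def rows_def row_inj_def sum.reindex)

lemma sorted_point:
  assumes "\<And>i. finite (A i)"
  shows "(\<lambda>i. sorted_list_of_set (A i)) \<in> enums A"
    and "row_inj (cards A) (pt (\<lambda>i. sorted_list_of_set (A i)))"
    and "rows (cards A) (pt (\<lambda>i. sorted_list_of_set (A i))) = A"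
proof -
  show e: "(\<lambda>i. sorted_list_of_set (A i)) \<in> enums A"
    using assms by (rule sorted_list_in_enums)
  show "row_inj (cards A) (pt (\<lambda>i. sorted_list_of_set (A i)))"
    "rows (cards A) (pt (\<lambda>i. sorted_list_of_set (A i))) = A"
    using row_inj_pt[OF e] assms by simp_all
qed

lemma eval_set_sigma_poly:
  assumes "\<And>i. finite (A i)"
  shows "eval_set (sigma_poly (cards A)) A = total A"
  using eval_sigma_poly[OF sorted_point(2)[of A]] sorted_point(3)[of A] assms by (simp add: eval_set_def)

lemma sigma_poly_mult_in_comp:
  "f \<in> coha_comp \<gamma> \<Longrightarrow> sigma_poly \<gamma> * f \<in> coha_comp (\<gamma> :: 'i::finite \<Rightarrow> nat)"
  by (rule coha_compI[where R = "\<lambda>A. total A * eval_set f A"]) (simp add: eval_sigma_poly eval_at_row_inj)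

lemma lookup_mult_sigma: "lookup (mult_sigma h) \<gamma> = sigma_poly \<gamma> * lookup h \<gamma>"
  by (simp add: mult_sigma_def lookup_sum lookup_single when_def in_keys_iff sum.delta)

lemma mult_sigma_in_space: "h \<in> coha_space \<Longrightarrow> mult_sigma h \<in> coha_space"
  by (simp add: coha_space_def lookup_mult_sigma sigma_poly_mult_in_comp)

lemma mult_sigma_in_plus: "h \<in> coha_plus \<Longrightarrow> mult_sigma h \<in> coha_plus"
  by (simp add: coha_plus_def mult_sigma_in_space lookup_mult_sigma)

lemma mult_sigma_add: "mult_sigma (x + y) = mult_sigma x + mult_sigma y"
  by (rule poly_mapping_eqI) (simp add: lookup_mult_sigma lookup_add distrib_left)

lemma mult_sigma_scale: "mult_sigma (coha_scale c x) = coha_scale c (mult_sigma x)"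
  by (rule poly_mapping_eqI) (simp add: lookup_mult_sigma lookup_coha_scale mult_ac)

lemma mult_sigma_0 [simp]: "mult_sigma 0 = 0"
  by (simp add: mult_sigma_def)

lemma mult_sigma_single: "mult_sigma (single \<gamma> f) = single \<gamma> (sigma_poly \<gamma> * f)"
  by (rule poly_mapping_eqI) (simp add: lookup_mult_sigma lookup_single when_def)

lemma module_hom_mult_sigma: "module_hom coha_scale coha_scale mult_sigma"
  by unfold_locales (simp_all add: mult_sigma_add mult_sigma_scale)

lemmas mult_sigma_diff = module_hom.diff[OF module_hom_mult_sigma]
  and mult_sigma_sum = module_hom.sum[OF module_hom_mult_sigma]

lemma hat_mult_sigma: "(\<And>i. finite (A i)) \<Longrightarrow> hat (mult_sigma h) A = total A * hat h A"
  using eval_set_sigma_poly[of A] by (simp add: hat_def lookup_mult_sigma eval_set_def)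

lemma total_split:
  assumes "B \<in> subfams A" "\<And>i. finite (A i)"
  shows "total A = total B + total (diff_fam A B)"
  unfolding total_def sum.distrib[symmetric]
proof (rule sum.cong[OF refl])
  fix i
  have "B i \<subseteq> A i"
    using assms by (auto simp: subfams_def)
  then show "(\<Sum>b\<in>A i. b) = (\<Sum>b\<in>B i. b) + (\<Sum>b\<in>diff_fam A B i. b)"
    using sum.subset_diff[of "B i" "A i" "\<lambda>b. b"] assms by simp
qed

text \<open>The sum of the variables is additive under splitting a family, so it acts as a derivation.\<close>

lemma mult_sigma_star:
  assumes x: "x \<in> coha_space" and y: "y \<in> coha_space"
  shows "mult_sigma (coha_star a \<psi> x y) = coha_star a \<psi> (mult_sigma x) y + coha_star a \<psi> x (mult_sigma y)"
proof (rule coha_eqI)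
  fix A :: "'a \<Rightarrow> rat set" assume A: "\<And>i. finite (A i)"
  have fin: "finite (B i)" if "B \<in> subfams A" for B i
    using that A by (rule finite_subfam)
  have "hat (mult_sigma (coha_star a \<psi> x y)) A = (\<Sum>B\<in>subfams A. (total B + total (diff_fam A B)) *
      (twist \<psi> (cards B) (cards (diff_fam A B)) * hat x B * hat y (diff_fam A B) *
       shuffle_kernel a B (diff_fam A B)))"
    unfolding hat_mult_sigma[OF A] hat_star[OF x y A] sum_distrib_left
    by (rule sum.cong[OF refl]) (simp add: total_split[OF _ A])
  also have "\<dots> = hat (coha_star a \<psi> (mult_sigma x) y + coha_star a \<psi> x (mult_sigma y)) A"
    unfolding hat_add hat_star[OF mult_sigma_in_space[OF x] y A] hat_star[OF x mult_sigma_in_space[OF y] A]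
      sum.distrib[symmetric]
    by (rule sum.cong[OF refl]) (simp add: hat_mult_sigma fin A algebra_simps)
  finally show "hat (mult_sigma (coha_star a \<psi> x y)) A =
    hat (coha_star a \<psi> (mult_sigma x) y + coha_star a \<psi> x (mult_sigma y)) A" .
qed (use x y in \<open>auto intro!: coha_star_in_space mult_sigma_in_space space_add\<close>)

lemma mult_sigma_decomposables:
  assumes "h \<in> decomposables a \<psi>"
  shows "mult_sigma h \<in> decomposables a \<psi>"
  using assms unfolding decomposables_def
proof (induction rule: coha.span_induct)
  case base
  show ?case
    by (rule coha.subspaceI)
      (auto simp: mult_sigma_add mult_sigma_scale coha.span_zero intro: coha.span_add coha.span_scale)
next
  case (step h)
  then obtain x y where h: "h = coha_star a \<psi> x y" "x \<in> coha_plus" "y \<in> coha_plus"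
    by auto
  have "mult_sigma h \<in> decomposables a \<psi>"
    unfolding h mult_sigma_star[OF h(2,3)[THEN plus_in_space]]
    using h by (intro coha.subspace_add[OF subspace_decomposables] coha_star_in_decomposables mult_sigma_in_plus)
  then show ?case
    by (simp add: decomposables_def)
qed


section \<open>Symmetrization\<close>

definition row_perms :: "('i \<Rightarrow> nat) \<Rightarrow> ('i \<Rightarrow> nat \<Rightarrow> nat) set" where
  "row_perms \<gamma> = {\<pi>. \<forall>i. \<pi> i permutes {..<\<gamma> i}}"

definition symmetrize :: "('i::finite \<Rightarrow> nat) \<Rightarrow> ('i \<times> nat) mpol \<Rightarrow> ('i \<times> nat) mpol" where
  "symmetrize \<gamma> f =
     (\<Sum>\<pi>\<in>row_perms \<gamma>. subst (\<lambda>(i, \<alpha>). if \<alpha> < \<gamma> i then Var (i, \<pi> i \<alpha>) else 0) f)"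

lemma finite_row_perms: "finite (row_perms (\<gamma> :: 'i::finite \<Rightarrow> nat))"
proof -
  have "row_perms \<gamma> = PiE UNIV (\<lambda>i. {p. p permutes {..<\<gamma> i}})"
    by (auto simp: row_perms_def PiE_UNIV_domain)
  then show ?thesis
    by (simp add: finite_PiE finite_permutations)
qed

lemma length_enum:
  assumes "e \<in> enums A"
  shows "length (e i) = card (A i)"
  using assms distinct_card[of "e i"] by (simp add: enums_def)

lemma bij_betw_row_perms_enums:
  assumes e: "e \<in> enums A"
  shows "bij_betw (\<lambda>\<pi> i. permute_list (\<pi> i) (e i)) (row_perms (cards A)) (enums A)"
  unfolding bij_betw_def
proof (intro conjI inj_onI equalityI subsetI)
  have len: "length (e i) = cards A i" for i
    using length_enum[OF e] by (simp add: cards_def)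
  have dist: "distinct (e i)" and set: "set (e i) = A i" for i
    using e by (auto simp: enums_def)
  {
    fix \<pi> \<rho> assume \<pi>: "\<pi> \<in> row_perms (cards A)" and \<rho>: "\<rho> \<in> row_perms (cards A)"
      and eq: "(\<lambda>i. permute_list (\<pi> i) (e i)) = (\<lambda>i. permute_list (\<rho> i) (e i))"
    show "\<pi> = \<rho>"
    proof (intro ext)
      fix i \<alpha>
      have p: "\<pi> i permutes {..<cards A i}" "\<rho> i permutes {..<cards A i}"
        using \<pi> \<rho> by (auto simp: row_perms_def)
      show "\<pi> i \<alpha> = \<rho> i \<alpha>"
      proof (cases "\<alpha> < cards A i")
        case True
        have "permute_list (\<pi> i) (e i) ! \<alpha> = permute_list (\<rho> i) (e i) ! \<alpha>"
          using fun_cong[OF eq, of i] by simp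
        then have "e i ! \<pi> i \<alpha> = e i ! \<rho> i \<alpha>"
          using p True by (simp add: permute_list_nth len)
        moreover have "\<pi> i \<alpha> < length (e i)" "\<rho> i \<alpha> < length (e i)"
          using permutes_in_image[OF p(1), of \<alpha>] permutes_in_image[OF p(2), of \<alpha>] True by (auto simp: len)
        ultimately show ?thesis
          using dist by (simp add: nth_eq_iff_index_eq)
      next
        case False
        then show ?thesis
          using p by (simp add: permutes_not_in)
      qed
    qed
  }
  {
    fix e' assume "e' \<in> (\<lambda>\<pi> i. permute_list (\<pi> i) (e i)) ` row_perms (cards A)"
    then show "e' \<in> enums A"
      using dist set by (auto simp: enums_def row_perms_def len)
  }
  {
    fix e' assume e': "e' \<in> enums A"
    have "\<exists>p. p permutes {..<cards A i} \<and> permute_list p (e i) = e' i" for i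
    proof -
      have "mset (e' i) = mset (e i)"
        using e' dist set by (subst set_eq_iff_mset_eq_distinct[symmetric]) (auto simp: enums_def)
      then show ?thesis
        using mset_eq_permutation[of "e' i" "e i"] by (auto simp: len)
    qed
    then obtain p where "\<And>i. p i permutes {..<cards A i}" "\<And>i. permute_list (p i) (e i) = e' i"
      by metis
    then show "e' \<in> (\<lambda>\<pi> i. permute_list (\<pi> i) (e i)) ` row_perms (cards A)"
      by (intro image_eqI[of _ _ p]) (auto simp: row_perms_def)
  }
qed

lemma finite_enums:
  assumes "\<And>i. finite (A i)"
  shows "finite (enums (A :: 'i::finite \<Rightarrow> rat set))"
proof -
  have "(\<lambda>i. sorted_list_of_set (A i)) \<in> enums A"
    using assms by (rule sorted_point)
  from bij_betw_finite[OF bij_betw_row_perms_enums[OF this]] show ?thesis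
    by (simp add: finite_row_perms)
qed

lemma pt_permute:
  assumes "e \<in> enums A" "\<pi> \<in> row_perms (cards A)"
  shows "pt (\<lambda>i. permute_list (\<pi> i) (e i)) = (\<lambda>(i, \<alpha>). pt e (i, \<pi> i \<alpha>))"
proof (rule ext, safe)
  fix i \<alpha>
  have p: "\<pi> i permutes {..<length (e i)}"
    using assms length_enum[OF assms(1)] by (auto simp: row_perms_def cards_def)
  then have "\<pi> i \<alpha> < length (e i) \<longleftrightarrow> \<alpha> < length (e i)"
    using permutes_in_image[OF p, of \<alpha>] by simp
  then show "pt (\<lambda>i. permute_list (\<pi> i) (e i)) (i, \<alpha>) = pt e (i, \<pi> i \<alpha>)"
    using p by (simp add: pt_def permute_list_nth)
qed

lemma sum_enums_permute:
  fixes A :: "'i::finite \<Rightarrow> rat set"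
  assumes A: "\<And>i. finite (A i)" and \<rho>: "\<rho> \<in> row_perms (cards A)"
  shows "(\<Sum>e\<in>enums A. F (\<lambda>(i, \<alpha>). pt e (i, \<rho> i \<alpha>))) = (\<Sum>e\<in>enums A. F (pt e))"
proof -
  have inj: "inj_on (\<lambda>e i. permute_list (\<rho> i) (e i)) (enums A)"
  proof (intro inj_onI ext)
    fix e e' i
    assume e: "e \<in> enums A" "e' \<in> enums A"
      and eq: "(\<lambda>i. permute_list (\<rho> i) (e i)) = (\<lambda>i. permute_list (\<rho> i) (e' i))"
    have p: "\<rho> i permutes {..<card (A i)}"
      using \<rho> by (auto simp: row_perms_def cards_def)
    have inv_e: "permute_list (inv (\<rho> i)) (permute_list (\<rho> i) (e i)) = e i" if "e \<in> enums A" for e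
    proof -
      have "permute_list (\<rho> i \<circ> inv (\<rho> i)) (e i) = permute_list (inv (\<rho> i)) (permute_list (\<rho> i) (e i))"
        by (rule permute_list_compose) (use permutes_inv[OF p] length_enum[OF that] in simp)
      then show ?thesis
        by (simp add: permutes_inv_o[OF p])
    qed
    show "e i = e' i"
      using inv_e[OF e(1)] inv_e[OF e(2)] fun_cong[OF eq, of i] by metis
  qed
  have "(\<lambda>e i. permute_list (\<rho> i) (e i)) ` enums A \<subseteq> enums A"
  proof (rule image_subsetI)
    fix e assume "e \<in> enums A"
    then show "(\<lambda>i. permute_list (\<rho> i) (e i)) \<in> enums A"
      using bij_betw_row_perms_enums[of e A] \<rho> by (auto simp: bij_betw_def)
  qed
  then have "(\<lambda>e i. permute_list (\<rho> i) (e i)) ` enums A = enums A"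
    using inj by (rule endo_inj_surj[OF finite_enums, rotated]) (rule A)
  then have "bij_betw (\<lambda>e i. permute_list (\<rho> i) (e i)) (enums A) (enums A)"
    using inj by (simp add: bij_betw_def)
  then have "(\<Sum>e\<in>enums A. F (pt (\<lambda>i. permute_list (\<rho> i) (e i)))) = (\<Sum>e\<in>enums A. F (pt e))"
    by (rule sum.reindex_bij_betw)
  moreover have "(\<Sum>e\<in>enums A. F (pt (\<lambda>i. permute_list (\<rho> i) (e i)))) =
      (\<Sum>e\<in>enums A. F (\<lambda>(i, \<alpha>). pt e (i, \<rho> i \<alpha>)))"
    by (intro sum.cong refl arg_cong[of _ _ F] pt_permute[OF _ \<rho>])
  ultimately show ?thesis by metis
qed

lemma eval_symmetrize:
  fixes \<gamma> :: "'i::finite \<Rightarrow> nat"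
  assumes x: "row_inj \<gamma> x"
  shows "eval_at x (symmetrize \<gamma> f) = (\<Sum>e\<in>enums (rows \<gamma> x). eval_at (pt e) f)"
proof -
  define e where "e i = map (\<lambda>\<alpha>. x (i, \<alpha>)) [0..<\<gamma> i]" for i
  have e: "e \<in> enums (rows \<gamma> x)"
    using x by (auto simp: enums_def e_def rows_def distinct_map row_inj_def atLeast0LessThan)
  have eq: "eval_at x (subst (\<lambda>(i, \<alpha>). if \<alpha> < \<gamma> i then Var (i, \<pi> i \<alpha>) else 0) f)
      = eval_at (pt (\<lambda>i. permute_list (\<pi> i) (e i))) f" if \<pi>: "\<pi> \<in> row_perms \<gamma>" for \<pi>
  proof -
    have "eval_at x (case v of (i, \<alpha>) \<Rightarrow> if \<alpha> < \<gamma> i then Var (i, \<pi> i \<alpha>) else 0)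
        = pt (\<lambda>i. permute_list (\<pi> i) (e i)) v" for v
    proof (cases v)
      case (Pair i \<alpha>)
      have p: "\<pi> i permutes {..<\<gamma> i}"
        using \<pi> by (simp add: row_perms_def)
      then have "\<pi> i \<alpha> < \<gamma> i \<longleftrightarrow> \<alpha> < \<gamma> i"
        using permutes_in_image[OF p, of \<alpha>] by simp
      then show ?thesis
        using p by (simp add: Pair pt_def permute_list_nth) (simp add: e_def permute_list_nth)
    qed
    then show ?thesis by simp
  qed
  have "eval_at x (symmetrize \<gamma> f) = (\<Sum>\<pi>\<in>row_perms \<gamma>. eval_at (pt (\<lambda>i. permute_list (\<pi> i) (e i))) f)"
    unfolding symmetrize_def eval_at_sum by (rule sum.cong[OF refl eq])
  also have "\<dots> = (\<Sum>e\<in>enums (rows \<gamma> x). eval_at (pt e) f)"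
    using sum.reindex_bij_betw[OF bij_betw_row_perms_enums[OF e]] by (simp add: cards_rows[OF x])
  finally show ?thesis .
qed

lemma symmetrize_in_comp: "symmetrize \<gamma> f \<in> coha_comp (\<gamma> :: 'i::finite \<Rightarrow> nat)"
  using eval_symmetrize by (rule coha_compI)

lemma eval_set_symmetrize:
  assumes A: "\<And>i. finite (A i)"
  shows "eval_set (symmetrize (cards A) f) A = (\<Sum>e\<in>enums A. eval_at (pt e) f)"
  using eval_symmetrize[OF sorted_point(2)[of A]] sorted_point(3)[of A] A by (simp add: eval_set_def)

lemma single_eqI:
  fixes \<gamma> :: "'i::finite \<Rightarrow> nat"
  assumes "p \<in> coha_comp \<gamma>" "q \<in> coha_comp \<gamma>"
    and "\<And>A. (\<And>i. finite (A i)) \<Longrightarrow> cards A = \<gamma> \<Longrightarrow> eval_set p A = eval_set q A"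
  shows "p = q"
proof -
  have "single \<gamma> p = single \<gamma> q"
    by (rule coha_eqI) (use assms in \<open>auto simp: hat_single\<close>)
  then show ?thesis
    by (metis lookup_single_eq)
qed

lemma symmetrize_add: "symmetrize \<gamma> (f + g) = symmetrize \<gamma> f + symmetrize (\<gamma> :: 'i::finite \<Rightarrow> nat) g"
proof (rule single_eqI[of _ \<gamma>])
  fix A :: "'i \<Rightarrow> rat set" assume A: "\<And>i. finite (A i)" "cards A = \<gamma>"
  have "eval_set (symmetrize \<gamma> h) A = (\<Sum>e\<in>enums A. eval_at (pt e) h)" for h
    using eval_set_symmetrize[of A h] A by simp
  moreover have "eval_set (p + q) A = eval_set p A + eval_set q A" for p q
    by (simp add: eval_set_def)
  ultimately show "eval_set (symmetrize \<gamma> (f + g)) A = eval_set (symmetrize \<gamma> f + symmetrize \<gamma> g) A"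
    by (simp add: sum.distrib)
qed (auto intro: symmetrize_in_comp coha_comp_add)

lemma symmetrize_0: "symmetrize \<gamma> 0 = (0 :: ('i::finite \<times> nat) mpol)"
  using symmetrize_add[of \<gamma> 0 0] by simp

lemma symmetrize_mult:
  assumes f: "f \<in> coha_comp (\<gamma> :: 'i::finite \<Rightarrow> nat)"
  shows "symmetrize \<gamma> (f * g) = f * symmetrize \<gamma> g"
proof (rule single_eqI)
  show "f * symmetrize \<gamma> g \<in> coha_comp \<gamma>"
    by (rule coha_compI[where R = "\<lambda>A. eval_set f A * eval_set (symmetrize \<gamma> g) A"])
      (simp add: eval_at_row_inj[OF f] eval_at_row_inj[OF symmetrize_in_comp])
  fix A :: "'i \<Rightarrow> rat set" assume A: "\<And>i. finite (A i)" "cards A = \<gamma>"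
  have symm: "eval_set (symmetrize \<gamma> h) A = (\<Sum>e\<in>enums A. eval_at (pt e) h)" for h
    using eval_set_symmetrize[of A h] A by simp
  have "eval_set (f * symmetrize \<gamma> g) A = eval_set f A * eval_set (symmetrize \<gamma> g) A"
    by (simp add: eval_set_def)
  also have "\<dots> = (\<Sum>e\<in>enums A. eval_set f A * eval_at (pt e) g)"
    by (simp add: symm sum_distrib_left)
  also have "\<dots> = (\<Sum>e\<in>enums A. eval_at (pt e) (f * g))"
    using eval_at_enum[of f A] A f by (intro sum.cong) auto
  finally show "eval_set (symmetrize \<gamma> (f * g)) A = eval_set (f * symmetrize \<gamma> g) A"
    by (simp add: symm)
qed (rule symmetrize_in_comp)

lemma sigma_poly_in_comp: "sigma_poly \<gamma> \<in> coha_comp (\<gamma> :: 'i::finite \<Rightarrow> nat)"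
  using sigma_poly_mult_in_comp[OF coha_comp_1] by simp

text \<open>An ordering of the family \<open>A\<close> is an ordering of a subfamily \<open>B\<close> followed by an ordering of the
  remaining elements.\<close>

lemma sum_enums_split:
  fixes A :: "'i::finite \<Rightarrow> rat set"
  assumes A: "\<And>i. finite (A i)" and \<gamma>1: "\<And>i. \<gamma>1 i \<le> card (A i)"
  shows "(\<Sum>e\<in>enums A. G e) = (\<Sum>B | B \<in> subfams A \<and> cards B = \<gamma>1.
    \<Sum>b\<in>enums B. \<Sum>c\<in>enums (diff_fam A B). G (\<lambda>i. b i @ c i))"
proof -
  let ?Bs = "{B. B \<in> subfams A \<and> cards B = \<gamma>1}"
  have fin: "finite (B i)" if "B \<in> subfams A" for B i
    using that A by (rule finite_subfam)
  have "(\<Sum>e\<in>enums A. G e) =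
      (\<Sum>(B, b, c)\<in>(SIGMA B:?Bs. enums B \<times> enums (diff_fam A B)). G (\<lambda>i. b i @ c i))"
  proof (rule sum.reindex_bij_witness[where i = "\<lambda>(B, b, c) i. b i @ c i" and
        j = "\<lambda>e. (\<lambda>i. set (take (\<gamma>1 i) (e i)), \<lambda>i. take (\<gamma>1 i) (e i), \<lambda>i. drop (\<gamma>1 i) (e i))"])
    fix e assume e: "e \<in> enums A"
    then have d: "distinct (e i)" and s: "set (e i) = A i" for i
      by (auto simp: enums_def)
    let ?B = "\<lambda>i. set (take (\<gamma>1 i) (e i))"
    have "set (take (\<gamma>1 i) (e i)) \<union> set (drop (\<gamma>1 i) (e i)) = A i" for i
      by (metis append_take_drop_id s set_append)
    moreover have "set (take (\<gamma>1 i) (e i)) \<inter> set (drop (\<gamma>1 i) (e i)) = {}" for i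
      using d by (simp add: set_take_disj_set_drop_if_distinct)
    ultimately have "set (drop (\<gamma>1 i) (e i)) = A i - ?B i" "?B i \<subseteq> A i" for i
      by blast+
    moreover have "card (?B i) = \<gamma>1 i" for i
      using d \<gamma>1 length_enum[OF e] by (simp add: distinct_card)
    ultimately show "(\<lambda>i. set (take (\<gamma>1 i) (e i)), \<lambda>i. take (\<gamma>1 i) (e i), \<lambda>i. drop (\<gamma>1 i) (e i))
        \<in> (SIGMA B:?Bs. enums B \<times> enums (diff_fam A B))"
      using d by (auto simp: subfams_def cards_def enums_def)
  next
    fix p assume "p \<in> (SIGMA B:?Bs. enums B \<times> enums (diff_fam A B))"
    then obtain B b c where p: "p = (B, b, c)" "B \<in> subfams A" "cards B = \<gamma>1"
      and b: "b \<in> enums B" and c: "c \<in> enums (diff_fam A B)"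
      by auto
    have len: "length (b i) = \<gamma>1 i" for i
      using length_enum[OF b] p(3) by (auto simp: cards_def)
    then show "(\<lambda>e. (\<lambda>i. set (take (\<gamma>1 i) (e i)), \<lambda>i. take (\<gamma>1 i) (e i), \<lambda>i. drop (\<gamma>1 i) (e i)))
        ((\<lambda>(B, b, c) i. b i @ c i) p) = p"
      using b by (auto simp: p enums_def)
    show "(\<lambda>(B, b, c) i. b i @ c i) p \<in> enums A"
      using b c p(2) by (auto simp: p(1) enums_def subfams_def)
  qed auto
  also have "\<dots> = (\<Sum>B\<in>?Bs. \<Sum>b\<in>enums B. \<Sum>c\<in>enums (diff_fam A B). G (\<lambda>i. b i @ c i))"
  proof -
    have "(\<Sum>(B, b, c)\<in>(SIGMA B:?Bs. enums B \<times> enums (diff_fam A B)). G (\<lambda>i. b i @ c i)) =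
        (\<Sum>B\<in>?Bs. \<Sum>(b, c)\<in>enums B \<times> enums (diff_fam A B). G (\<lambda>i. b i @ c i))"
      by (rule sum.Sigma[symmetric]) (use A fin finite_subfams[of A, OF A] in \<open>auto simp: finite_enums\<close>)
    then show ?thesis
      by (simp only: sum.cartesian_product[symmetric])
  qed
  finally show ?thesis .
qed

text \<open>Symmetrizing the product of a shuffle kernel with an arbitrary polynomial gives a sum of products:
  after splitting each monomial into its parts on either side of the cut, the orderings of a family
  are pairs of orderings of the two halves.\<close>

lemma symmetrized_kernel_decomposable:
  fixes \<gamma> :: "'i::finite \<Rightarrow> nat"
  assumes p: "p \<in> coha_comp \<gamma>" and \<gamma>: "\<gamma> = (\<lambda>i. \<gamma>1 i + \<gamma>2 i)" "\<gamma>1 \<noteq> (\<lambda>_. 0)" "\<gamma>2 \<noteq> (\<lambda>_. 0)"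
    and eval: "\<And>A. (\<And>i. finite (A i)) \<Longrightarrow> cards A = \<gamma> \<Longrightarrow> eval_set p A =
      (\<Sum>e\<in>enums A. shuffle_kernel a (\<lambda>i. set (take (\<gamma>1 i) (e i))) (\<lambda>i. set (drop (\<gamma>1 i) (e i))) *
        eval_at (pt e) H)"
  shows "single \<gamma> p \<in> decomposables a \<psi>"
proof -
  define f1 where "f1 m = (\<Prod>v\<in>keys m. if snd v < \<gamma>1 (fst v) then Var v ^ lookup m v else 1)"
    for m :: "('i \<times> nat) \<Rightarrow>\<^sub>0 nat"
  define f2 where "f2 m = (\<Prod>v\<in>keys m. if snd v < \<gamma>1 (fst v) then 1
      else Var (fst v, snd v - \<gamma>1 (fst v)) ^ lookup m v)" for m :: "('i \<times> nat) \<Rightarrow>\<^sub>0 nat"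
  define x where "x m = single \<gamma>1 (symmetrize \<gamma>1 (f1 m))" for m
  define y where "y m = single \<gamma>2 (symmetrize \<gamma>2 (f2 m))" for m
  have x: "x m \<in> coha_plus" and y: "y m \<in> coha_plus" for m
    using \<gamma>(2,3) by (auto simp: x_def y_def coha_plus_def symmetrize_in_comp lookup_single when_def)
  define D where "D = (\<Sum>m\<in>keys H. coha_scale (twist \<psi> \<gamma>1 \<gamma>2 * lookup H m) (coha_star a \<psi> (x m) (y m)))"
  have D: "D \<in> decomposables a \<psi>"
    unfolding D_def
    by (intro coha.subspace_sum[OF subspace_decomposables] coha.subspace_scale[OF subspace_decomposables]
        coha_star_in_decomposables x y)
  have "single \<gamma> p = D"
  proof (rule coha_eqI)
    fix A :: "'i \<Rightarrow> rat set" assume A: "\<And>i. finite (A i)"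
    have fin: "finite (B i)" if "B \<in> subfams A" for B i
      using that A by (rule finite_subfam)
    have finA: "finite (subfams A)"
      using A by (rule finite_subfams)
    let ?C = "\<lambda>B. diff_fam A B" and ?K = "\<lambda>B. shuffle_kernel a B (diff_fam A B)"
    let ?X = "\<lambda>m B. \<Sum>b\<in>enums B. eval_at (pt b) (f1 m)"
      and ?Y = "\<lambda>m B. \<Sum>c\<in>enums (diff_fam A B). eval_at (pt c) (f2 m)"
      and ?XY = "\<lambda>m b c. eval_at (pt b) (f1 m) * eval_at (pt c) (f2 m)"
    have star: "hat (coha_star a \<psi> (x m) (y m)) A = (\<Sum>B | B \<in> subfams A \<and> cards B = \<gamma>1.
        if cards (?C B) = \<gamma>2 then twist \<psi> \<gamma>1 \<gamma>2 * ?K B *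
          (?X m B * ?Y m B) else 0)" for m
      unfolding hat_star[OF x[THEN plus_in_space] y[THEN plus_in_space] A]
    proof (rule sum.mono_neutral_cong_right)
      show "\<forall>B\<in>subfams A - {B. B \<in> subfams A \<and> cards B = \<gamma>1}.
          twist \<psi> (cards B) (cards (?C B)) * hat (x m) B * hat (y m) (?C B) * ?K B = 0"
        by (auto simp: x_def hat_single)
      fix B assume B: "B \<in> {B. B \<in> subfams A \<and> cards B = \<gamma>1}"
      have "hat (x m) B = ?X m B"
        using B eval_set_symmetrize[of B "f1 m"] fin by (auto simp: x_def hat_single)
      moreover have "hat (y m) (?C B) = (if cards (?C B) = \<gamma>2
          then ?Y m B else 0)"
        using eval_set_symmetrize[of "diff_fam A B" "f2 m"] A by (auto simp: y_def hat_single)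
      ultimately show "twist \<psi> (cards B) (cards (?C B)) * hat (x m) B * hat (y m) (?C B) * ?K B =
          (if cards (?C B) = \<gamma>2 then twist \<psi> \<gamma>1 \<gamma>2 * ?K B *
          (?X m B * ?Y m B) else 0)"
        using B by simp
    qed (use finA in auto)
    show "hat (single \<gamma> p) A = hat D A"
    proof (cases "cards A = \<gamma>")
      case False
      then have "cards (?C B) \<noteq> \<gamma>2" if "B \<in> subfams A" "cards B = \<gamma>1" for B
        using cards_split[OF that(1) A] that(2) \<gamma>(1) by auto
      then show ?thesis
        using False by (simp add: hat_single D_def star)
    next
      case True
      have c2: "cards (?C B) = \<gamma>2" if "B \<in> subfams A" "cards B = \<gamma>1" for B
        using cards_split[OF that(1) A] that(2) True by (auto simp: \<gamma>(1) fun_eq_iff)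
      have \<gamma>1_le: "\<gamma>1 i \<le> card (A i)" for i
        using fun_cong[OF True, of i] by (simp add: cards_def \<gamma>(1))
      have concat: "eval_at (pt (\<lambda>i. b i @ c i)) H =
          (\<Sum>m\<in>keys H. lookup H m * ?XY m b c)"
        if "b \<in> enums B" "cards B = \<gamma>1" for B b c
      proof -
        have len: "length (b i) = \<gamma>1 i" for i
          using length_enum[OF that(1)] that(2) by (auto simp: cards_def)
        have "monom_at (pt (\<lambda>i. b i @ c i)) m = eval_at (pt b) (f1 m) * eval_at (pt c) (f2 m)" for m
          unfolding monom_at_def f1_def f2_def eval_at_prod prod.distrib[symmetric]
          by (rule prod.cong) (auto simp: pt_def nth_append len)
        then show ?thesis
          by (simp add: eval_at_def[of _ H])
      qed
      have "hat (single \<gamma> p) A = (\<Sum>B | B \<in> subfams A \<and> cards B = \<gamma>1.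
          \<Sum>b\<in>enums B. \<Sum>c\<in>enums (?C B).
            ?K B * (\<Sum>m\<in>keys H. lookup H m * ?XY m b c))"
        unfolding hat_single eval[of A, OF A True] sum_enums_split[of A, OF A \<gamma>1_le]
        using True
      proof (simp, intro sum.cong refl)
        fix B b c assume B: "B \<in> {B. B \<in> subfams A \<and> cards B = \<gamma>1}" and b: "b \<in> enums B" and c: "c \<in> enums (?C B)"
        have len: "length (b i) = \<gamma>1 i" for i
          using length_enum[OF b] B by (auto simp: cards_def)
        have "(\<lambda>i. set (take (\<gamma>1 i) (b i @ c i))) = B" "(\<lambda>i. set (drop (\<gamma>1 i) (b i @ c i))) = diff_fam A B"
          using b c by (auto simp: len enums_def fun_eq_iff)
        then show "shuffle_kernel a (\<lambda>i. set (take (\<gamma>1 i) (b i)) \<union> set (take (\<gamma>1 i - length (b i)) (c i)))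
            (\<lambda>i. set (drop (\<gamma>1 i) (b i)) \<union> set (drop (\<gamma>1 i - length (b i)) (c i))) * eval_at (pt (\<lambda>i. b i @ c i)) H
          = ?K B * (\<Sum>m\<in>keys H. lookup H m * ?XY m b c)"
          using concat[OF b] B by simp
      qed
      also have "\<dots> = (\<Sum>B | B \<in> subfams A \<and> cards B = \<gamma>1. \<Sum>m\<in>keys H.
          lookup H m * ?K B * (?X m B *
            ?Y m B))"
      proof (rule sum.cong[OF refl])
        fix B
        have "(\<Sum>b\<in>enums B. \<Sum>c\<in>enums (?C B).
            ?K B * (\<Sum>m\<in>keys H. lookup H m * ?XY m b c))
          = (\<Sum>b\<in>enums B. \<Sum>m\<in>keys H. \<Sum>c\<in>enums (?C B).
            lookup H m * ?K B * ?XY m b c)"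
        proof (rule sum.cong[OF refl])
          fix b
          have "(\<Sum>c\<in>enums (?C B).
              ?K B * (\<Sum>m\<in>keys H. lookup H m * ?XY m b c))
            = (\<Sum>c\<in>enums (?C B). \<Sum>m\<in>keys H.
              lookup H m * ?K B * ?XY m b c)"
            by (simp add: sum_distrib_left mult_ac)
          also have "\<dots> = (\<Sum>m\<in>keys H. \<Sum>c\<in>enums (?C B).
              lookup H m * ?K B * ?XY m b c)"
            by (rule sum.swap)
          finally show "(\<Sum>c\<in>enums (?C B).
              ?K B * (\<Sum>m\<in>keys H. lookup H m * ?XY m b c))
            = (\<Sum>m\<in>keys H. \<Sum>c\<in>enums (?C B).
              lookup H m * ?K B * ?XY m b c)" .
        qed
        also have "\<dots> = (\<Sum>m\<in>keys H. \<Sum>b\<in>enums B. \<Sum>c\<in>enums (?C B).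
            lookup H m * ?K B * ?XY m b c)"
          by (rule sum.swap)
        also have "\<dots> = (\<Sum>m\<in>keys H. lookup H m * ?K B * (?X m B *
            ?Y m B))"
          unfolding sum_product unfolding sum_distrib_left by (rule refl)
        finally show "(\<Sum>b\<in>enums B. \<Sum>c\<in>enums (?C B).
            ?K B * (\<Sum>m\<in>keys H. lookup H m * ?XY m b c))
          = (\<Sum>m\<in>keys H. lookup H m * ?K B * (?X m B *
            ?Y m B))"
          .
      qed
      also have "\<dots> = (\<Sum>m\<in>keys H. \<Sum>B | B \<in> subfams A \<and> cards B = \<gamma>1.
          lookup H m * ?K B * (?X m B *
            ?Y m B))"
        by (rule sum.swap)
      also have "\<dots> = hat D A"
      proof -
        define P where "P m B = ?X m B *
          ?Y m B" for m B
        show ?thesis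
          unfolding D_def hat_sum hat_scale star unfolding P_def[symmetric] unfolding sum_distrib_left
          by (intro sum.cong refl) (simp add: c2 twist_def)
      qed
      finally show ?thesis .
    qed
  next
    show "single \<gamma> p \<in> coha_space"
      using p by simp
    show "D \<in> coha_space"
      using D decomposables_subset_plus[of a \<psi>] by (intro plus_in_space) blast
  qed
  then show ?thesis
    using D by metis
qed

section \<open>Cuts and shuffle kernels\<close>

text \<open>The subtraction is the truncated one, so that the diagonal value is \<open>max (a i i - 1) 0\<close>.\<close>

definition edge_mult :: "('i \<Rightarrow> 'i \<Rightarrow> nat) \<Rightarrow> 'i \<Rightarrow> 'i \<Rightarrow> nat" where
  "edge_mult a i j = (if i = j then a i i - 1 else a i j)"

definition points :: "('i \<Rightarrow> nat) \<Rightarrow> ('i \<times> nat) set" where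
  "points \<gamma> = (SIGMA i:UNIV. {..<\<gamma> i})"

lemma finite_points [simp]: "finite (points (\<gamma> :: 'i::finite \<Rightarrow> nat))"
  by (simp add: points_def)

lemma sum_rowwise:
  fixes U :: "'i::finite \<Rightarrow> 'b set"
  assumes "\<And>i. finite (U i)"
  shows "(\<Sum>u\<in>(SIGMA i:UNIV. U i). F u) = (\<Sum>i\<in>UNIV. \<Sum>\<alpha>\<in>U i. F (i, \<alpha>))"
  by (subst sum.Sigma) (auto simp: assms)

lemma prod_rowwise:
  fixes U :: "'i::finite \<Rightarrow> 'b set"
  assumes "\<And>i. finite (U i)"
  shows "(\<Prod>u\<in>(SIGMA i:UNIV. U i). F u) = (\<Prod>i\<in>UNIV. \<Prod>\<alpha>\<in>U i. F (i, \<alpha>))"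
  by (subst prod.Sigma) (auto simp: assms)

lemma permutation_to_initial_segment:
  assumes "T \<subseteq> {..<n :: nat}"
  shows "\<exists>\<rho>. \<rho> permutes {..<n} \<and> \<rho> ` T = {..<card T}"
proof -
  let ?xs = "sorted_list_of_set T @ sorted_list_of_set ({..<n} - T)"
  have T: "finite T"
    using assms finite_subset by blast
  have "mset ?xs = mset [0..<n]"
    using T assms by (subst set_eq_iff_mset_eq_distinct[symmetric]) auto
  then obtain p where p: "p permutes {..<n}" "permute_list p [0..<n] = ?xs"
    using mset_eq_permutation[of ?xs "[0..<n]"] by auto
  have nth: "p \<alpha> = ?xs ! \<alpha>" if "\<alpha> < n" for \<alpha>
  proof -
    have "p \<alpha> < n"
      using permutes_in_image[OF p(1), of \<alpha>] that by simp
    then show ?thesis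
      using that p by (simp add: permute_list_nth flip: p(2))
  qed
  have card: "card T \<le> n"
    using card_mono[OF _ assms] by simp
  have "p ` {..<card T} = (\<lambda>\<alpha>. sorted_list_of_set T ! \<alpha>) ` {..<card T}"
    using card by (intro image_cong) (auto simp: nth nth_append)
  also have "\<dots> = T"
    using bij_betw_nth[of "sorted_list_of_set T" "{..<card T}" T] T by (simp add: bij_betw_def)
  finally have "inv p ` T = {..<card T}"
    using permutes_inverses(2)[OF p(1)] by (metis (no_types, lifting) image_comp image_cong image_ident comp_apply)
  then show ?thesis
    using permutes_inv[OF p(1)] by blast
qed

text \<open>With \<open>a i i - 1\<close> edges between two points of the same row \<open>i\<close>, the product over a cut is the
  numerator of the shuffle kernel over its denominator, except in the rows without loops, where the
  kernel has a pole. There it is the kernel times a polynomial.\<close>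

lemma cut_eq_kernel_times_polynomial:
  fixes \<gamma>1 \<gamma> :: "'i::finite \<Rightarrow> nat"
  assumes e: "e \<in> enums A" and \<gamma>: "cards A = \<gamma>" and le: "\<And>i. \<gamma>1 i \<le> \<gamma> i"
  defines "x \<equiv> pt e"
  shows "(\<Prod>i\<in>UNIV. \<Prod>\<alpha><\<gamma>1 i. \<Prod>j\<in>UNIV. \<Prod>\<beta>\<in>{\<gamma>1 j..<\<gamma> j}. (x (j, \<beta>) - x (i, \<alpha>)) ^ edge_mult a i j) =
    shuffle_kernel a (\<lambda>i. set (take (\<gamma>1 i) (e i))) (\<lambda>i. set (drop (\<gamma>1 i) (e i))) *
    (\<Prod>i\<in>UNIV. \<Prod>\<alpha><\<gamma>1 i. \<Prod>\<beta>\<in>{\<gamma>1 i..<\<gamma> i}. (x (i, \<beta>) - x (i, \<alpha>)) ^ (if a i i = 0 then 1 else 0))"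
proof -
  have len: "length (e i) = \<gamma> i" for i
    using length_enum[OF e] \<gamma> by (auto simp: cards_def)
  have dist: "distinct (e i)" for i
    using e by (simp add: enums_def)
  have x_nth: "x (i, \<alpha>) = e i ! \<alpha>" if "\<alpha> < \<gamma> i" for i \<alpha>
    using that by (simp add: x_def pt_def len)
  have inj: "inj_on (\<lambda>\<alpha>. x (i, \<alpha>)) {..<\<gamma> i}" for i
    using dist len by (auto simp: inj_on_def x_nth nth_eq_iff_index_eq)
  have take: "set (take (\<gamma>1 i) (e i)) = (\<lambda>\<alpha>. x (i, \<alpha>)) ` {..<\<gamma>1 i}" for i
  proof -
    have "set (take (\<gamma>1 i) (e i)) = (\<lambda>\<alpha>. e i ! \<alpha>) ` {..<\<gamma>1 i}"
      using le[of i] by (simp add: nth_image[symmetric] len lessThan_atLeast0)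
    also have "\<dots> = (\<lambda>\<alpha>. x (i, \<alpha>)) ` {..<\<gamma>1 i}"
      using le[of i] by (intro image_cong) (auto simp: x_nth)
    finally show ?thesis .
  qed
  have drop: "set (drop (\<gamma>1 i) (e i)) = (\<lambda>\<alpha>. x (i, \<alpha>)) ` {\<gamma>1 i..<\<gamma> i}" for i
  proof -
    have "set (drop (\<gamma>1 i) (e i)) = (\<lambda>\<alpha>. drop (\<gamma>1 i) (e i) ! \<alpha>) ` {..<length (drop (\<gamma>1 i) (e i))}"
      by (auto simp: set_conv_nth)
    also have "\<dots> = (\<lambda>\<alpha>. e i ! \<alpha>) ` (\<lambda>\<alpha>. \<gamma>1 i + \<alpha>) ` {0..<\<gamma> i - \<gamma>1 i}"
      unfolding image_image using le[of i] by (intro image_cong) (auto simp: len)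
    also have "\<dots> = (\<lambda>\<alpha>. e i ! \<alpha>) ` {\<gamma>1 i..<\<gamma> i}"
      unfolding image_add_atLeastLessThan using le[of i] by simp
    also have "\<dots> = (\<lambda>\<alpha>. x (i, \<alpha>)) ` {\<gamma>1 i..<\<gamma> i}"
      by (intro image_cong) (auto simp: x_nth)
    finally show ?thesis .
  qed
  have prod_take: "(\<Prod>b\<in>set (take (\<gamma>1 i) (e i)). F b) = (\<Prod>\<alpha><\<gamma>1 i. F (x (i, \<alpha>)))" for i and F :: "rat \<Rightarrow> rat"
    unfolding take using inj_on_subset[OF inj[of i], of "{..<\<gamma>1 i}"] le[of i] by (subst prod.reindex) auto
  have prod_drop: "(\<Prod>b\<in>set (drop (\<gamma>1 i) (e i)). F b) = (\<Prod>\<beta>\<in>{\<gamma>1 i..<\<gamma> i}. F (x (i, \<beta>)))" for i and F :: "rat \<Rightarrow> rat"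
    unfolding drop using inj_on_subset[OF inj[of i], of "{\<gamma>1 i..<\<gamma> i}"]
    by (subst prod.reindex) (auto simp: subset_iff)
  define P where "P w i j = (\<Prod>\<alpha><\<gamma>1 i. \<Prod>\<beta>\<in>{\<gamma>1 j..<\<gamma> j}. (x (j, \<beta>) - x (i, \<alpha>)) ^ w)" for w i j
  define z where "z i = (if a i i = 0 then 1 else 0 :: nat)" for i
  have P_mult: "P (edge_mult a i j) i j = P (a i j) i j * (if j = i then P (z i) i i / P 1 i i else 1)" for i j
  proof (cases "j = i")
    case True
    have "d ^ edge_mult a i i = d ^ a i i * d ^ z i / d" if "d \<noteq> 0" for d :: rat
      using that by (cases "a i i") (auto simp: edge_mult_def z_def)
    moreover have "x (i, \<beta>) - x (i, \<alpha>) \<noteq> 0" if "\<alpha> < \<gamma>1 i" "\<beta> \<in> {\<gamma>1 i..<\<gamma> i}" for \<alpha> \<beta>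
      using inj_onD[OF inj[of i], of \<beta> \<alpha>] that le[of i] by auto
    ultimately have "P (edge_mult a i i) i i = (\<Prod>\<alpha><\<gamma>1 i. \<Prod>\<beta>\<in>{\<gamma>1 i..<\<gamma> i}.
        (x (i, \<beta>) - x (i, \<alpha>)) ^ a i i * (x (i, \<beta>) - x (i, \<alpha>)) ^ z i / (x (i, \<beta>) - x (i, \<alpha>)))"
      unfolding P_def by (intro prod.cong refl) auto
    then show ?thesis
      using True by (simp add: P_def prod.distrib prod_dividef)
  next
    case False
    then show ?thesis by (simp add: edge_mult_def)
  qed
  have "(\<Prod>i\<in>UNIV. \<Prod>\<alpha><\<gamma>1 i. \<Prod>j\<in>UNIV. \<Prod>\<beta>\<in>{\<gamma>1 j..<\<gamma> j}. (x (j, \<beta>) - x (i, \<alpha>)) ^ edge_mult a i j) =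
      (\<Prod>i\<in>UNIV. \<Prod>j\<in>UNIV. P (edge_mult a i j) i j)"
    unfolding P_def by (intro prod.cong[OF refl] prod.swap)
  also have "\<dots> = (\<Prod>i\<in>UNIV. (\<Prod>j\<in>UNIV. P (a i j) i j) * (P (z i) i i / P 1 i i))"
    by (simp add: P_mult prod.distrib)
  also have "\<dots> = (\<Prod>i\<in>UNIV. \<Prod>j\<in>UNIV. P (a i j) i j) / (\<Prod>i\<in>UNIV. P 1 i i) * (\<Prod>i\<in>UNIV. P (z i) i i)"
    by (simp add: prod.distrib prod_dividef)
  also have "(\<Prod>i\<in>UNIV. \<Prod>j\<in>UNIV. P (a i j) i j) / (\<Prod>i\<in>UNIV. P 1 i i) =
      shuffle_kernel a (\<lambda>i. set (take (\<gamma>1 i) (e i))) (\<lambda>i. set (drop (\<gamma>1 i) (e i)))"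
    unfolding shuffle_kernel_def prod_take prod_drop P_def by simp
  finally show ?thesis
    by (simp add: P_def z_def)
qed

text \<open>After a permutation of the rows the cut is the one between initial and final segments, whose
  shuffle kernel divides the cut product.\<close>

lemma symmetrized_cut_decomposable:
  fixes a :: "'i::finite \<Rightarrow> 'i \<Rightarrow> nat" and \<gamma> :: "'i \<Rightarrow> nat"
  assumes S: "S \<subseteq> points \<gamma>" "S \<noteq> {}" "S \<noteq> points \<gamma>"
  defines "q \<equiv> \<Prod>u\<in>S. \<Prod>v\<in>points \<gamma> - S. (Var v - Var u) ^ edge_mult a (fst u) (fst v)"
  shows "single \<gamma> (symmetrize \<gamma> (q * h)) \<in> decomposables a \<psi>"
proof -
  define T where "T i = {\<alpha>. (i, \<alpha>) \<in> S}" for i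
  define \<gamma>1 where "\<gamma>1 i = card (T i)" for i
  have T: "T i \<subseteq> {..<\<gamma> i}" for i
    using S(1) by (auto simp: T_def points_def)
  have le: "\<gamma>1 i \<le> \<gamma> i" for i
    using card_mono[OF _ T] by (simp add: \<gamma>1_def)
  have fT: "finite (T i)" for i
    using T finite_subset by blast
  obtain u where u: "u \<in> S" using S(2) by blast
  have "T (fst u) \<noteq> {}"
    using u by (auto simp: T_def intro!: exI[of _ "snd u"])
  then have \<gamma>1: "\<gamma>1 \<noteq> (\<lambda>_. 0)"
    using fT by (auto simp: \<gamma>1_def fun_eq_iff intro!: exI[of _ "fst u"])
  have "\<gamma>1 \<noteq> \<gamma>"
  proof
    assume "\<gamma>1 = \<gamma>"
    then have "T i = {..<\<gamma> i}" for i
      using card_subset_eq[OF _ T[of i]] by (auto simp: \<gamma>1_def fun_eq_iff)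
    then have "S = points \<gamma>"
      by (auto simp: T_def points_def set_eq_iff)
    then show False using S(3) by blast
  qed
  then obtain i where "\<gamma>1 i \<noteq> \<gamma> i"
    by blast
  then have \<gamma>2: "(\<lambda>i. \<gamma> i - \<gamma>1 i) \<noteq> (\<lambda>_. 0)"
    using le[of i] by (auto simp: fun_eq_iff intro!: exI[of _ i])
  obtain \<rho> where \<rho>: "\<And>i. \<rho> i permutes {..<\<gamma> i}" "\<And>i. \<rho> i ` T i = {..<\<gamma>1 i}"
    using permutation_to_initial_segment[OF T] unfolding \<gamma>1_def by metis
  define r where "r = (\<lambda>(i, \<alpha>). (i, \<rho> i \<alpha>))"
  have r_inj: "inj r"
  proof (rule injI)
    fix u v assume "r u = r v"
    then show "u = v"
      using injD[OF permutes_inj[OF \<rho>(1)]] by (cases u; cases v) (auto simp: r_def)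
  qed
  have r_Sigma: "r ` (SIGMA i:UNIV. U i) = (SIGMA i:UNIV. \<rho> i ` U i)" for U
  proof (intro equalityI subsetI)
    fix v assume "v \<in> (SIGMA i:UNIV. \<rho> i ` U i)"
    then obtain i \<alpha> where "\<alpha> \<in> U i" "v = (i, \<rho> i \<alpha>)"
      by auto
    then show "v \<in> r ` (SIGMA i:UNIV. U i)"
      by (intro image_eqI[of _ _ "(i, \<alpha>)"]) (simp_all add: r_def)
  qed (auto simp: r_def)
  have "S = (SIGMA i:UNIV. T i)"
    by (auto simp: T_def)
  then have r_S: "r ` S = (SIGMA i:UNIV. {..<\<gamma>1 i})"
    by (simp only: r_Sigma \<rho>(2))
  have "r ` points \<gamma> = points \<gamma>"
    unfolding points_def by (simp only: r_Sigma permutes_image[OF \<rho>(1)])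
  then have "r ` (points \<gamma> - S) = points \<gamma> - (SIGMA i:UNIV. {..<\<gamma>1 i})"
    by (simp only: image_set_diff[OF r_inj] r_S)
  also have "\<dots> = (SIGMA i:UNIV. {\<gamma>1 i..<\<gamma> i})"
    by (auto simp: points_def)
  finally have r_C: "r ` (points \<gamma> - S) = (SIGMA i:UNIV. {\<gamma>1 i..<\<gamma> i})" .
  define H where "H = (\<Prod>i\<in>UNIV. \<Prod>\<alpha><\<gamma>1 i. \<Prod>\<beta>\<in>{\<gamma>1 i..<\<gamma> i}.
      (Var (i, \<beta>) - Var (i, \<alpha>)) ^ (if a i i = 0 then 1 else 0)) * subst (\<lambda>(i, \<alpha>). Var (i, \<rho> i \<alpha>)) h"
  show ?thesis
  proof (rule symmetrized_kernel_decomposable[OF symmetrize_in_comp _ \<gamma>1 \<gamma>2, where H = H])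
    show "\<gamma> = (\<lambda>i. \<gamma>1 i + (\<gamma> i - \<gamma>1 i))"
      using le by simp
    fix A :: "'i \<Rightarrow> rat set" assume A: "\<And>i. finite (A i)" and c: "cards A = \<gamma>"
    have \<rho>_perm: "\<rho> \<in> row_perms (cards A)"
      using \<rho>(1) c by (simp add: row_perms_def)
    have "eval_set (symmetrize \<gamma> (q * h)) A = (\<Sum>e\<in>enums A. eval_at (pt e) (q * h))"
      using eval_set_symmetrize[of A "q * h"] A c by simp
    also have "\<dots> = (\<Sum>e\<in>enums A. eval_at (\<lambda>(i, \<alpha>). pt e (i, \<rho> i \<alpha>)) (q * h))"
      using sum_enums_permute[of A \<rho> "\<lambda>x. eval_at x (q * h)"] A \<rho>_perm by simp
    also have "\<dots> = (\<Sum>e\<in>enums A. shuffle_kernel a (\<lambda>i. set (take (\<gamma>1 i) (e i)))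
        (\<lambda>i. set (drop (\<gamma>1 i) (e i))) * eval_at (pt e) H)"
    proof (rule sum.cong[OF refl])
      fix e assume e: "e \<in> enums A"
      let ?x = "pt e"
      have y: "(\<lambda>(i, \<alpha>). ?x (i, \<rho> i \<alpha>)) v = ?x (r v)" for v
        by (cases v) (simp add: r_def)
      have fst_r: "fst (r v) = fst v" for v
        by (cases v) (simp add: r_def)
      have "eval_at (\<lambda>(i, \<alpha>). ?x (i, \<rho> i \<alpha>)) q =
          (\<Prod>u\<in>S. \<Prod>v\<in>points \<gamma> - S. (?x (r v) - ?x (r u)) ^ edge_mult a (fst (r u)) (fst (r v)))"
        by (simp add: q_def y fst_r)
      also have "\<dots> = (\<Prod>u\<in>r ` S. \<Prod>v\<in>r ` (points \<gamma> - S). (?x v - ?x u) ^ edge_mult a (fst u) (fst v))"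
        using inj_on_subset[OF r_inj] by (simp add: prod.reindex)
      also have "\<dots> = (\<Prod>i\<in>UNIV. \<Prod>\<alpha><\<gamma>1 i. \<Prod>j\<in>UNIV. \<Prod>\<beta>\<in>{\<gamma>1 j..<\<gamma> j}.
          (?x (j, \<beta>) - ?x (i, \<alpha>)) ^ edge_mult a i j)"
        unfolding r_S r_C by (simp add: prod_rowwise)
      also have "\<dots> = shuffle_kernel a (\<lambda>i. set (take (\<gamma>1 i) (e i))) (\<lambda>i. set (drop (\<gamma>1 i) (e i))) *
          (\<Prod>i\<in>UNIV. \<Prod>\<alpha><\<gamma>1 i. \<Prod>\<beta>\<in>{\<gamma>1 i..<\<gamma> i}. (?x (i, \<beta>) - ?x (i, \<alpha>)) ^ (if a i i = 0 then 1 else 0))"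
        by (rule cut_eq_kernel_times_polynomial[OF e c le])
      finally have "eval_at (\<lambda>(i, \<alpha>). ?x (i, \<rho> i \<alpha>)) q =
          shuffle_kernel a (\<lambda>i. set (take (\<gamma>1 i) (e i))) (\<lambda>i. set (drop (\<gamma>1 i) (e i))) *
          (\<Prod>i\<in>UNIV. \<Prod>\<alpha><\<gamma>1 i. \<Prod>\<beta>\<in>{\<gamma>1 i..<\<gamma> i}. (?x (i, \<beta>) - ?x (i, \<alpha>)) ^ (if a i i = 0 then 1 else 0))" .
      then show "eval_at (\<lambda>(i, \<alpha>). ?x (i, \<rho> i \<alpha>)) (q * h) =
          shuffle_kernel a (\<lambda>i. set (take (\<gamma>1 i) (e i))) (\<lambda>i. set (drop (\<gamma>1 i) (e i))) * eval_at ?x H"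
        by (simp only: eval_at_mult H_def eval_at_subst_rows)
          (simp only: eval_at_prod eval_at_power eval_at_diff eval_at_Var mult.assoc)
    qed
    finally show "eval_set (symmetrize \<gamma> (q * h)) A =
      (\<Sum>e\<in>enums A. shuffle_kernel a (\<lambda>i. set (take (\<gamma>1 i) (e i))) (\<lambda>i. set (drop (\<gamma>1 i) (e i))) *
        eval_at (pt e) H)" .
  qed
qed


section \<open>High degrees are decomposable up to multiples of the sum of the variables\<close>

text \<open>The multiplier \<open>h\<close> makes this an ideal: it is the largest one whose elements symmetrize to
  multiples of the sum of the variables modulo decomposable elements.\<close>

definition reducible_polys ::
  "('i::finite \<Rightarrow> 'i \<Rightarrow> nat) \<Rightarrow> (('i \<Rightarrow> bit) \<Rightarrow> ('i \<Rightarrow> bit) \<Rightarrow> bit) \<Rightarrow> ('i \<Rightarrow> nat) \<Rightarrow>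
     ('i \<times> nat) mpol set" where
  "reducible_polys a \<psi> \<gamma> = {p. \<forall>h. \<exists>g\<in>coha_comp \<gamma>.
     single \<gamma> (symmetrize \<gamma> (p * h)) - mult_sigma (single \<gamma> g) \<in> decomposables a \<psi>}"

lemma is_ideal_reducible_polys: "is_ideal (reducible_polys a \<psi> \<gamma>)"
  unfolding is_ideal_def
proof (intro conjI ballI allI)
  show "0 \<in> reducible_polys a \<psi> \<gamma>"
    using coha.subspace_0[OF subspace_decomposables]
    by (auto simp: reducible_polys_def symmetrize_0 intro!: bexI[of _ 0])
next
  fix p q assume p: "p \<in> reducible_polys a \<psi> \<gamma>" and q: "q \<in> reducible_polys a \<psi> \<gamma>"
  show "p + q \<in> reducible_polys a \<psi> \<gamma>"
    unfolding reducible_polys_def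
  proof (intro CollectI allI)
    fix h
    obtain g where g: "g \<in> coha_comp \<gamma>"
      "single \<gamma> (symmetrize \<gamma> (p * h)) - mult_sigma (single \<gamma> g) \<in> decomposables a \<psi>"
      using p by (auto simp: reducible_polys_def)
    obtain g' where g': "g' \<in> coha_comp \<gamma>"
      "single \<gamma> (symmetrize \<gamma> (q * h)) - mult_sigma (single \<gamma> g') \<in> decomposables a \<psi>"
      using q by (auto simp: reducible_polys_def)
    have "single \<gamma> (symmetrize \<gamma> ((p + q) * h)) - mult_sigma (single \<gamma> (g + g')) =
      (single \<gamma> (symmetrize \<gamma> (p * h)) - mult_sigma (single \<gamma> g)) +
      (single \<gamma> (symmetrize \<gamma> (q * h)) - mult_sigma (single \<gamma> g'))"
      by (simp add: distrib_right symmetrize_add single_add mult_sigma_add)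
    also have "\<dots> \<in> decomposables a \<psi>"
      using g(2) g'(2) by (rule coha.subspace_add[OF subspace_decomposables])
    finally show "\<exists>g\<in>coha_comp \<gamma>. single \<gamma> (symmetrize \<gamma> ((p + q) * h)) -
        mult_sigma (single \<gamma> g) \<in> decomposables a \<psi>"
      using coha_comp_add[OF g(1) g'(1)] by blast
  qed
next
  fix p r assume "p \<in> reducible_polys a \<psi> \<gamma>"
  then have "\<exists>g\<in>coha_comp \<gamma>. single \<gamma> (symmetrize \<gamma> (p * (r * h))) -
      mult_sigma (single \<gamma> g) \<in> decomposables a \<psi>" for h
    unfolding reducible_polys_def by blast
  then show "r * p \<in> reducible_polys a \<psi> \<gamma>"
    by (simp add: reducible_polys_def mult_ac)
qed

lemma sigma_poly_reducible: "sigma_poly \<gamma> \<in> reducible_polys a \<psi> \<gamma>"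
  unfolding reducible_polys_def
proof (intro CollectI allI bexI)
  fix h
  show "single \<gamma> (symmetrize \<gamma> (sigma_poly \<gamma> * h)) -
      mult_sigma (single \<gamma> (symmetrize \<gamma> h)) \<in> decomposables a \<psi>"
    using coha.subspace_0[OF subspace_decomposables]
    by (simp add: symmetrize_mult sigma_poly_in_comp mult_sigma_single)
qed (rule symmetrize_in_comp)

text \<open>The enumeration of the points orients the edges, so that each pair of points is listed once.\<close>

definition point_pairs :: "('i::finite \<Rightarrow> nat) \<Rightarrow> (('i \<times> nat) \<times> ('i \<times> nat)) set" where
  "point_pairs \<gamma> = {(u, v) \<in> points \<gamma> \<times> points \<gamma>. to_nat u < to_nat v}"

definition point_graph :: "('i::finite \<Rightarrow> 'i \<Rightarrow> nat) \<Rightarrow> ('i \<Rightarrow> nat) \<Rightarrow> (('i \<times> nat) \<times> ('i \<times> nat)) multiset" where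
  "point_graph a \<gamma> = (\<Sum>p\<in>point_pairs \<gamma>. replicate_mset (edge_mult a (fst (fst p)) (fst (snd p))) p)"

lemma finite_point_pairs [simp]: "finite (point_pairs \<gamma>)"
  unfolding point_pairs_def by (rule finite_subset[of _ "points \<gamma> \<times> points \<gamma>"]) auto

lemma size_sum_mset_family: "size (\<Sum>p\<in>P. M p :: 'c multiset) = (\<Sum>p\<in>P. size (M p))"
  by (induction P rule: infinite_finite_induct) auto

lemma set_sum_mset_family: "finite P \<Longrightarrow> set_mset (\<Sum>p\<in>P. M p) = (\<Union>p\<in>P. set_mset (M p))"
  by (induction P rule: finite_induct) auto

lemma set_point_graph: "set_mset (point_graph a \<gamma>) \<subseteq> points \<gamma> \<times> points \<gamma>"
  unfolding point_graph_def set_sum_mset_family[OF finite_point_pairs]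
  by (auto simp: point_pairs_def split: if_splits)

lemma prod_mset_sum_family: "(\<Prod>x\<in>#(\<Sum>p\<in>P. M p). F x) = (\<Prod>p\<in>P. \<Prod>x\<in>#M p. F x)"
  by (induction P rule: infinite_finite_induct) auto

text \<open>Twice the number of edges is the bracket in the definition of the bound.\<close>

lemma size_point_graph:
  assumes "symmetric_quiver a"
  shows "2 * int (size (point_graph a \<gamma>)) =
    int (\<Sum>(i, j)\<in>{(i, j). i \<noteq> j}. a i j * \<gamma> i * \<gamma> j) +
    (\<Sum>i\<in>UNIV. max (int (a i i) - 1) 0 * (int (\<gamma> i) * (int (\<gamma> i) - 1)))"
proof -
  let ?w = "\<lambda>(u, v). int (edge_mult a (fst u) (fst v))"
  let ?X = "points \<gamma>" and ?P = "point_pairs \<gamma>" and ?D = "(\<lambda>u. (u, u)) ` points \<gamma>"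
  have sym: "?w (prod.swap p) = ?w p" for p
    using assms by (cases p) (auto simp: symmetric_quiver_def edge_mult_def)
  have split: "?X \<times> ?X = (?P \<union> prod.swap ` ?P) \<union> ?D"
  proof (intro equalityI subsetI)
    fix p assume "p \<in> ?X \<times> ?X"
    then obtain u v where p: "p = (u, v)" "u \<in> ?X" "v \<in> ?X" by auto
    consider "to_nat u < to_nat v" | "to_nat v < to_nat u" | "u = v"
      using to_nat_split[of u] by (metis linorder_neqE_nat to_nat_split)
    then show "p \<in> (?P \<union> prod.swap ` ?P) \<union> ?D"
    proof cases
      case 2
      then have "(v, u) \<in> ?P"
        using p by (simp add: point_pairs_def)
      then have "prod.swap (v, u) \<in> prod.swap ` ?P"
        by (rule imageI)
      then show ?thesis
        using p by simp
    qed (use p in \<open>auto simp: point_pairs_def\<close>)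
  qed (auto simp: point_pairs_def)
  have "(\<Sum>p\<in>?X \<times> ?X. ?w p) = (\<Sum>p\<in>?P \<union> prod.swap ` ?P. ?w p) + (\<Sum>p\<in>?D. ?w p)"
    unfolding split by (rule sum.union_disjoint) (simp, simp, auto simp: point_pairs_def)
  also have "(\<Sum>p\<in>?P \<union> prod.swap ` ?P. ?w p) = (\<Sum>p\<in>?P. ?w p) + (\<Sum>p\<in>prod.swap ` ?P. ?w p)"
    by (rule sum.union_disjoint) (simp, simp, auto simp: point_pairs_def)
  also have "(\<Sum>p\<in>prod.swap ` ?P. ?w p) = (\<Sum>p\<in>?P. ?w p)"
    by (subst sum.reindex) (simp_all only: inj_swap comp_def sym)
  also have "(\<Sum>p\<in>?D. ?w p) = (\<Sum>u\<in>?X. int (edge_mult a (fst u) (fst u)))"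
    by (subst sum.reindex) (auto simp: inj_on_def)
  also have "\<dots> = (\<Sum>i\<in>UNIV. int (edge_mult a i i) * int (\<gamma> i))"
    by (simp add: points_def sum_rowwise mult.commute)
  also have "(\<Sum>p\<in>?P. ?w p) = int (size (point_graph a \<gamma>))"
    by (simp add: point_graph_def size_sum_mset_family case_prod_beta)
  finally have "(\<Sum>p\<in>?X \<times> ?X. ?w p) = 2 * int (size (point_graph a \<gamma>)) +
      (\<Sum>i\<in>UNIV. int (edge_mult a i i) * int (\<gamma> i))"
    by simp
  moreover have "(\<Sum>p\<in>?X \<times> ?X. ?w p) = (\<Sum>i\<in>UNIV. \<Sum>j\<in>UNIV. int (edge_mult a i j) * int (\<gamma> i) * int (\<gamma> j))"
  proof -
    have "(\<Sum>p\<in>?X \<times> ?X. ?w p) = (\<Sum>u\<in>?X. \<Sum>v\<in>?X. int (edge_mult a (fst u) (fst v)))"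
      by (simp add: sum.cartesian_product case_prod_beta)
    also have "\<dots> = (\<Sum>i\<in>UNIV. \<Sum>\<alpha><\<gamma> i. \<Sum>j\<in>UNIV. \<Sum>\<beta><\<gamma> j. int (edge_mult a i j))"
      by (simp add: points_def sum_rowwise)
    finally show ?thesis
      by (simp add: sum_distrib_left mult_ac)
  qed
  moreover have "(\<Sum>i\<in>UNIV. \<Sum>j\<in>UNIV. int (edge_mult a i j) * int (\<gamma> i) * int (\<gamma> j)) =
      int (\<Sum>(i, j)\<in>{(i, j). i \<noteq> j}. a i j * \<gamma> i * \<gamma> j) + (\<Sum>i\<in>UNIV. int (edge_mult a i i) * int (\<gamma> i) * int (\<gamma> i))"
  proof -
    have "(\<Sum>i\<in>UNIV. \<Sum>j\<in>UNIV. int (edge_mult a i j) * int (\<gamma> i) * int (\<gamma> j)) =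
      (\<Sum>(i, j)\<in>UNIV. int (edge_mult a i j) * int (\<gamma> i) * int (\<gamma> j))"
      by (simp add: sum.cartesian_product)
    also have "\<dots> = (\<Sum>(i, j)\<in>{(i, j). i \<noteq> j} \<union> (\<lambda>i. (i, i)) ` UNIV. int (edge_mult a i j) * int (\<gamma> i) * int (\<gamma> j))"
      by (rule sum.cong) auto
    also have "\<dots> = (\<Sum>(i, j)\<in>{(i, j). i \<noteq> j}. int (edge_mult a i j) * int (\<gamma> i) * int (\<gamma> j)) +
        (\<Sum>(i, j)\<in>(\<lambda>i. (i, i)) ` UNIV. int (edge_mult a i j) * int (\<gamma> i) * int (\<gamma> j))"
      by (rule sum.union_disjoint) auto
    also have "(\<Sum>(i, j)\<in>{(i, j). i \<noteq> j}. int (edge_mult a i j) * int (\<gamma> i) * int (\<gamma> j)) =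
        int (\<Sum>(i, j)\<in>{(i, j). i \<noteq> j}. a i j * \<gamma> i * \<gamma> j)"
      unfolding of_nat_sum by (rule sum.cong) (auto simp: edge_mult_def)
    finally show ?thesis
      by (subst (asm) sum.reindex) (auto simp: inj_on_def)
  qed
  moreover have "max (int (a i i) - 1) 0 = int (edge_mult a i i)" for i
    by (auto simp: edge_mult_def)
  ultimately show ?thesis
    by (simp add: right_diff_distrib sum_subtractf mult.assoc)
qed

text \<open>The cut product of the graph differs from the one with all edges directed out of \<open>S\<close> by a sign.\<close>

lemma cut_product_point_graph_reducible:
  fixes \<gamma> :: "'i::finite \<Rightarrow> nat"
  assumes a: "symmetric_quiver a" and S: "S \<subseteq> points \<gamma>" "S \<noteq> {}" "S \<noteq> points \<gamma>"
  shows "cut_product (point_graph a \<gamma>) S \<in> reducible_polys a \<psi> \<gamma>"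
proof -
  define q where "q = (\<Prod>u\<in>S. \<Prod>v\<in>points \<gamma> - S. (Var v - Var u :: ('i \<times> nat) mpol) ^ edge_mult a (fst u) (fst v))"
  have q: "q \<in> reducible_polys a \<psi> \<gamma>"
    using symmetrized_cut_decomposable[OF S, where a = a and \<psi> = \<psi>]
    by (auto simp: reducible_polys_def q_def intro!: bexI[of _ 0])
  let ?T = "S \<times> (points \<gamma> - S)"
  define d where "d = (\<lambda>(u, v). (Var v - Var u :: ('i \<times> nat) mpol) ^ edge_mult a (fst u) (fst v))"
  define D where "D = (\<lambda>(u, v). (if (u \<in> S) \<noteq> (v \<in> S) then Var u - Var v :: ('i \<times> nat) mpol else 1)
    ^ edge_mult a (fst u) (fst v))"
  define ori where "ori = (\<lambda>(u :: 'i \<times> nat, v). if to_nat u < to_nat v then (u, v) else (v, u))"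
  have fS: "finite S"
    using S(1) by (rule finite_subset) simp
  have "q = (\<Prod>t\<in>?T. d t)"
    by (simp add: q_def d_def prod.cartesian_product)
  also have "\<dots> dvd (\<Prod>t\<in>?T. D (ori t))"
  proof (rule prod_dvd_prod)
    fix t assume "t \<in> ?T"
    then obtain u v where t: "t = (u, v)" "u \<in> S" "v \<notin> S" by auto
    have "edge_mult a (fst v) (fst u) = edge_mult a (fst u) (fst v)"
      using a by (auto simp: edge_mult_def symmetric_quiver_def)
    moreover have "(Var v - Var u :: ('i \<times> nat) mpol) dvd Var u - Var v"
      by (metis dvd_minus_iff dvd_refl minus_diff_eq)
    ultimately show "d t dvd D (ori t)"
      using t by (auto simp: d_def D_def ori_def dvd_power_same)
  qed
  also have "(\<Prod>t\<in>?T. D (ori t)) = (\<Prod>p\<in>ori ` ?T. D p)"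
    by (subst prod.reindex) (auto simp: ori_def inj_on_def split: if_splits)
  also have "\<dots> dvd (\<Prod>p\<in>point_pairs \<gamma>. D p)"
  proof (rule prod_dvd_prod_subset)
    show "ori ` ?T \<subseteq> point_pairs \<gamma>"
    proof (rule image_subsetI)
      fix t assume "t \<in> ?T"
      then obtain u v where t: "t = (u, v)" "u \<in> S" "v \<in> points \<gamma>" "v \<notin> S" by auto
      then have "u \<noteq> v" "u \<in> points \<gamma>" using S(1) by auto
      then have "to_nat u < to_nat v \<or> to_nat v < to_nat u"
        using linorder_neqE_nat[of "to_nat u" "to_nat v"] by auto
      then show "ori t \<in> point_pairs \<gamma>"
        using t \<open>u \<in> points \<gamma>\<close> by (auto simp: ori_def point_pairs_def)
    qed
  qed simp
  also have "(\<Prod>p\<in>point_pairs \<gamma>. D p) = cut_product (point_graph a \<gamma>) S"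
    unfolding cut_product_def point_graph_def prod_mset_sum_family
    by (rule prod.cong) (auto simp: D_def)
  finally show ?thesis
    by (rule is_idealD(5)[OF is_ideal_reducible_polys q])
qed

text \<open>The ideal of reducible polynomials contains the sum of the variables and all cut products, hence all
  monomials of such a degree. As symmetrizing \<open>f\<close> multiplies it by the number of permutations, the
  constant multiplier \<open>h\<close> is the inverse of that number.\<close>

lemma high_degree_reducible:
  fixes \<gamma> :: "'i::finite \<Rightarrow> nat"
  assumes a: "symmetric_quiver a" and \<gamma>: "\<gamma> \<noteq> (\<lambda>_. 0)" and f: "f \<in> coha_comp \<gamma>"
    and deg: "\<And>m. m \<in> keys f \<Longrightarrow> N_bound a \<gamma> \<le> of_nat (mon_degree m)"
  shows "\<exists>g\<in>coha_comp \<gamma>. single \<gamma> f - mult_sigma (single \<gamma> g) \<in> decomposables a \<psi>"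
proof -
  let ?J = "reducible_polys a \<psi> \<gamma>" and ?E = "point_graph a \<gamma>"
  have card: "card (points \<gamma>) = (\<Sum>i\<in>UNIV. \<gamma> i)"
    by (simp add: points_def)
  have "2 * (rat_of_int (int (size ?E))) = of_int (int (\<Sum>(i, j)\<in>{(i, j). i \<noteq> j}. a i j * \<gamma> i * \<gamma> j) +
    (\<Sum>i\<in>UNIV. max (int (a i i) - 1) 0 * (int (\<gamma> i) * (int (\<gamma> i) - 1))))"
    unfolding size_point_graph[OF a, symmetric] by simp
  then have N: "N_bound a \<gamma> = of_nat (size ?E) - of_nat (card (points \<gamma>)) + 2"
    unfolding N_bound_def card by simp
  have "single m 1 \<in> ?J" if m: "m \<in> keys f" for m
  proof (rule monomials_in_cut_ideal[where X = "points \<gamma>" and E = ?E])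
    have "(\<Sum>v\<in>points \<gamma>. Var v) = sigma_poly \<gamma>"
      by (simp add: points_def sigma_poly_def sum_rowwise)
    then show "(\<Sum>v\<in>points \<gamma>. Var v) \<in> ?J"
      by (simp add: sigma_poly_reducible)
    show "keys m \<subseteq> points \<gamma>"
      using f m by (auto simp: coha_comp_def points_def)
    obtain i where "\<gamma> i \<noteq> 0"
      using \<gamma> by auto
    then have "(i, 0) \<in> points \<gamma>"
      by (simp add: points_def)
    then show "points \<gamma> \<noteq> {}"
      by blast
    have "rat_of_int (int (size ?E) - int (card (points \<gamma>)) + 2) \<le> rat_of_int (int (mon_degree m))"
      using deg[OF m] by (simp add: N)
    then show "int (size ?E) - int (card (points \<gamma>)) + 2 \<le> int (mon_degree m)"
      by (simp only: of_int_le_iff)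
  qed (use cut_product_point_graph_reducible[OF a] set_point_graph in \<open>simp_all add: is_ideal_reducible_polys\<close>)
  then have "Const (lookup f m) * single m 1 \<in> ?J" if "m \<in> keys f" for m
    using is_idealD(3)[OF is_ideal_reducible_polys] that by blast
  then have "(\<Sum>m\<in>keys f. Const (lookup f m) * single m 1) \<in> ?J"
    by (intro ideal_sum[OF is_ideal_reducible_polys])
  then have fJ: "f \<in> ?J"
    by (subst poly_mapping_as_sum) (simp add: Const_def mult_single)
  \<comment> \<open>By the choice of multiplier the symmetrization returns \<open>f\<close>.\<close>
  define c where "c = 1 / rat_of_nat (card (row_perms \<gamma>))"
  have "row_perms \<gamma> \<noteq> {}"
    using permutes_id by (auto simp: row_perms_def intro!: exI[of _ "\<lambda>_. id"])
  then have card_nz: "card (row_perms \<gamma>) \<noteq> 0"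
    by (simp add: finite_row_perms)
  have "symmetrize \<gamma> (f * Const c) = f"
  proof (rule single_eqI[OF symmetrize_in_comp f])
    fix A :: "'i \<Rightarrow> rat set" assume A: "\<And>i. finite (A i)" and cA: "cards A = \<gamma>"
    have "card (enums A) = card (row_perms \<gamma>)"
      using bij_betw_same_card[OF bij_betw_row_perms_enums[OF sorted_point(1)[of A]]] A cA by simp
    then have enums: "of_nat (card (enums A)) * c = 1"
      using card_nz by (simp add: c_def)
    have "eval_set (symmetrize \<gamma> (f * Const c)) A = (\<Sum>e\<in>enums A. eval_at (pt e) (f * Const c))"
      using eval_set_symmetrize[of A "f * Const c"] A cA by simp
    also have "\<dots> = (\<Sum>e\<in>enums A. eval_set f A * c)"
      using eval_at_enum[of f A] A cA f by (intro sum.cong) auto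
    also have "\<dots> = eval_set f A * (of_nat (card (enums A)) * c)"
      by simp
    finally show "eval_set (symmetrize \<gamma> (f * Const c)) A = eval_set f A"
      by (simp only: enums mult_1_right)
  qed
  moreover obtain g where "g \<in> coha_comp \<gamma>"
    "single \<gamma> (symmetrize \<gamma> (f * Const c)) - mult_sigma (single \<gamma> g) \<in> decomposables a \<psi>"
    using fJ unfolding reducible_polys_def by blast
  ultimately show ?thesis
    by auto
qed

section \<open>The bigrading of the decomposable elements\<close>

definition bideg_part :: "('i::finite \<Rightarrow> 'i \<Rightarrow> nat) \<Rightarrow> ('i \<Rightarrow> nat) \<Rightarrow> int \<Rightarrow> ('i \<times> nat) mpol \<Rightarrow> ('i \<times> nat) mpol" where
  "bideg_part a \<gamma> k f =
     (\<Sum>m | m \<in> keys f \<and> 2 * int (mon_degree m) + chi a \<gamma> \<gamma> = k. single m (lookup f m))"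

definition bideg_proj :: "('i::finite \<Rightarrow> 'i \<Rightarrow> nat) \<Rightarrow> ('i \<Rightarrow> nat) \<Rightarrow> int \<Rightarrow> 'i coha \<Rightarrow> 'i coha" where
  "bideg_proj a \<gamma> k h = single \<gamma> (bideg_part a \<gamma> k (lookup h \<gamma>))"

lemma lookup_bideg_part:
  "lookup (bideg_part a \<gamma> k f) m = (if 2 * int (mon_degree m) + chi a \<gamma> \<gamma> = k then lookup f m else 0)"
  unfolding bideg_part_def lookup_sum
  by (auto simp: lookup_single when_def in_keys_iff sum.delta)

lemma lookup_Const_mult: "lookup (Const c * f) m = c * lookup f m"
proof -
  have "Const c * f = Poly_Mapping.map ((*) c) f"
    by (simp add: Const_def mult_map_scale_conv_mult)
  then show ?thesis
    by (simp add: Poly_Mapping.map.rep_eq when_def)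
qed

lemma module_hom_bideg_proj: "module_hom coha_scale coha_scale (bideg_proj a \<gamma> k)"
proof (unfold_locales)
  fix x y and c :: rat
  show "bideg_proj a \<gamma> k (x + y) = bideg_proj a \<gamma> k x + bideg_proj a \<gamma> k y"
    by (intro poly_mapping_eqI)
      (auto simp: bideg_proj_def lookup_single when_def lookup_bideg_part lookup_add)
  show "bideg_proj a \<gamma> k (coha_scale c x) = coha_scale c (bideg_proj a \<gamma> k x)"
    by (intro poly_mapping_eqI)
      (auto simp: bideg_proj_def lookup_single when_def lookup_bideg_part lookup_coha_scale lookup_Const_mult)
qed

lemmas bideg_proj_add = module_hom.add[OF module_hom_bideg_proj]
  and bideg_proj_diff = module_hom.diff[OF module_hom_bideg_proj]
  and bideg_proj_scale = module_hom.scale[OF module_hom_bideg_proj]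
  and bideg_proj_sum = module_hom.sum[OF module_hom_bideg_proj]
  and bideg_proj_0 = module_hom.zero[OF module_hom_bideg_proj]

lemma bideg_proj_homogeneous:
  assumes "h \<in> coha_bideg a \<gamma>' k'"
  shows "bideg_proj a \<gamma> k h = (if \<gamma> = \<gamma>' \<and> k = k' then h else 0)"
proof -
  obtain f where h: "h = single \<gamma>' f"
    and deg: "\<And>m. m \<in> keys f \<Longrightarrow> 2 * int (mon_degree m) + chi a \<gamma>' \<gamma>' = k'"
    using assms by (auto simp: coha_bideg_def)
  show ?thesis
    by (intro poly_mapping_eqI)
      (use deg in \<open>auto simp: h bideg_proj_def lookup_single when_def lookup_bideg_part in_keys_iff\<close>)
qed

lemma monom_at_scale: "monom_at (\<lambda>v. t * x v) m = t ^ mon_degree m * monom_at x m"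
  by (simp add: monom_at_def mon_degree_def power_mult_distrib prod.distrib power_sum)

lemma row_inj_scale: "t \<noteq> 0 \<Longrightarrow> row_inj \<gamma> x \<Longrightarrow> row_inj \<gamma> (\<lambda>v. t * x v)"
  by (simp add: row_inj_def inj_on_def)

lemma rows_scale: "rows \<gamma> (\<lambda>v. t * x v) = (\<lambda>i. (*) t ` rows \<gamma> x i)"
  by (simp add: rows_def image_image)

text \<open>The homogeneous parts of \<open>f\<close> at the point \<open>x\<close> are the coefficients of the polynomial
  \<open>t \<mapsto> f (t x)\<close>, so they are symmetric whenever \<open>f\<close> is.\<close>

lemma bideg_part_in_comp:
  assumes f: "f \<in> coha_comp (\<gamma> :: 'i::finite \<Rightarrow> nat)"
  shows "bideg_part a \<gamma> k f \<in> coha_comp \<gamma>"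
proof (cases "\<exists>d. 2 * int d + chi a \<gamma> \<gamma> = k")
  case False
  then have "bideg_part a \<gamma> k f = 0"
    by (intro poly_mapping_eqI) (auto simp: lookup_bideg_part)
  then show ?thesis by simp
next
  case True
  then obtain d where d: "2 * int d + chi a \<gamma> \<gamma> = k" by blast
  define Q where "Q x = (\<Sum>m\<in>keys f. monom (lookup f m * monom_at x m) (mon_degree m))" for x
  have poly_Q: "poly (Q x) t = eval_at (\<lambda>v. t * x v) f" for x t
    by (simp add: Q_def poly_sum poly_monom eval_at_def monom_at_scale mult_ac)
  have coeff_Q: "coeff (Q x) d = eval_at x (bideg_part a \<gamma> k f)" for x
  proof -
    have "coeff (Q x) d = (\<Sum>m\<in>keys f. if mon_degree m = d then lookup f m * monom_at x m else 0)"
      unfolding Q_def coeff_sum by (rule sum.cong) auto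
    also have "\<dots> = (\<Sum>m\<in>keys f. if 2 * int (mon_degree m) + chi a \<gamma> \<gamma> = k then lookup f m * monom_at x m else 0)"
      using d by (intro sum.cong) auto
    also have "\<dots> = eval_at x (bideg_part a \<gamma> k f)"
      by (simp add: bideg_part_def sum.If_cases Int_def)
    finally show ?thesis .
  qed
  have Q_eq: "Q x = Q y" if "row_inj \<gamma> x" "row_inj \<gamma> y" "rows \<gamma> x = rows \<gamma> y" for x y
  proof -
    have "poly (Q x) t = poly (Q y) t" if "t \<noteq> 0" for t
      using \<open>row_inj \<gamma> x\<close> \<open>row_inj \<gamma> y\<close> \<open>rows \<gamma> x = rows \<gamma> y\<close> that
      by (simp add: poly_Q eval_at_row_inj[OF f] row_inj_scale rows_scale)
    \<comment> \<open>At \<open>t = 0\<close> the coordinates collide, so the comparison is made after multiplication by \<open>t\<close>.\<close>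
    then have "poly ([:0, 1:] * (Q x - Q y)) = poly 0"
      by (intro ext) auto
    then have "[:0, 1:] * (Q x - Q y) = 0"
      by (simp only: poly_eq_poly_eq_iff)
    then show ?thesis by simp
  qed
  show ?thesis
  proof (rule coha_compI)
    fix x assume x: "row_inj \<gamma> x"
    let ?y = "pt (\<lambda>i. sorted_list_of_set (rows \<gamma> x i))"
    have "row_inj \<gamma> ?y" "rows \<gamma> ?y = rows \<gamma> x"
      using sorted_point(2,3)[of "rows \<gamma> x"] by (simp_all add: cards_rows[OF x])
    then have "Q x = Q ?y"
      using x by (intro Q_eq) auto
    then show "eval_at x (bideg_part a \<gamma> k f) = eval_set (bideg_part a \<gamma> k f) (rows \<gamma> x)"
      unfolding coeff_Q[symmetric] eval_set_def by simp
  qed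
qed

lemma bideg_proj_in_bideg: "h \<in> coha_space \<Longrightarrow> bideg_proj a \<gamma> k h \<in> coha_bideg a \<gamma> k"
  unfolding coha_bideg_def bideg_proj_def
  by (intro CollectI exI[of _ "bideg_part a \<gamma> k (lookup h \<gamma>)"])
    (auto simp: coha_space_def bideg_part_in_comp in_keys_iff lookup_bideg_part split: if_splits)

lemma bideg_subset_space: "coha_bideg a \<gamma> k \<subseteq> (coha_space :: 'i::finite coha set)"
  by (auto simp: coha_bideg_def)

lemma bideg_proj_in_plus:
  assumes "h \<in> coha_plus"
  shows "bideg_proj a \<gamma> k h \<in> coha_plus"
proof -
  have "bideg_proj a \<gamma> k h \<in> coha_space"
    using bideg_proj_in_bideg[of h a \<gamma> k] bideg_subset_space[of a \<gamma> k] assms by (auto simp: coha_plus_def)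
  moreover have "lookup (bideg_proj a \<gamma> k h) (\<lambda>_. 0) = 0"
    using assms
    by (intro poly_mapping_eqI) (auto simp: bideg_proj_def lookup_single when_def lookup_bideg_part coha_plus_def)
  ultimately show ?thesis by (simp add: coha_plus_def)
qed

lemma sum_bideg_proj:
  fixes a :: "'a::finite \<Rightarrow> 'a \<Rightarrow> nat"
  obtains P where "finite P" "h = (\<Sum>p\<in>P. bideg_proj a (fst p) (snd p) h)"
proof -
  define P where "P = (SIGMA \<gamma>:keys h. (\<lambda>m. 2 * int (mon_degree m) + chi a \<gamma> \<gamma>) ` keys (lookup h \<gamma>))"
  have fin: "finite P"
    by (simp add: P_def)
  have "h = (\<Sum>p\<in>P. bideg_proj a (fst p) (snd p) h)"
  proof (intro poly_mapping_eqI)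
    fix \<gamma> :: "'a \<Rightarrow> nat" and m :: "('a \<times> nat) \<Rightarrow>\<^sub>0 nat"
    let ?p = "(\<gamma>, 2 * int (mon_degree m) + chi a \<gamma> \<gamma>)"
    have "lookup (lookup (\<Sum>p\<in>P. bideg_proj a (fst p) (snd p) h) \<gamma>) m =
        (\<Sum>p\<in>P. if p = ?p then lookup (lookup h \<gamma>) m else 0)"
      unfolding lookup_sum
      by (rule sum.cong) (auto simp: bideg_proj_def lookup_single when_def lookup_bideg_part)
    also have "\<dots> = (if ?p \<in> P then lookup (lookup h \<gamma>) m else 0)"
      using fin by simp
    also have "\<dots> = lookup (lookup h \<gamma>) m"
    proof (cases "lookup (lookup h \<gamma>) m = 0")
      case False
      then have "m \<in> keys (lookup h \<gamma>)" "\<gamma> \<in> keys h"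
        by (auto simp: in_keys_iff)
      then have "?p \<in> P"
        by (auto simp: P_def)
      then show ?thesis by simp
    qed simp
    finally show "lookup (lookup h \<gamma>) m = lookup (lookup (\<Sum>p\<in>P. bideg_proj a (fst p) (snd p) h) \<gamma>) m"
      by simp
  qed
  then show ?thesis
    using fin that by blast
qed

lemma zero_in_bideg: "0 \<in> coha_bideg a (\<gamma> :: 'i::finite \<Rightarrow> nat) k"
  unfolding coha_bideg_def by (intro CollectI exI[of _ 0]) simp

lemma subspace_bideg: "coha.subspace (coha_bideg a \<gamma> k)"
proof (rule coha.subspaceI)
  fix x y assume "x \<in> coha_bideg a \<gamma> k" "y \<in> coha_bideg a \<gamma> k"
  then obtain f g where f: "x = single \<gamma> f" "f \<in> coha_comp \<gamma>"
      "\<And>m. m \<in> keys f \<Longrightarrow> 2 * int (mon_degree m) + chi a \<gamma> \<gamma> = k"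
    and g: "y = single \<gamma> g" "g \<in> coha_comp \<gamma>"
      "\<And>m. m \<in> keys g \<Longrightarrow> 2 * int (mon_degree m) + chi a \<gamma> \<gamma> = k"
    by (auto simp: coha_bideg_def)
  have "2 * int (mon_degree m) + chi a \<gamma> \<gamma> = k" if "m \<in> keys (f + g)" for m
    using that Poly_Mapping.keys_add[of f g] f(3) g(3) by blast
  then show "x + y \<in> coha_bideg a \<gamma> k"
    unfolding coha_bideg_def f(1) g(1) single_add[symmetric] using coha_comp_add[OF f(2) g(2)] by blast
next
  fix c x assume "x \<in> coha_bideg a \<gamma> k"
  then obtain f where f: "x = single \<gamma> f" "f \<in> coha_comp \<gamma>"
      "\<And>m. m \<in> keys f \<Longrightarrow> 2 * int (mon_degree m) + chi a \<gamma> \<gamma> = k"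
    by (auto simp: coha_bideg_def)
  have "coha_scale c x = single \<gamma> (Const c * f)"
    by (rule poly_mapping_eqI) (simp add: f lookup_coha_scale lookup_single when_def)
  moreover have "2 * int (mon_degree m) + chi a \<gamma> \<gamma> = k" if "m \<in> keys (Const c * f)" for m
    using that f(3) by (simp add: in_keys_iff lookup_Const_mult)
  ultimately show "coha_scale c x \<in> coha_bideg a \<gamma> k"
    unfolding coha_bideg_def using coha_comp_Const_mult[OF f(2), of c] by blast
qed (rule zero_in_bideg)

lemma eval_set_scale:
  assumes f: "f \<in> coha_comp (cards A)" and deg: "\<And>m. m \<in> keys f \<Longrightarrow> mon_degree m = d"
    and A: "\<And>i. finite (A i)"
  shows "eval_set f (\<lambda>i. (*) 2 ` A i) = 2 ^ d * eval_set f (A :: 'i::finite \<Rightarrow> rat set)"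
proof -
  let ?x = "pt (\<lambda>i. sorted_list_of_set (A i))"
  have x: "row_inj (cards A) ?x" "rows (cards A) ?x = A"
    using A by (auto intro: sorted_point)
  have "eval_at (\<lambda>v. 2 * ?x v) f = eval_set f (\<lambda>i. (*) 2 ` A i)"
    by (simp add: eval_at_row_inj[OF f] row_inj_scale x rows_scale)
  moreover have "eval_at (\<lambda>v. 2 * ?x v) f = 2 ^ d * eval_at ?x f"
    unfolding eval_at_def sum_distrib_left by (rule sum.cong) (auto simp: monom_at_scale deg)
  ultimately show ?thesis
    by (simp add: eval_set_def)
qed

lemma prod_scale:
  fixes C :: "rat set" and F :: "rat \<Rightarrow> rat"
  shows "(\<Prod>c\<in>(*) 2 ` C. F c) = (\<Prod>c\<in>C. F (2 * c))"
  by (subst prod.reindex) (auto simp: inj_on_def)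

text \<open>The degree of the kernel as a rational function is \<open>- \<chi>(\<gamma>\<^sub>1, \<gamma>\<^sub>2)\<close>, possibly negative.\<close>

lemma shuffle_kernel_scale:
  "shuffle_kernel a (\<lambda>i. (*) 2 ` B i) (\<lambda>i. (*) 2 ` C i) =
    2 powi (- chi a (cards B) (cards C)) * shuffle_kernel a B C"
proof -
  have d: "2 * c - 2 * b = 2 * (c - b)" for b c :: rat
    by simp
  have pid: "(2 :: rat) powi (int m - int n) = 2 ^ m / 2 ^ n" for m n
    by (simp add: power_int_diff)
  have num: "(\<Prod>i\<in>UNIV. \<Prod>j\<in>UNIV. \<Prod>b\<in>B i. \<Prod>c\<in>C j. (2 * c - 2 * b) ^ a i j) =
      2 ^ (\<Sum>i\<in>UNIV. \<Sum>j\<in>UNIV. a i j * cards C j * cards B i) *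
      (\<Prod>i\<in>UNIV. \<Prod>j\<in>UNIV. \<Prod>b\<in>B i. \<Prod>c\<in>C j. (c - b) ^ a i j)"
    unfolding d power_mult_distrib prod.distrib by (simp add: cards_def power_sum power_mult)
  have den: "(\<Prod>i\<in>UNIV. \<Prod>b\<in>B i. \<Prod>c\<in>C i. 2 * c - 2 * b) =
      2 ^ (\<Sum>i\<in>UNIV. cards C i * cards B i) * (\<Prod>i\<in>UNIV. \<Prod>b\<in>B i. \<Prod>c\<in>C i. c - b)"
    unfolding d prod.distrib by (simp add: cards_def power_sum power_mult)
  have "- chi a (cards B) (cards C) = int (\<Sum>i\<in>UNIV. \<Sum>j\<in>UNIV. a i j * cards C j * cards B i) -
      int (\<Sum>i\<in>UNIV. cards C i * cards B i)"
    by (simp add: euler_form_def mult_ac)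
  then have "(2 :: rat) powi (- chi a (cards B) (cards C)) =
      2 ^ (\<Sum>i\<in>UNIV. \<Sum>j\<in>UNIV. a i j * cards C j * cards B i) / 2 ^ (\<Sum>i\<in>UNIV. cards C i * cards B i)"
    by (simp only: pid)
  then show ?thesis
    unfolding shuffle_kernel_def prod_scale num den by simp
qed

text \<open>The single scaling factor \<open>2\<close> detects the degree, since its powers are distinct.\<close>

lemma homogeneous_if_eval_scale:
  fixes h :: "'v::countable mpol"
  assumes "\<And>x. inj x \<Longrightarrow> eval_at (\<lambda>v. 2 * x v) h = 2 powi E * eval_at x h" and m: "m \<in> keys h"
  shows "int (mon_degree m) = E"
proof -
  define h' where "h' = (\<Sum>m\<in>keys h. single m (lookup h m * 2 ^ mon_degree m))"
  have "h' = Const (2 powi E) * h"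
  proof (rule mpol_eqI)
    fix x :: "'v \<Rightarrow> rat" assume "inj x"
    have "eval_at x h' = eval_at (\<lambda>v. 2 * x v) h"
      unfolding eval_at_def[of "\<lambda>v. 2 * x v"] monom_at_scale by (simp add: h'_def mult_ac)
    then show "eval_at x h' = eval_at x (Const (2 powi E) * h)"
      using assms(1)[OF \<open>inj x\<close>] by simp
  qed
  then have "lookup h' m = 2 powi E * lookup h m"
    by (simp add: lookup_Const_mult)
  moreover have "lookup h' m = lookup h m * 2 ^ mon_degree m"
    using m by (simp add: h'_def lookup_sum lookup_single when_def)
  ultimately have "(2 :: rat) powi int (mon_degree m) = 2 powi E"
    using m by (simp add: in_keys_iff power_int_of_nat)
  then show ?thesis
  proof (rule contrapos_pp)
    assume "int (mon_degree m) \<noteq> E"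
    then consider "int (mon_degree m) < E" | "E < int (mon_degree m)"
      by linarith
    then have "(2 :: rat) powi int (mon_degree m) < 2 powi E \<or> (2 :: rat) powi E < 2 powi int (mon_degree m)"
    proof cases
      case 1
      then show ?thesis
        by (intro disjI1 power_int_strict_increasing) simp_all
    next
      case 2
      then show ?thesis
        by (intro disjI2 power_int_strict_increasing) simp_all
    qed
    then show "(2 :: rat) powi int (mon_degree m) \<noteq> 2 powi E"
      by linarith
  qed
qed

lemma euler_form_add_left:
  "euler_form a (\<lambda>i. g i + g' i) h = euler_form a g h + euler_form a g' h"
  by (simp add: euler_form_def distrib_left distrib_right sum.distrib)

lemma euler_form_sym:
  assumes "symmetric_quiver a"
  shows "euler_form a g h = euler_form a h g"
proof -
  have "(\<Sum>i\<in>UNIV. \<Sum>j\<in>UNIV. int (a i j) * g i * h j) = (\<Sum>i\<in>UNIV. \<Sum>j\<in>UNIV. int (a j i) * g j * h i)"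
    by (rule sum.swap)
  also have "\<dots> = (\<Sum>i\<in>UNIV. \<Sum>j\<in>UNIV. int (a i j) * h i * g j)"
    using assms by (intro sum.cong refl) (simp add: symmetric_quiver_def mult_ac)
  finally show ?thesis
    by (simp add: euler_form_def mult.commute)
qed

lemma chi_add:
  assumes "symmetric_quiver a"
  shows "chi a (\<lambda>i. \<gamma>1 i + \<gamma>2 i) (\<lambda>i. \<gamma>1 i + \<gamma>2 i) =
    chi a \<gamma>1 \<gamma>1 + chi a \<gamma>2 \<gamma>2 + 2 * chi a \<gamma>1 \<gamma>2"
proof -
  have add_right: "euler_form a g (\<lambda>i. h i + h' i) = euler_form a g h + euler_form a g h'" for g h h'
    using euler_form_add_left[of a h h' g] euler_form_sym[OF assms] by metis
  show ?thesis
    using euler_form_sym[OF assms, of "\<lambda>i. int (\<gamma>2 i)" "\<lambda>i. int (\<gamma>1 i)"]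
    by (simp add: euler_form_add_left add_right)
qed

lemma coha_star_bideg:
  assumes a: "symmetric_quiver a"
    and x: "x \<in> coha_bideg a \<gamma>1 k1" and y: "y \<in> coha_bideg a \<gamma>2 k2"
  shows "coha_star a \<psi> x y \<in> coha_bideg a (\<lambda>i. \<gamma>1 i + \<gamma>2 i) (k1 + k2)"
proof -
  obtain f1 where f1: "x = single \<gamma>1 f1" "f1 \<in> coha_comp \<gamma>1"
    and deg1: "\<And>m. m \<in> keys f1 \<Longrightarrow> 2 * int (mon_degree m) + chi a \<gamma>1 \<gamma>1 = k1"
    using x by (auto simp: coha_bideg_def)
  obtain f2 where f2: "y = single \<gamma>2 f2" "f2 \<in> coha_comp \<gamma>2"
    and deg2: "\<And>m. m \<in> keys f2 \<Longrightarrow> 2 * int (mon_degree m) + chi a \<gamma>2 \<gamma>2 = k2"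
    using y by (auto simp: coha_bideg_def)
  show ?thesis
  proof (cases "f1 = 0 \<or> f2 = 0")
    case True
    then have "coha_star a \<psi> x y = 0"
      by (auto simp: f1 f2)
    then show ?thesis
      by (simp add: zero_in_bideg)
  next
    case False
    then obtain m1 m2 where m: "m1 \<in> keys f1" "m2 \<in> keys f2"
      by (metis all_not_in_conv keys_eq_empty)
    define d1 d2 where "d1 = mon_degree m1" and "d2 = mon_degree m2"
    have d1: "mon_degree m = d1" if "m \<in> keys f1" for m
      using deg1[OF that] deg1[OF m(1)] by (simp add: d1_def)
    have d2: "mon_degree m = d2" if "m \<in> keys f2" for m
      using deg2[OF that] deg2[OF m(2)] by (simp add: d2_def)
    let ?\<gamma> = "\<lambda>i. \<gamma>1 i + \<gamma>2 i"
    let ?h = "coha_mult a \<gamma>1 \<gamma>2 f1 f2"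
    define E where "E = int d1 + int d2 - chi a \<gamma>1 \<gamma>2"
    have "eval_at (\<lambda>v. 2 * x v) ?h = 2 powi E * eval_at x ?h" if "inj x" for x
    proof -
      let ?A = "rows ?\<gamma> x" and ?s = "\<lambda>(B :: 'a \<Rightarrow> rat set) i. (*) 2 ` B i"
      have x: "row_inj ?\<gamma> x"
        using that by (rule row_inj_if_inj)
      have inj2: "inj_on ((*) (2 :: rat)) X" for X
        by (auto simp: inj_on_def)
      have "bij_betw ?s {B. B \<in> subfams ?A \<and> cards B = \<gamma>1} {B. B \<in> subfams (?s ?A) \<and> cards B = \<gamma>1}"
      proof (rule bij_betw_byWitness[where f' = "\<lambda>B i. (*) (1 / 2) ` B i"])
        show "?s ` {B. B \<in> subfams ?A \<and> cards B = \<gamma>1} \<subseteq> {B. B \<in> subfams (?s ?A) \<and> cards B = \<gamma>1}"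
          by (auto simp: subfams_def cards_def card_image[OF inj2])
        show "(\<lambda>B i. (*) (1 / 2) ` B i) ` {B. B \<in> subfams (?s ?A) \<and> cards B = \<gamma>1} \<subseteq> {B. B \<in> subfams ?A \<and> cards B = \<gamma>1}"
        proof (rule image_subsetI, intro CollectI conjI)
          fix B assume "B \<in> {B. B \<in> subfams (?s ?A) \<and> cards B = \<gamma>1}"
          then have B: "B \<in> subfams (?s ?A)" "cards B = \<gamma>1"
            by auto
          have "(*) (1 / 2) ` B i \<subseteq> (*) (1 / 2) ` ?s ?A i" for i
            using B(1) by (intro image_mono) (simp add: subfams_def)
          then show "(\<lambda>i. (*) (1 / 2) ` B i) \<in> subfams ?A"
            by (simp add: subfams_def image_image)
          show "cards (\<lambda>i. (*) (1 / 2) ` B i) = \<gamma>1"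
            unfolding B(2)[symmetric] by (simp add: cards_def card_image inj_on_def)
        qed
      qed (simp_all add: image_image)
      note bij = this
      have "eval_at (\<lambda>v. 2 * x v) ?h = shuffle_sum a \<gamma>1 f1 f2 (?s ?A)"
        using coha_mult_eval[OF f1(2) f2(2) row_inj_scale[OF _ x]] by (simp add: rows_scale)
      also have "\<dots> = (\<Sum>B | B \<in> subfams ?A \<and> cards B = \<gamma>1. eval_set f1 (?s B) *
          eval_set f2 (diff_fam (?s ?A) (?s B)) * shuffle_kernel a (?s B) (diff_fam (?s ?A) (?s B)))"
        unfolding shuffle_sum_def by (rule sum.reindex_bij_betw[OF bij, symmetric])
      also have "\<dots> = (\<Sum>B | B \<in> subfams ?A \<and> cards B = \<gamma>1. 2 powi E * (eval_set f1 B *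
          eval_set f2 (diff_fam ?A B) * shuffle_kernel a B (diff_fam ?A B)))"
      proof (rule sum.cong[OF refl])
        fix B assume "B \<in> {B. B \<in> subfams ?A \<and> cards B = \<gamma>1}"
        then have B: "B \<in> subfams ?A" "cards B = \<gamma>1" by auto
        let ?C = "diff_fam ?A B"
        have C: "diff_fam (?s ?A) (?s B) = ?s ?C"
          by (intro ext image_set_diff[symmetric]) (simp add: inj_on_def)
        have "B i \<subseteq> ?A i" for i
          using B(1) by (auto simp: subfams_def)
        then have fB: "finite (B i)" for i
          by (rule finite_subset) (rule finite_rows)
        have cC: "cards ?C = \<gamma>2"
        proof
          fix i
          have "\<gamma>1 i + \<gamma>2 i = cards B i + cards ?C i"
            using fun_cong[OF cards_split[OF B(1)], of i] fun_cong[OF cards_rows[OF x], of i] by simp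
          then show "cards ?C i = \<gamma>2 i"
            using fun_cong[OF B(2), of i] by linarith
        qed
        have "eval_set f1 (?s B) = 2 ^ d1 * eval_set f1 B"
          by (rule eval_set_scale) (use f1(2) B(2) d1 fB in auto)
        moreover have "eval_set f2 (?s ?C) = 2 ^ d2 * eval_set f2 ?C"
          by (rule eval_set_scale) (use f2(2) cC d2 in auto)
        moreover have "shuffle_kernel a (?s B) (?s ?C) = 2 powi (- chi a \<gamma>1 \<gamma>2) * shuffle_kernel a B ?C"
          using shuffle_kernel_scale[of a B ?C] by (simp only: B(2) cC)
        moreover have "(2 :: rat) powi E = 2 ^ d1 * 2 ^ d2 * 2 powi (- chi a \<gamma>1 \<gamma>2)"
        proof -
          have E: "E = int (d1 + d2) + (- chi a \<gamma>1 \<gamma>2)"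
            by (simp add: E_def)
          have "(2 :: rat) powi E = 2 powi int (d1 + d2) * 2 powi (- chi a \<gamma>1 \<gamma>2)"
            unfolding E by (rule power_int_add) simp
          then show ?thesis
            by (simp only: power_int_of_nat power_add)
        qed
        ultimately show "eval_set f1 (?s B) * eval_set f2 (diff_fam (?s ?A) (?s B)) *
            shuffle_kernel a (?s B) (diff_fam (?s ?A) (?s B)) =
            2 powi E * (eval_set f1 B * eval_set f2 ?C * shuffle_kernel a B ?C)"
          unfolding C by simp
      qed
      also have "\<dots> = 2 powi E * shuffle_sum a \<gamma>1 f1 f2 ?A"
        by (simp add: shuffle_sum_def sum_distrib_left)
      also have "\<dots> = 2 powi E * eval_at x ?h"
        using coha_mult_eval[OF f1(2) f2(2) x] by simp
      finally show ?thesis .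
    qed
    then have E: "int (mon_degree m) = E" if "m \<in> keys ?h" for m
      using that by (rule homogeneous_if_eval_scale)
    have deg: "2 * int (mon_degree m) + chi a ?\<gamma> ?\<gamma> = k1 + k2" if "m \<in> keys ?h" for m
      using E[OF that] deg1[OF m(1)] deg2[OF m(2)] chi_add[OF a, of \<gamma>1 \<gamma>2]
      unfolding E_def d1_def d2_def by linarith
    define g where "g = (if \<psi> (mod2 \<gamma>1) (mod2 \<gamma>2) = 0 then 1 else - 1) * ?h"
    have "coha_star a \<psi> x y = single ?\<gamma> g"
      using False by (simp add: coha_star_def f1 f2 g_def)
    moreover have "coha_star a \<psi> x y \<in> coha_space"
      using x y bideg_subset_space by (blast intro: coha_star_in_space)
    moreover have "keys g = keys ?h"
      by (auto simp: g_def in_keys_iff)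
    ultimately show ?thesis
      using deg by (auto simp: coha_bideg_def)
  qed
qed

lemma bideg_proj_decomposables:
  assumes a: "symmetric_quiver a" and h: "h \<in> decomposables a \<psi>"
  shows "bideg_proj a \<gamma> k h \<in> decomposables a \<psi>"
  using h unfolding decomposables_def
proof (induction rule: coha.span_induct)
  case base
  show ?case
    by (rule coha.subspaceI)
      (auto simp: bideg_proj_0 bideg_proj_add bideg_proj_scale coha.span_zero intro: coha.span_add coha.span_scale)
next
  case (step h)
  then obtain x y where h: "h = coha_star a \<psi> x y" and x: "x \<in> coha_plus" and y: "y \<in> coha_plus"
    by auto
  obtain P where P: "finite P" "x = (\<Sum>p\<in>P. bideg_proj a (fst p) (snd p) x)"
    by (rule sum_bideg_proj)
  obtain R where R: "finite R" "y = (\<Sum>r\<in>R. bideg_proj a (fst r) (snd r) y)"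
    by (rule sum_bideg_proj)
  let ?x = "\<lambda>p. bideg_proj a (fst p) (snd p) x" and ?y = "\<lambda>r. bideg_proj a (fst r) (snd r) y"
  have xs: "?x p \<in> coha_plus" and ys: "?y p \<in> coha_plus" for p
    using x y by (auto intro: bideg_proj_in_plus)
  have "h = coha_star a \<psi> (\<Sum>p\<in>P. ?x p) (\<Sum>r\<in>R. ?y r)"
    by (simp only: h P(2)[symmetric] R(2)[symmetric])
  also have "\<dots> = (\<Sum>p\<in>P. coha_star a \<psi> (?x p) (\<Sum>r\<in>R. ?y r))"
    by (rule coha_star_sum_left) (auto intro: xs ys plus_in_space space_sum)
  also have "\<dots> = (\<Sum>p\<in>P. \<Sum>r\<in>R. coha_star a \<psi> (?x p) (?y r))"
    by (intro sum.cong refl coha_star_sum_right) (auto intro: xs ys plus_in_space)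
  finally have "bideg_proj a \<gamma> k h = (\<Sum>p\<in>P. \<Sum>r\<in>R. bideg_proj a \<gamma> k (coha_star a \<psi> (?x p) (?y r)))"
    by (simp add: bideg_proj_sum)
  also have "\<dots> \<in> decomposables a \<psi>"
  proof (intro coha.subspace_sum[OF subspace_decomposables])
    fix p r
    have "coha_star a \<psi> (?x p) (?y r) \<in> coha_bideg a (\<lambda>i. fst p i + fst r i) (snd p + snd r)"
      using x y by (intro coha_star_bideg[OF a] bideg_proj_in_bideg plus_in_space)
    then show "bideg_proj a \<gamma> k (coha_star a \<psi> (?x p) (?y r)) \<in> decomposables a \<psi>"
      using coha_star_in_decomposables[OF xs ys, of a \<psi> p r] coha.subspace_0[OF subspace_decomposables]
      by (auto simp: bideg_proj_homogeneous)
  qed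
  finally show ?case
    by (simp add: decomposables_def)
qed

lemma mult_sigma_bideg:
  assumes "h \<in> coha_bideg a \<gamma> k"
  shows "mult_sigma h \<in> coha_bideg a \<gamma> (k + 2)"
proof -
  obtain f where f: "h = single \<gamma> f" "f \<in> coha_comp \<gamma>"
    and deg: "\<And>m. m \<in> keys f \<Longrightarrow> 2 * int (mon_degree m) + chi a \<gamma> \<gamma> = k"
    using assms by (auto simp: coha_bideg_def)
  have sigma: "mon_degree m = 1" if m: "m \<in> keys (sigma_poly \<gamma>)" for m
  proof -
    have "\<exists>i \<alpha>. lookup (Var (i, \<alpha>) :: ('a \<times> nat) mpol) m \<noteq> 0"
    proof (rule ccontr)
      assume "\<not> ?thesis"
      then have "lookup (sigma_poly \<gamma>) m = 0"
        by (simp add: sigma_poly_def lookup_sum)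
      then show False using m by (simp add: in_keys_iff)
    qed
    then show ?thesis
      by (auto simp: Var_def lookup_single when_def split: if_splits)
  qed
  have "2 * int (mon_degree m) + chi a \<gamma> \<gamma> = k + 2" if m: "m \<in> keys (sigma_poly \<gamma> * f)" for m
  proof -
    obtain m1 m2 where "m = m1 + m2" "m1 \<in> keys (sigma_poly \<gamma>)" "m2 \<in> keys f"
      using Poly_Mapping.keys_mult[of "sigma_poly \<gamma>" f] m by blast
    then show ?thesis
      using sigma[of m1] deg[of m2] by (simp add: mon_degree_add)
  qed
  then show ?thesis
    using f sigma_poly_mult_in_comp[OF f(2)] by (auto simp: coha_bideg_def mult_sigma_single)
qed


section \<open>Generators in high degree\<close>

text \<open>The symmetric polynomial in front of the sum of the variables, provided by \<open>high_degree_reducible\<close>,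
  need not be homogeneous or a generator. It is replaced by the generator to which it is congruent,
  and then by the component of that generator in the right bidegree; this is legitimate because
  the decomposable elements are bigraded.\<close>

lemma generator_from_lower_degree:
  fixes a :: "'i::finite \<Rightarrow> 'i \<Rightarrow> nat"
  assumes a: "symmetric_quiver a" and \<psi>: "bilinear_form2 \<psi>"
    and V: "bigraded_subspace a V" and free: "free_supercomm_generated a \<psi> V"
    and \<gamma>: "\<gamma> \<noteq> (\<lambda>_. 0)" and k: "rat_of_int (chi a \<gamma> \<gamma>) + 2 * N_bound a \<gamma> \<le> rat_of_int k"
    and v: "v \<in> V \<inter> coha_bideg a \<gamma> k"
  shows "\<exists>v'\<in>V \<inter> coha_bideg a \<gamma> (k - 2). v - mult_sigma v' \<in> decomposables a \<psi>"
proof -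
  obtain f where f: "v = single \<gamma> f" "f \<in> coha_comp \<gamma>"
    and deg: "\<And>m. m \<in> keys f \<Longrightarrow> 2 * int (mon_degree m) + chi a \<gamma> \<gamma> = k"
    using v by (auto simp: coha_bideg_def)
  have "N_bound a \<gamma> \<le> of_nat (mon_degree m)" if "m \<in> keys f" for m
  proof -
    have "rat_of_int k = rat_of_int (2 * int (mon_degree m) + chi a \<gamma> \<gamma>)"
      by (simp only: deg[OF that])
    then show ?thesis
      using k by simp
  qed
  then obtain g where g: "g \<in> coha_comp \<gamma>"
    "v - mult_sigma (single \<gamma> g) \<in> decomposables a \<psi>"
    using high_degree_reducible[OF a \<gamma> f(2)] unfolding f(1) by blast
  have "single \<gamma> g \<in> coha_plus"
    using g(1) \<gamma> by (simp add: coha_plus_def lookup_single when_def)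
  then obtain u where u: "u \<in> V" "single \<gamma> g - u \<in> decomposables a \<psi>"
    using plus_eq_V_plus_decomposables[OF \<psi> V free] by blast
  have "v - mult_sigma u = (v - mult_sigma (single \<gamma> g)) + mult_sigma (single \<gamma> g - u)"
    by (simp add: mult_sigma_diff)
  also have "\<dots> \<in> decomposables a \<psi>"
    using g(2) mult_sigma_decomposables[OF u(2)] by (rule coha.subspace_add[OF subspace_decomposables])
  finally have vu: "v - mult_sigma u \<in> decomposables a \<psi>" .
  have "is_direct_sum V (\<lambda>(\<gamma>, k). V \<inter> coha_bideg a \<gamma> k)"
    using V by (simp add: bigraded_subspace_def)
  then obtain c where c: "\<And>p. c p \<in> (\<lambda>(\<gamma>, k). V \<inter> coha_bideg a \<gamma> k) p" "u = (\<Sum>p | c p \<noteq> 0. c p)"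
    and fin: "finite {p. c p \<noteq> 0}"
    using u(1) unfolding is_direct_sum_def by blast
  have c_bideg: "c p \<in> V \<inter> coha_bideg a (fst p) (snd p)" for p
    using c(1)[of p] by (simp add: case_prod_beta)
  have "bideg_proj a \<gamma> k (mult_sigma u) = (\<Sum>p | c p \<noteq> 0. bideg_proj a \<gamma> k (mult_sigma (c p)))"
    by (simp add: c(2) mult_sigma_sum bideg_proj_sum)
  also have "\<dots> = (\<Sum>p | c p \<noteq> 0. if p = (\<gamma>, k - 2) then mult_sigma (c p) else 0)"
  proof (rule sum.cong[OF refl])
    fix p
    have "mult_sigma (c p) \<in> coha_bideg a (fst p) (snd p + 2)"
      using c_bideg[of p] by (intro mult_sigma_bideg) blast
    then show "bideg_proj a \<gamma> k (mult_sigma (c p)) = (if p = (\<gamma>, k - 2) then mult_sigma (c p) else 0)"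
      by (cases p) (auto simp: bideg_proj_homogeneous)
  qed
  also have "\<dots> = mult_sigma (c (\<gamma>, k - 2))"
    using fin by (auto simp: sum.delta)
  finally have "bideg_proj a \<gamma> k (v - mult_sigma u) = v - mult_sigma (c (\<gamma>, k - 2))"
    using v bideg_proj_homogeneous[of v a \<gamma> k \<gamma> k] by (simp add: bideg_proj_diff)
  then have "v - mult_sigma (c (\<gamma>, k - 2)) \<in> decomposables a \<psi>"
    using bideg_proj_decomposables[OF a vu, of \<gamma> k] by simp
  then show ?thesis
    using c_bideg[of "(\<gamma>, k - 2)"] by auto
qed

section \<open>The dimension count\<close>

context
  fixes a :: "'i::finite \<Rightarrow> 'i \<Rightarrow> nat" and V :: "'i coha set"
    and scale :: "rat \<Rightarrow> 'w::ab_group_add \<Rightarrow> 'w" and W :: "('i \<Rightarrow> nat) \<Rightarrow> int \<Rightarrow> 'w set"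
    and \<phi> :: "'w poly \<Rightarrow> 'i coha"
  assumes W: "bigraded_space scale W" and iso: "bigraded_iso_tensor_x a scale W V \<phi>"
begin

interpretation W: vector_space scale
  using W by (simp add: bigraded_space_def)

lemma W_subspace: "W.subspace (W \<gamma> k)"
  using W by (simp add: bigraded_space_def)

lemma iso_add: "\<phi> (p + q) = \<phi> p + \<phi> q"
  and iso_scale: "\<phi> (map_poly (scale c) p) = coha_scale c (\<phi> p)"
  and iso_image: "\<phi> ` tensor_x_bideg W \<gamma> k = V \<inter> coha_bideg a \<gamma> k"
  using iso by (auto simp: bigraded_iso_tensor_x_def)

lemma iso_inj: "\<phi> p = \<phi> q \<longleftrightarrow> p = q"
  using iso by (auto simp: bigraded_iso_tensor_x_def bij_betw_def inj_eq)

lemma iso_0: "\<phi> 0 = 0"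
  using iso_add[of 0 0] by simp

lemma iso_sum: "\<phi> (\<Sum>i\<in>I. p i) = (\<Sum>i\<in>I. \<phi> (p i))"
  by (induction I rule: infinite_finite_induct) (auto simp: iso_0 iso_add)

lemma constant_in_tensor: "w \<in> W \<gamma> k \<Longrightarrow> [:w:] \<in> tensor_x_bideg W \<gamma> k"
  using W.subspace_0[OF W_subspace] by (auto simp: tensor_x_bideg_def coeff_pCons split: nat.split)

lemma times_x_in_tensor:
  assumes "p \<in> tensor_x_bideg W \<gamma> (k - 2)"
  shows "pCons 0 p \<in> tensor_x_bideg W \<gamma> k"
  unfolding tensor_x_bideg_def
proof (intro CollectI allI)
  fix n
  show "coeff (pCons 0 p) n \<in> W \<gamma> (k - 2 * int n)"
  proof (cases n)
    case 0
    then show ?thesis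
      using W.subspace_0[OF W_subspace] by simp
  next
    case (Suc n')
    have "coeff p n' \<in> W \<gamma> (k - 2 - 2 * int n')"
      using assms by (simp add: tensor_x_bideg_def)
    moreover have "k - 2 - 2 * int n' = k - 2 * int n"
      using Suc by simp
    ultimately show ?thesis
      using Suc by (simp only: coeff_pCons_Suc)
  qed
qed

lemma bideg_finitely_spanned:
  assumes fin: "finite {l. W \<gamma> l \<noteq> {0}}" and fin_dim: "\<And>l. fin_dim scale (W \<gamma> l)"
  obtains T where "finite T" "V \<inter> coha_bideg a \<gamma> k \<subseteq> coha.span T"
proof -
  obtain B where B: "\<And>l. finite (B l)" "\<And>l. W.span (B l) = W \<gamma> l"
    using fin_dim unfolding fin_dim_def by metis
  define N where "N = {n. W \<gamma> (k - 2 * int n) \<noteq> {0}}"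
  have "inj_on (\<lambda>n. k - 2 * int n) N"
    by (auto simp: inj_on_def)
  moreover have "finite ((\<lambda>n. k - 2 * int n) ` N)"
    by (rule finite_subset[OF _ fin]) (auto simp: N_def)
  ultimately have finN: "finite N"
    by (rule finite_imageD[rotated])
  define T where "T = (\<Union>n\<in>N. (\<lambda>b. \<phi> (monom b n)) ` B (k - 2 * int n))"
  have monoms: "\<phi> (monom w n) \<in> coha.span T" if w: "w \<in> W \<gamma> (k - 2 * int n)" for w n
  proof (cases "n \<in> N")
    case False
    then have "w = 0"
      using w by (auto simp: N_def)
    then show ?thesis
      by (simp add: iso_0 coha.span_zero)
  next
    case True
    have "w \<in> W.span (B (k - 2 * int n))"
      using w B(2) by simp
    then show ?thesis
    proof (induction rule: W.span_induct)
      case base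
      have scale_monom: "monom (scale c x) n = map_poly (scale c) (monom x n)" for c x
        by (simp add: map_poly_monom)
      show ?case
        by (rule W.subspaceI)
          (auto simp: iso_0 coha.span_zero iso_add scale_monom iso_scale
            intro: coha.span_add coha.span_scale simp flip: add_monom)
    next
      case (step x)
      then show ?case
        using True by (intro coha.span_base) (auto simp: T_def)
    qed
  qed
  have "V \<inter> coha_bideg a \<gamma> k \<subseteq> coha.span T"
  proof
    fix v assume "v \<in> V \<inter> coha_bideg a \<gamma> k"
    then obtain p where p: "v = \<phi> p" "p \<in> tensor_x_bideg W \<gamma> k"
      using iso_image[of \<gamma> k] by blast
    have "v = (\<Sum>n\<le>degree p. \<phi> (monom (coeff p n) n))"
      unfolding p(1) iso_sum[symmetric] by (simp add: poly_as_sum_of_monoms)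
    also have "\<dots> \<in> coha.span T"
      using p(2) by (intro coha.span_sum monoms) (simp add: tensor_x_bideg_def)
    finally show "v \<in> coha.span T" .
  qed
  moreover have "finite T"
    using finN B(1) by (simp add: T_def)
  ultimately show ?thesis
    using that by blast
qed

text \<open>Sending \<open>v\<close> to \<open>v'\<close> on a basis extends to a linear injection of \<open>V\<^sub>k\<close> into \<open>V\<^sub>k\<^sub>-\<^sub>2\<close>, because \<open>v'\<close> determines
  \<open>v\<close> modulo \<open>D\<close>. Followed by multiplication with \<open>x\<close> it is an injective endomorphism of the finite-dimensional
  space \<open>V\<^sub>k\<close>. A non-zero constant polynomial \<open>[:w:]\<close> would provide a vector outside of its image, and so
  one independent vector too many.\<close>

lemma no_new_generators:
  assumes fin: "finite {l. W \<gamma> l \<noteq> {0}}" "\<And>l. fin_dim scale (W \<gamma> l)"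
    and D: "coha.subspace D" and V_D: "V \<inter> D = {0}" and V: "coha.subspace V"
    and s: "module_hom coha_scale coha_scale s"
    and lower: "\<And>v. v \<in> V \<inter> coha_bideg a \<gamma> k \<Longrightarrow> \<exists>v'\<in>V \<inter> coha_bideg a \<gamma> (k - 2). v - s v' \<in> D"
  shows "W \<gamma> k = {0}"
proof (rule ccontr)
  let ?V = "\<lambda>k. V \<inter> coha_bideg a \<gamma> k"
  assume "W \<gamma> k \<noteq> {0}"
  then obtain w where w: "w \<in> W \<gamma> k" "w \<noteq> 0"
    using W.subspace_0[OF W_subspace] by blast
  have V_sub: "coha.subspace (?V l)" for l
    by (rule coha.subspace_inter[OF V subspace_bideg])
  interpret pair: vector_space_pair coha_scale coha_scale
    by unfold_locales
  obtain C where C: "C \<subseteq> ?V k" "coha.independent C" "?V k \<subseteq> coha.span C"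
    using coha.maximal_independent_subset[of "?V k"] by blast
  have span_C: "coha.span C = ?V k"
    using C coha.span_minimal[OF C(1) V_sub] by blast
  obtain T where T: "finite T" "?V k \<subseteq> coha.span T"
    using bideg_finitely_spanned[OF fin] by blast
  have fin_C: "finite C"
    using coha.independent_span_bound[OF T(1) C(2)] C(1) T(2) by blast
  have "\<forall>v\<in>C. \<exists>p. p \<in> tensor_x_bideg W \<gamma> (k - 2) \<and> v - s (\<phi> p) \<in> D"
  proof
    fix v assume "v \<in> C"
    then obtain v' where "v' \<in> ?V (k - 2)" "v - s v' \<in> D"
      using lower[of v] C(1) by blast
    then show "\<exists>p. p \<in> tensor_x_bideg W \<gamma> (k - 2) \<and> v - s (\<phi> p) \<in> D"
      using iso_image[of \<gamma> "k - 2"] by (metis imageE)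
  qed
  then obtain P where P: "\<And>v. v \<in> C \<Longrightarrow> P v \<in> tensor_x_bideg W \<gamma> (k - 2)" "\<And>v. v \<in> C \<Longrightarrow> v - s (\<phi> (P v)) \<in> D"
    by metis
  obtain g where g: "Vector_Spaces.linear coha_scale coha_scale g" "\<And>v. v \<in> C \<Longrightarrow> g v = \<phi> (pCons 0 (P v))"
    using pair.linear_independent_extend[OF C(2), of "\<lambda>v. \<phi> (pCons 0 (P v))"] by blast
  interpret g: Vector_Spaces.linear coha_scale coha_scale g
    by fact
  interpret s: module_hom coha_scale coha_scale s
    by fact
  let ?G = "{v. \<exists>p. p \<in> tensor_x_bideg W \<gamma> (k - 2) \<and> g v = \<phi> (pCons 0 p) \<and> v - s (\<phi> p) \<in> D}"
  have g_span: "\<exists>p. p \<in> tensor_x_bideg W \<gamma> (k - 2) \<and> g v = \<phi> (pCons 0 p) \<and> v - s (\<phi> p) \<in> D"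
    if "v \<in> coha.span C" for v
    using that
  proof (induction rule: coha.span_induct)
    case base
    show ?case
    proof (rule coha.subspaceI)
      show "0 \<in> ?G"
        using W.subspace_0[OF W_subspace] coha.subspace_0[OF D]
        by (auto simp: tensor_x_bideg_def iso_0 s.zero g.zero intro!: exI[of _ 0])
    next
      fix x y
      assume "x \<in> ?G"
        "y \<in> ?G"
      then obtain p q where p: "p \<in> tensor_x_bideg W \<gamma> (k - 2)" "g x = \<phi> (pCons 0 p)" "x - s (\<phi> p) \<in> D"
        and q: "q \<in> tensor_x_bideg W \<gamma> (k - 2)" "g y = \<phi> (pCons 0 q)" "y - s (\<phi> q) \<in> D"
        by blast
      have "p + q \<in> tensor_x_bideg W \<gamma> (k - 2)"
        using p(1) q(1) W.subspace_add[OF W_subspace] by (simp add: tensor_x_bideg_def)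
      moreover have "g (x + y) = \<phi> (pCons 0 (p + q))"
        using iso_add[of "pCons 0 p" "pCons 0 q"] by (simp add: g.add p(2) q(2))
      moreover have "x + y - s (\<phi> (p + q)) = (x - s (\<phi> p)) + (y - s (\<phi> q))"
        by (simp add: iso_add s.add)
      then have "x + y - s (\<phi> (p + q)) \<in> D"
        using coha.subspace_add[OF D p(3) q(3)] by (simp only:)
      ultimately show "x + y \<in> ?G"
        by blast
    next
      fix c x
      assume "x \<in> ?G"
      then obtain p where p: "p \<in> tensor_x_bideg W \<gamma> (k - 2)" "g x = \<phi> (pCons 0 p)" "x - s (\<phi> p) \<in> D"
        by blast
      let ?q = "map_poly (scale c) p"
      have "?q \<in> tensor_x_bideg W \<gamma> (k - 2)"
        using p(1) W.subspace_scale[OF W_subspace] by (simp add: tensor_x_bideg_def coeff_map_poly)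
      moreover have "pCons 0 ?q = map_poly (scale c) (pCons 0 p)"
        by (rule poly_eqI) (simp add: coeff_map_poly coeff_pCons split: nat.split)
      then have "g (coha_scale c x) = \<phi> (pCons 0 ?q)"
        by (simp add: g.scale p(2) iso_scale)
      moreover have "coha_scale c x - s (\<phi> ?q) = coha_scale c (x - s (\<phi> p))"
        by (simp add: iso_scale s.scale coha.scale_right_diff_distrib)
      then have "coha_scale c x - s (\<phi> ?q) \<in> D"
        using coha.subspace_scale[OF D p(3)] by (simp only:)
      ultimately show "coha_scale c x \<in> ?G"
        by blast
    qed
  qed (use P g(2) in blast)
  have "inj_on g (coha.span C)"
    unfolding g.inj_on_iff_eq_0[OF coha.subspace_span]
  proof (intro ballI impI)
    fix v assume v: "v \<in> coha.span C" "g v = 0"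
    then obtain p where p: "g v = \<phi> (pCons 0 p)" "v - s (\<phi> p) \<in> D"
      using g_span by blast
    then have "pCons 0 p = 0"
      using v(2) iso_inj[of "pCons 0 p" 0] by (simp add: iso_0)
    then have "v \<in> D"
      using p(2) by (simp add: iso_0 s.zero)
    then show "v = 0"
      using v(1) V_D unfolding span_C by blast
  qed
  then have g_indep: "coha.independent (g ` C)" and card_g: "card (g ` C) = card C"
    using pair.linear_independent_injective_image[OF g(1) C(2)] coha.span_superset[of C]
    by (auto intro: card_image inj_on_subset)
  have g_image: "\<exists>p. y = \<phi> (pCons 0 p)" "y \<in> ?V k" if "y \<in> coha.span (g ` C)" for y
  proof -
    obtain v where "v \<in> coha.span C" "y = g v"
      using \<open>y \<in> coha.span (g ` C)\<close> unfolding g.span_image by blast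
    then obtain p where p: "p \<in> tensor_x_bideg W \<gamma> (k - 2)" "y = \<phi> (pCons 0 p)"
      using g_span by metis
    then show "\<exists>p. y = \<phi> (pCons 0 p)" by blast
    show "y \<in> ?V k"
      using times_x_in_tensor[OF p(1)] iso_image[of \<gamma> k] p(2) by blast
  qed
  have "\<phi> [:w:] \<notin> coha.span (g ` C)"
    using g_image(1)[of "\<phi> [:w:]"] w(2) by (auto simp: iso_inj)
  then have indep: "coha.independent (insert (\<phi> [:w:]) (g ` C))" and new: "\<phi> [:w:] \<notin> g ` C"
    using coha.independent_insertI[OF _ g_indep] coha.span_superset[of "g ` C"] by blast+
  have "\<phi> [:w:] \<in> ?V k"
    using constant_in_tensor[OF w(1)] iso_image[of \<gamma> k] by blast
  then have "insert (\<phi> [:w:]) (g ` C) \<subseteq> coha.span C"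
    unfolding span_C using g_image(2) coha.span_superset[of "g ` C"] by blast
  then have "card (insert (\<phi> [:w:]) (g ` C)) \<le> card C"
    using coha.independent_span_bound[OF fin_C indep] by blast
  then show False
    using new fin_C card_g by simp
qed

end

theorem theorem1p2:
  fixes a :: "'i::finite \<Rightarrow> 'i \<Rightarrow> nat"
    and \<psi> :: "('i \<Rightarrow> bit) \<Rightarrow> ('i \<Rightarrow> bit) \<Rightarrow> bit"
    and V :: "'i coha set"
    and scale :: "rat \<Rightarrow> 'w::ab_group_add \<Rightarrow> 'w"
    and Vprim :: "('i \<Rightarrow> nat) \<Rightarrow> int \<Rightarrow> 'w set"
    and \<phi> :: "'w poly \<Rightarrow> 'i coha"
    and \<gamma> :: "'i \<Rightarrow> nat"
    and k :: int
  assumes "symmetric_quiver a"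
    and "sign_form a \<psi>"
    and "bigraded_subspace a V"
    and "free_supercomm_generated a \<psi> V"
    and "bigraded_space scale Vprim"
    and "bigraded_iso_tensor_x a scale Vprim V \<phi>"
    and "\<And>\<delta>. finite {l. Vprim \<delta> l \<noteq> {0}}"
    and "\<And>\<delta> l. fin_dim scale (Vprim \<delta> l)"
    and "Vprim \<gamma> k \<noteq> {0}"
  shows "\<gamma> \<noteq> (\<lambda>_. 0) \<and>
         k mod 2 = chi a \<gamma> \<gamma> mod 2 \<and>
         chi a \<gamma> \<gamma> \<le> k \<and>
         rat_of_int k < rat_of_int (chi a \<gamma> \<gamma>) + 2 * N_bound a \<gamma>"
proof -
  have \<psi>: "bilinear_form2 \<psi>"
    using assms(2) by (simp add: sign_form_def)
  note V_facts = \<psi> assms(3,4)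
  note iso_facts = assms(5,6)
  interpret W: vector_space scale
    using assms(5) by (simp add: bigraded_space_def)
  \<comment> \<open>A constant polynomial turns a non-zero element of \<open>Vprim\<close> into a generator of the same bidegree.\<close>
  obtain w where w: "w \<in> Vprim \<gamma> k" "w \<noteq> 0"
    using assms(9) W.subspace_0[OF W_subspace[OF iso_facts]] by blast
  define v where "v = \<phi> [:w:]"
  have v: "v \<in> V \<inter> coha_bideg a \<gamma> k"
    unfolding v_def iso_image[OF iso_facts, symmetric] using constant_in_tensor[OF iso_facts w(1)] by (rule imageI)
  have "v \<noteq> 0"
    using w(2) iso_inj[OF iso_facts, of "[:w:]" 0] by (simp add: v_def iso_0[OF iso_facts])
  have \<gamma>: "\<gamma> \<noteq> (\<lambda>_. 0)"
    using V_no_constants[OF V_facts] v \<open>v \<noteq> 0\<close> by blast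
  obtain f where f: "v = single \<gamma> f" "\<And>m. m \<in> keys f \<Longrightarrow> 2 * int (mon_degree m) + chi a \<gamma> \<gamma> = k"
    using v by (auto simp: coha_bideg_def)
  have "f \<noteq> 0"
    using \<open>v \<noteq> 0\<close> f(1) by auto
  then obtain m where "m \<in> keys f"
    by (metis all_not_in_conv keys_eq_empty)
  then have k: "k = 2 * int (mon_degree m) + chi a \<gamma> \<gamma>"
    using f(2) by simp
  have "rat_of_int k < rat_of_int (chi a \<gamma> \<gamma>) + 2 * N_bound a \<gamma>"
  proof (rule ccontr)
    assume "\<not> ?thesis"
    then have ge: "rat_of_int (chi a \<gamma> \<gamma>) + 2 * N_bound a \<gamma> \<le> rat_of_int k"
      by simp
    have "V \<inter> decomposables a \<psi> = {0}"
      using V_Int_decomposables[OF V_facts] coha.subspace_0[OF V_subspace[OF V_facts]]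
        coha.subspace_0[OF subspace_decomposables] by blast
    then have "Vprim \<gamma> k = {0}"
      using generator_from_lower_degree[OF assms(1) V_facts \<gamma> ge]
      by (intro no_new_generators[OF iso_facts assms(7,8) subspace_decomposables _ V_subspace[OF V_facts]
            module_hom_mult_sigma]) auto
    then show False
      using assms(9) by contradiction
  qed
  then show ?thesis
    using \<gamma> k by simp
qed

end
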